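(* To define a $p$-DG $2$-functor on $(\mathcal U,\partial)$ it suffices to define a $2$-functor on $\mathcal U^R$ with the correct action of $\partial$ on the images of the generators. Precisely: let $\mathcal K$ be a $p$-DG $2$-category and let $\Phi:\mathcal U^R\to\mathcal K$ be a graded $\Bbbk$-linear $2$-functor such that for every $m\in\mathbb Z$ $$\partial\Phi(x)=\Phi(x^2),\qquad\partial\Phi(\tau)=\Phi(1-2(x\mathcal E)\tau),\qquad\partial\Phi(\varepsilon_m)=(m+1)\Phi(\varepsilon_m(\mathcal Fx)),\qquad\partial\Phi(\eta_m)=(1-m)\Phi((x\mathcal F)\eta_m).$$ Then, transported through the equivalence $\mathcal U\cong\mathcal U^R$ matching the generators $x,\tau,\eta_m,\varepsilon_m$ with those of the same name, $\Phi$ gives a $p$-DG $2$-functor $(\mathcal U,\partial)\to\mathcal K$, i.e. a $2$-functor commuting with $\partial$ on all $2$-morphisms.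
   Context: $\Bbbk$ is a field of characteristic $p>0$. A $p$-DG $2$-category is a graded $\Bbbk$-linear additive $2$-category with grading shifts on $1$-morphisms whose $2$-morphism spaces carry degree-2 maps $\partial$ with $\partial^p=0$ satisfying the Leibniz rule for horizontal and vertical composition. $q^i$ denotes grading shift. Horizontal composition is written by juxtaposition. **$2$-category $\mathcal U$** (Khovanov–Lauda). Objects $m\in\mathbb Z$; $1$-morphisms are direct sums of shifts of composites of $\mathcal E1_m:m\to m+2$, $\mathcal F1_m:m\to m-2$. Generating $2$-morphisms: $x=x_{\mathcal E}\in\mathrm{End}(\mathcal E)$, $x_{\mathcal F}\in\mathrm{End}(\mathcal F)$ (degree 2), $\tau=\tau_{\mathcal E}\in\mathrm{End}(\mathcal{EE})$, $\tau_{\mathcal F}\in\mathrm{End}(\mathcal{FF})$ (degree $-2$), $\eta_m:1_m\to\mathcal{EF}1_m$, $\varepsilon'_m:\mathcal{EF}1_m\to1_m$ (degree $1-m$), $\varepsilon_m:\mathcal{FE}1_m\to1_m$, $\eta'_m:1_m\to\mathcal{FE}1_m$ (degree $1+m$). Clockwise bubbles: $c_k(m)=\varepsilon'_m(x^{k+m-1}\mathcal F)\eta_m$ if $k+m-1\ge0$; counterclockwise: $\bar c_k(m)=\varepsilon_m(\mathcal Fx^{k-m-1})\eta'_m$ if $k-m-1\ge0$; for other $k$ they are formal symbols (fake bubbles) determined by $c_k=\bar c_k=0$ ($k<0$), $c_0=\bar c_0=1$, $\sum_{i+j=k}c_i\bar c_j=\delta_{k,0}$, these relations being imposed for all $k$.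 Put $\sigma=(\varepsilon\mathcal{EF})(\mathcal F\tau\mathcal F)(\mathcal{FE}\eta):\mathcal{FE}\to\mathcal{EF}$, $\sigma'=(\mathcal{FE}\varepsilon')(\mathcal F\tau\mathcal F)(\eta'\mathcal{EF}):\mathcal{EF}\to\mathcal{FE}$. Relations: zigzag relations for $(\eta,\varepsilon)$ and $(\eta',\varepsilon')$; $\varepsilon(\mathcal Fx)=\varepsilon(x_{\mathcal F}\mathcal E)$, $\varepsilon'(x\mathcal F)=\varepsilon'(\mathcal Ex_{\mathcal F})$; $\varepsilon(\mathcal F\varepsilon\mathcal E)(\tau_{\mathcal F}\mathcal{EE})=\varepsilon(\mathcal F\varepsilon\mathcal E)(\mathcal{FF}\tau)$, $\varepsilon'(\mathcal E\varepsilon'\mathcal F)(\tau\mathcal{FF})=\varepsilon'(\mathcal E\varepsilon'\mathcal F)(\mathcal{EE}\tau_{\mathcal F})$; the nilHecke relations $\tau^2=0$, $(\tau\mathcal E)(\mathcal E\tau)(\tau\mathcal E)=(\mathcal E\tau)(\tau\mathcal E)(\mathcal E\tau)$, $\tau(x\mathcal E)-(\mathcal Ex)\tau=1=(x\mathcal E)\tau-\tau(\mathcal Ex)$; $(\mathcal E\varepsilon'_m)(\tau\mathcal F)(\mathcal E\eta_m)=-\sum_{i+j=-m}x^jc_i(m)$ on $\mathcal E1_m$; $(\varepsilon_m\mathcal E)(\mathcal F\tau)(\eta'_m\mathcal E)=\sum_{i+j=m}\bar c_i(m)x^j$ on $1_m\mathcal E$; $\mathrm{id}_{\mathcal{EF}1_m}=-\sigma\sigma'+\sum_{i+j+k=m-1}(x^k\mathcal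 F)\eta_m\bar c_j(m)\varepsilon'_m(x^i\mathcal F)$; $\mathrm{id}_{\mathcal{FE}1_m}=-\sigma'\sigma+\sum_{i+j+k=-m-1}(\mathcal Fx^k)\eta'_mc_j(m)\varepsilon_m(\mathcal Fx^i)$. Its $p$-differential $\partial$ is the unique one with $\partial x=x^2$, $\partial\tau=1-2(x\mathcal E)\tau$, $\partial\eta_m=(1-m)(x\mathcal F)\eta_m$, $\partial\varepsilon_m=(m+1)\varepsilon_m(\mathcal Fx)$. **$2$-category $\mathcal U^R$** (Rouquier). Same objects and $1$-morphisms. Generating $2$-morphisms: $x\in\mathrm{End}(\mathcal E)$ (degree 2), $\tau\in\mathrm{End}(\mathcal{EE})$ (degree $-2$), $\eta_m:1_m\to\mathcal{EF}1_m$ (degree $1-m$), $\varepsilon_m:\mathcal{FE}1_m\to1_m$ (degree $1+m$). Relations: zigzag relations for $(\eta,\varepsilon)$; the nilHecke relations $\tau^2=0$, $(\tau\mathcal E)(\mathcal E\tau)(\tau\mathcal E)=(\mathcal E\tau)(\tau\mathcal E)(\mathcal E\tau)$, $\tau(x\mathcal E)-(\mathcal Ex)\tau=1=(x\mathcal E)\tau-\tau(\mathcal Ex)$; and, with $\sigma=(\varepsilon\mathcal{EF})(\mathcal F\tau\mathcal F)(\mathcal{FE}\eta)$, the following maps are (formally made) invertible, grading shifts being chosen to make all components homogeneous of degree $0$: for $m\ge0$, $\big(\sigma,\ (x^j\mathcal F)\eta_m\ (0\le j\le m-1)\big):\mathcal{FE}1_m\oplus\bigoplus_{j=0}^{m-1}1_m\to\mathcal{EF}1_m$;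 for $m\le0$, $\big(\sigma,\ \varepsilon_m(\mathcal Fx^j)\ (0\le j\le-m-1)\big):\mathcal{FE}1_m\to\mathcal{EF}1_m\oplus\bigoplus_{j=0}^{-m-1}1_m$. By a theorem of Brundan there is an equivalence $\mathcal U\cong\mathcal U^R$ matching the generators $x,\tau,\eta_m,\varepsilon_m$.
   Formalization: Φ is also assumed to send the inclusions of direct summands and the grading-shift isomorphisms to 2-morphisms killed by ∂, and to have coherence isomorphisms killed by ∂ (automatic if Φ is strict); without this, twisting ∂ on shifted 1-morphisms refutes the claim. *)

theory Defs
  imports "HOL-Algebra.Algebraic_Closure_Type"
begin

section \<open>Graded linear 2-categories and p-differentials\<close>

text \<open>
  A strict 2-category whose spaces of 2-morphisms are graded \<open>'k\<close>-vector spaces.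
  \<open>Hom2 C f g\<close> is the whole space of 2-morphisms from \<open>f\<close> to \<open>g\<close> and \<open>Deg2 C f g d\<close> its
  homogeneous part of degree \<open>d\<close>. As usual, \<open>g \<diamondop> f\<close> is the composite ``first \<open>f\<close>, then \<open>g\<close>'',
  \<open>\<beta> \<bullet> \<alpha>\<close> the vertical composite ``first \<open>\<alpha>\<close>, then \<open>\<beta>\<close>'', and \<open>\<beta> \<star> \<alpha>\<close> horizontal composition.
\<close>

record ('o, 'f, 'a, 'k) gr2cat =
  Objs :: "'o set"
  Mor :: "'o \<Rightarrow> 'o \<Rightarrow> 'f set"
  Unit1 :: "'o \<Rightarrow> 'f"
  Comp1 :: "'f \<Rightarrow> 'f \<Rightarrow> 'f"  (infixr \<open>\<diamondop>\<index>\<close> 75)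
  Hom2 :: "'f \<Rightarrow> 'f \<Rightarrow> ('k, 'a) module"
  Deg2 :: "'f \<Rightarrow> 'f \<Rightarrow> int \<Rightarrow> 'a set"
  Id2 :: "'f \<Rightarrow> 'a"
  Vcomp :: "'a \<Rightarrow> 'a \<Rightarrow> 'a"  (infixr \<open>\<bullet>\<index>\<close> 72)
  Hcomp :: "'a \<Rightarrow> 'a \<Rightarrow> 'a"  (infixr \<open>\<star>\<index>\<close> 74)

abbreviation Cells :: "('o, 'f, 'a, 'k) gr2cat \<Rightarrow> 'f \<Rightarrow> 'f \<Rightarrow> 'a set"
  where "Cells C f g \<equiv> carrier (Hom2 C f g)"

locale graded_2cat =
  fixes C :: "('o, 'f, 'a, 'k::field) gr2cat" (structure)
  assumes Unit1_closed: "a \<in> Objs C \<Longrightarrow> Unit1 C a \<in> Mor C a a"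
    and Mor_objs: "f \<in> Mor C a b \<Longrightarrow> a \<in> Objs C \<and> b \<in> Objs C"
    and Comp1_closed: "\<lbrakk>f \<in> Mor C a b; g \<in> Mor C b c\<rbrakk> \<Longrightarrow> g \<diamondop> f \<in> Mor C a c"
    and Comp1_assoc: "\<lbrakk>f \<in> Mor C a b; g \<in> Mor C b c; h \<in> Mor C c c'\<rbrakk> \<Longrightarrow> (h \<diamondop> g) \<diamondop> f = h \<diamondop> (g \<diamondop> f)"
    and Comp1_unit: "f \<in> Mor C a b \<Longrightarrow> f \<diamondop> Unit1 C a = f" "f \<in> Mor C a b \<Longrightarrow> Unit1 C b \<diamondop> f = f"
    and Hom2_module: "\<lbrakk>f \<in> Mor C a b; g \<in> Mor C a b\<rbrakk> \<Longrightarrow> module ring_of_type_algebra (Hom2 C f g)"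
    and Deg2_submodule:
      "\<lbrakk>f \<in> Mor C a b; g \<in> Mor C a b\<rbrakk> \<Longrightarrow> submodule (Deg2 C f g d) ring_of_type_algebra (Hom2 C f g)"
    and Deg2_direct_sum:
      "\<lbrakk>f \<in> Mor C a b; g \<in> Mor C a b; \<alpha> \<in> Cells C f g\<rbrakk> \<Longrightarrow>
        \<exists>!u :: int \<Rightarrow> 'a. (\<forall>d. u d \<in> Deg2 C f g d) \<and> finite {d. u d \<noteq> \<zero>\<^bsub>Hom2 C f g\<^esub>} \<and>
          \<alpha> = finsum (Hom2 C f g) u {d. u d \<noteq> \<zero>\<^bsub>Hom2 C f g\<^esub>}"
    and Id2_closed: "f \<in> Mor C a b \<Longrightarrow> Id2 C f \<in> Deg2 C f f 0"
    and Vcomp_closed: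
      "\<lbrakk>f \<in> Mor C a b; g \<in> Mor C a b; h \<in> Mor C a b; \<alpha> \<in> Cells C f g; \<beta> \<in> Cells C g h\<rbrakk>
        \<Longrightarrow> \<beta> \<bullet> \<alpha> \<in> Cells C f h"
    and Vcomp_degree:
      "\<lbrakk>f \<in> Mor C a b; g \<in> Mor C a b; h \<in> Mor C a b; \<alpha> \<in> Deg2 C f g d; \<beta> \<in> Deg2 C g h e\<rbrakk>
        \<Longrightarrow> \<beta> \<bullet> \<alpha> \<in> Deg2 C f h (e + d)"
    and Vcomp_assoc:
      "\<lbrakk>f \<in> Mor C a b; g \<in> Mor C a b; h \<in> Mor C a b; k \<in> Mor C a b;
        \<alpha> \<in> Cells C f g; \<beta> \<in> Cells C g h; \<gamma> \<in> Cells C h k\<rbrakk> \<Longrightarrow> (\<gamma> \<bullet> \<beta>) \<bullet> \<alpha> = \<gamma> \<bullet> (\<beta> \<bullet> \<alpha>)"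
    and Vcomp_id:
      "\<lbrakk>f \<in> Mor C a b; g \<in> Mor C a b; \<alpha> \<in> Cells C f g\<rbrakk> \<Longrightarrow> \<alpha> \<bullet> Id2 C f = \<alpha>"
      "\<lbrakk>f \<in> Mor C a b; g \<in> Mor C a b; \<alpha> \<in> Cells C f g\<rbrakk> \<Longrightarrow> Id2 C g \<bullet> \<alpha> = \<alpha>"
    and Vcomp_add:
      "\<lbrakk>f \<in> Mor C a b; g \<in> Mor C a b; h \<in> Mor C a b; \<alpha> \<in> Cells C f g; \<alpha>' \<in> Cells C f g; \<beta> \<in> Cells C g h\<rbrakk>
        \<Longrightarrow> \<beta> \<bullet> (\<alpha> \<oplus>\<^bsub>Hom2 C f g\<^esub> \<alpha>') = (\<beta> \<bullet> \<alpha>) \<oplus>\<^bsub>Hom2 C f h\<^esub> (\<beta> \<bullet> \<alpha>')"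
      "\<lbrakk>f \<in> Mor C a b; g \<in> Mor C a b; h \<in> Mor C a b; \<alpha> \<in> Cells C f g; \<beta> \<in> Cells C g h; \<beta>' \<in> Cells C g h\<rbrakk>
        \<Longrightarrow> (\<beta> \<oplus>\<^bsub>Hom2 C g h\<^esub> \<beta>') \<bullet> \<alpha> = (\<beta> \<bullet> \<alpha>) \<oplus>\<^bsub>Hom2 C f h\<^esub> (\<beta>' \<bullet> \<alpha>)"
    and Vcomp_smult:
      "\<lbrakk>f \<in> Mor C a b; g \<in> Mor C a b; h \<in> Mor C a b; \<alpha> \<in> Cells C f g; \<beta> \<in> Cells C g h\<rbrakk>
        \<Longrightarrow> \<beta> \<bullet> (r \<odot>\<^bsub>Hom2 C f g\<^esub> \<alpha>) = r \<odot>\<^bsub>Hom2 C f h\<^esub> (\<beta> \<bullet> \<alpha>)"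
      "\<lbrakk>f \<in> Mor C a b; g \<in> Mor C a b; h \<in> Mor C a b; \<alpha> \<in> Cells C f g; \<beta> \<in> Cells C g h\<rbrakk>
        \<Longrightarrow> (r \<odot>\<^bsub>Hom2 C g h\<^esub> \<beta>) \<bullet> \<alpha> = r \<odot>\<^bsub>Hom2 C f h\<^esub> (\<beta> \<bullet> \<alpha>)"
    and Hcomp_closed:
      "\<lbrakk>f \<in> Mor C a b; f' \<in> Mor C a b; g \<in> Mor C b c; g' \<in> Mor C b c; \<alpha> \<in> Cells C f f'; \<beta> \<in> Cells C g g'\<rbrakk>
        \<Longrightarrow> \<beta> \<star> \<alpha> \<in> Cells C (g \<diamondop> f) (g' \<diamondop> f')"
    and Hcomp_degree:
      "\<lbrakk>f \<in> Mor C a b; f' \<in> Mor C a b; g \<in> Mor C b c; g' \<in> Mor C b c; \<alpha> \<in> Deg2 C f f' d; \<beta> \<in> Deg2 C g g' e\<rbrakk>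
        \<Longrightarrow> \<beta> \<star> \<alpha> \<in> Deg2 C (g \<diamondop> f) (g' \<diamondop> f') (e + d)"
    and Hcomp_assoc:
      "\<lbrakk>f \<in> Mor C a b; f' \<in> Mor C a b; g \<in> Mor C b c; g' \<in> Mor C b c; h \<in> Mor C c c'; h' \<in> Mor C c c';
        \<alpha> \<in> Cells C f f'; \<beta> \<in> Cells C g g'; \<gamma> \<in> Cells C h h'\<rbrakk> \<Longrightarrow> (\<gamma> \<star> \<beta>) \<star> \<alpha> = \<gamma> \<star> (\<beta> \<star> \<alpha>)"
    and Hcomp_unit:
      "\<lbrakk>f \<in> Mor C a b; f' \<in> Mor C a b; \<alpha> \<in> Cells C f f'\<rbrakk> \<Longrightarrow> \<alpha> \<star> Id2 C (Unit1 C a) = \<alpha>"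
      "\<lbrakk>f \<in> Mor C a b; f' \<in> Mor C a b; \<alpha> \<in> Cells C f f'\<rbrakk> \<Longrightarrow> Id2 C (Unit1 C b) \<star> \<alpha> = \<alpha>"
    and Hcomp_id: "\<lbrakk>f \<in> Mor C a b; g \<in> Mor C b c\<rbrakk> \<Longrightarrow> Id2 C g \<star> Id2 C f = Id2 C (g \<diamondop> f)"
    and interchange:
      "\<lbrakk>f \<in> Mor C a b; f' \<in> Mor C a b; f'' \<in> Mor C a b; g \<in> Mor C b c; g' \<in> Mor C b c; g'' \<in> Mor C b c;
        \<alpha> \<in> Cells C f f'; \<alpha>' \<in> Cells C f' f''; \<beta> \<in> Cells C g g'; \<beta>' \<in> Cells C g' g''\<rbrakk>
        \<Longrightarrow> (\<beta>' \<bullet> \<beta>) \<star> (\<alpha>' \<bullet> \<alpha>) = (\<beta>' \<star> \<alpha>') \<bullet> (\<beta> \<star> \<alpha>)"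
    and Hcomp_add:
      "\<lbrakk>f \<in> Mor C a b; f' \<in> Mor C a b; g \<in> Mor C b c; g' \<in> Mor C b c;
        \<alpha> \<in> Cells C f f'; \<alpha>' \<in> Cells C f f'; \<beta> \<in> Cells C g g'\<rbrakk>
        \<Longrightarrow> \<beta> \<star> (\<alpha> \<oplus>\<^bsub>Hom2 C f f'\<^esub> \<alpha>') = (\<beta> \<star> \<alpha>) \<oplus>\<^bsub>Hom2 C (g \<diamondop> f) (g' \<diamondop> f')\<^esub> (\<beta> \<star> \<alpha>')"
      "\<lbrakk>f \<in> Mor C a b; f' \<in> Mor C a b; g \<in> Mor C b c; g' \<in> Mor C b c;
        \<alpha> \<in> Cells C f f'; \<beta> \<in> Cells C g g'; \<beta>' \<in> Cells C g g'\<rbrakk>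
        \<Longrightarrow> (\<beta> \<oplus>\<^bsub>Hom2 C g g'\<^esub> \<beta>') \<star> \<alpha> = (\<beta> \<star> \<alpha>) \<oplus>\<^bsub>Hom2 C (g \<diamondop> f) (g' \<diamondop> f')\<^esub> (\<beta>' \<star> \<alpha>)"
    and Hcomp_smult:
      "\<lbrakk>f \<in> Mor C a b; f' \<in> Mor C a b; g \<in> Mor C b c; g' \<in> Mor C b c; \<alpha> \<in> Cells C f f'; \<beta> \<in> Cells C g g'\<rbrakk>
        \<Longrightarrow> \<beta> \<star> (r \<odot>\<^bsub>Hom2 C f f'\<^esub> \<alpha>) = r \<odot>\<^bsub>Hom2 C (g \<diamondop> f) (g' \<diamondop> f')\<^esub> (\<beta> \<star> \<alpha>)"
      "\<lbrakk>f \<in> Mor C a b; f' \<in> Mor C a b; g \<in> Mor C b c; g' \<in> Mor C b c; \<alpha> \<in> Cells C f f'; \<beta> \<in> Cells C g g'\<rbrakk>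
        \<Longrightarrow> (r \<odot>\<^bsub>Hom2 C g g'\<^esub> \<beta>) \<star> \<alpha> = r \<odot>\<^bsub>Hom2 C (g \<diamondop> f) (g' \<diamondop> f')\<^esub> (\<beta> \<star> \<alpha>)"

definition homogeneous_iso :: "('o, 'f, 'a, 'k) gr2cat \<Rightarrow> int \<Rightarrow> 'f \<Rightarrow> 'f \<Rightarrow> 'a \<Rightarrow> bool"
  where "homogeneous_iso C n f g \<alpha> \<longleftrightarrow> \<alpha> \<in> Deg2 C f g n \<and>
    (\<exists>\<beta> \<in> Deg2 C g f (- n). \<beta> \<bullet>\<^bsub>C\<^esub> \<alpha> = Id2 C f \<and> \<alpha> \<bullet>\<^bsub>C\<^esub> \<beta> = Id2 C g)"

text \<open>The grading shift \<open>q\<^sup>n f\<close> is a 1-morphism with a homogeneous isomorphism \<open>f \<rightarrow> q\<^sup>n f\<close> of degree \<open>n\<close>.\<close>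

locale additive_graded_2cat = graded_2cat +
  assumes zero_1morphism:
      "\<lbrakk>a \<in> Objs C; b \<in> Objs C\<rbrakk> \<Longrightarrow> \<exists>z \<in> Mor C a b. Id2 C z = \<zero>\<^bsub>Hom2 C z z\<^esub>"
    and direct_sum:
      "\<lbrakk>f \<in> Mor C a b; g \<in> Mor C a b\<rbrakk> \<Longrightarrow>
        \<exists>s \<in> Mor C a b. \<exists>\<iota> \<in> Deg2 C f s 0. \<exists>\<iota>' \<in> Deg2 C g s 0. \<exists>\<pi> \<in> Deg2 C s f 0. \<exists>\<pi>' \<in> Deg2 C s g 0.
          \<pi> \<bullet> \<iota> = Id2 C f \<and> \<pi>' \<bullet> \<iota>' = Id2 C g \<and> \<pi> \<bullet> \<iota>' = \<zero>\<^bsub>Hom2 C g f\<^esub> \<and> \<pi>' \<bullet> \<iota> = \<zero>\<^bsub>Hom2 C f g\<^esub> \<and>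
          (\<iota> \<bullet> \<pi>) \<oplus>\<^bsub>Hom2 C s s\<^esub> (\<iota>' \<bullet> \<pi>') = Id2 C s"
    and grading_shift: "f \<in> Mor C a b \<Longrightarrow> \<exists>f' \<in> Mor C a b. \<exists>s. homogeneous_iso C n f f' s"

locale p_differential =
  fixes p :: nat and C :: "('o, 'f, 'a, 'k::field) gr2cat" (structure) and \<delta> :: "'a \<Rightarrow> 'a"
  assumes d_closed: "\<lbrakk>f \<in> Mor C a b; g \<in> Mor C a b; \<alpha> \<in> Cells C f g\<rbrakk> \<Longrightarrow> \<delta> \<alpha> \<in> Cells C f g"
    and d_degree: "\<lbrakk>f \<in> Mor C a b; g \<in> Mor C a b; \<alpha> \<in> Deg2 C f g d\<rbrakk> \<Longrightarrow> \<delta> \<alpha> \<in> Deg2 C f g (d + 2)"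
    and d_add: "\<lbrakk>f \<in> Mor C a b; g \<in> Mor C a b; \<alpha> \<in> Cells C f g; \<beta> \<in> Cells C f g\<rbrakk>
        \<Longrightarrow> \<delta> (\<alpha> \<oplus>\<^bsub>Hom2 C f g\<^esub> \<beta>) = \<delta> \<alpha> \<oplus>\<^bsub>Hom2 C f g\<^esub> \<delta> \<beta>"
    and d_smult: "\<lbrakk>f \<in> Mor C a b; g \<in> Mor C a b; \<alpha> \<in> Cells C f g\<rbrakk>
        \<Longrightarrow> \<delta> (r \<odot>\<^bsub>Hom2 C f g\<^esub> \<alpha>) = r \<odot>\<^bsub>Hom2 C f g\<^esub> \<delta> \<alpha>"
    and d_nilpotent: "\<lbrakk>f \<in> Mor C a b; g \<in> Mor C a b; \<alpha> \<in> Cells C f g\<rbrakk> \<Longrightarrow> (\<delta> ^^ p) \<alpha> = \<zero>\<^bsub>Hom2 C f g\<^esub>"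
    and Leibniz_Vcomp:
      "\<lbrakk>f \<in> Mor C a b; g \<in> Mor C a b; h \<in> Mor C a b; \<alpha> \<in> Cells C f g; \<beta> \<in> Cells C g h\<rbrakk>
        \<Longrightarrow> \<delta> (\<beta> \<bullet> \<alpha>) = (\<delta> \<beta> \<bullet> \<alpha>) \<oplus>\<^bsub>Hom2 C f h\<^esub> (\<beta> \<bullet> \<delta> \<alpha>)"
    and Leibniz_Hcomp:
      "\<lbrakk>f \<in> Mor C a b; f' \<in> Mor C a b; g \<in> Mor C b c; g' \<in> Mor C b c; \<alpha> \<in> Cells C f f'; \<beta> \<in> Cells C g g'\<rbrakk>
        \<Longrightarrow> \<delta> (\<beta> \<star> \<alpha>) = (\<delta> \<beta> \<star> \<alpha>) \<oplus>\<^bsub>Hom2 C (g \<diamondop> f) (g' \<diamondop> f')\<^esub> (\<beta> \<star> \<delta> \<alpha>)"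

locale pdg_2cat = additive_graded_2cat C + p_differential p C \<delta>
  for p :: nat and C :: "('o, 'f, 'a, 'k::field) gr2cat" (structure) and \<delta> :: "'a \<Rightarrow> 'a"


section \<open>2-functors\<close>

text \<open>
  2-functors come with the isomorphisms \<open>fcmp F g f : F g \<diamondop> F f \<rightarrow> F (g \<diamondop> f)\<close> and
  \<open>funit F a : 1 \<rightarrow> F 1\<close>; strict 2-functors are those for which these are identities.
\<close>

record ('o, 'f, 'a, 'o1, 'f1, 'a1) fun2 =
  fobj :: "'o \<Rightarrow> 'o1"
  fmor :: "'f \<Rightarrow> 'f1"
  fcell :: "'a \<Rightarrow> 'a1"
  fcmp :: "'f \<Rightarrow> 'f \<Rightarrow> 'a1"
  funit :: "'o \<Rightarrow> 'a1"

locale graded_2functor =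
  fixes C :: "('o, 'f, 'a, 'k::field) gr2cat" and D :: "('o1, 'f1, 'a1, 'k) gr2cat"
    and F :: "('o, 'f, 'a, 'o1, 'f1, 'a1) fun2"
  assumes fobj_closed: "a \<in> Objs C \<Longrightarrow> fobj F a \<in> Objs D"
    and fmor_closed: "f \<in> Mor C a b \<Longrightarrow> fmor F f \<in> Mor D (fobj F a) (fobj F b)"
    and fcell_closed: "\<lbrakk>f \<in> Mor C a b; g \<in> Mor C a b; \<alpha> \<in> Cells C f g\<rbrakk>
        \<Longrightarrow> fcell F \<alpha> \<in> Cells D (fmor F f) (fmor F g)"
    and fcell_degree: "\<lbrakk>f \<in> Mor C a b; g \<in> Mor C a b; \<alpha> \<in> Deg2 C f g d\<rbrakk>
        \<Longrightarrow> fcell F \<alpha> \<in> Deg2 D (fmor F f) (fmor F g) d"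
    and fcell_add: "\<lbrakk>f \<in> Mor C a b; g \<in> Mor C a b; \<alpha> \<in> Cells C f g; \<beta> \<in> Cells C f g\<rbrakk>
        \<Longrightarrow> fcell F (\<alpha> \<oplus>\<^bsub>Hom2 C f g\<^esub> \<beta>) = fcell F \<alpha> \<oplus>\<^bsub>Hom2 D (fmor F f) (fmor F g)\<^esub> fcell F \<beta>"
    and fcell_smult: "\<lbrakk>f \<in> Mor C a b; g \<in> Mor C a b; \<alpha> \<in> Cells C f g\<rbrakk>
        \<Longrightarrow> fcell F (r \<odot>\<^bsub>Hom2 C f g\<^esub> \<alpha>) = r \<odot>\<^bsub>Hom2 D (fmor F f) (fmor F g)\<^esub> fcell F \<alpha>"
    and fcell_id: "f \<in> Mor C a b \<Longrightarrow> fcell F (Id2 C f) = Id2 D (fmor F f)"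
    and fcell_Vcomp:
      "\<lbrakk>f \<in> Mor C a b; g \<in> Mor C a b; h \<in> Mor C a b; \<alpha> \<in> Cells C f g; \<beta> \<in> Cells C g h\<rbrakk>
        \<Longrightarrow> fcell F (\<beta> \<bullet>\<^bsub>C\<^esub> \<alpha>) = fcell F \<beta> \<bullet>\<^bsub>D\<^esub> fcell F \<alpha>"
    and fcmp_iso: "\<lbrakk>f \<in> Mor C a b; g \<in> Mor C b c\<rbrakk>
        \<Longrightarrow> homogeneous_iso D 0 (fmor F g \<diamondop>\<^bsub>D\<^esub> fmor F f) (fmor F (g \<diamondop>\<^bsub>C\<^esub> f)) (fcmp F g f)"
    and funit_iso: "a \<in> Objs C
        \<Longrightarrow> homogeneous_iso D 0 (Unit1 D (fobj F a)) (fmor F (Unit1 C a)) (funit F a)"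
    and fcmp_natural:
      "\<lbrakk>f \<in> Mor C a b; f' \<in> Mor C a b; g \<in> Mor C b c; g' \<in> Mor C b c; \<alpha> \<in> Cells C f f'; \<beta> \<in> Cells C g g'\<rbrakk>
        \<Longrightarrow> fcell F (\<beta> \<star>\<^bsub>C\<^esub> \<alpha>) \<bullet>\<^bsub>D\<^esub> fcmp F g f = fcmp F g' f' \<bullet>\<^bsub>D\<^esub> (fcell F \<beta> \<star>\<^bsub>D\<^esub> fcell F \<alpha>)"
    and fcmp_assoc:
      "\<lbrakk>f \<in> Mor C a b; g \<in> Mor C b c; h \<in> Mor C c c'\<rbrakk>
        \<Longrightarrow> fcmp F (h \<diamondop>\<^bsub>C\<^esub> g) f \<bullet>\<^bsub>D\<^esub> (fcmp F h g \<star>\<^bsub>D\<^esub> Id2 D (fmor F f))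
          = fcmp F h (g \<diamondop>\<^bsub>C\<^esub> f) \<bullet>\<^bsub>D\<^esub> (Id2 D (fmor F h) \<star>\<^bsub>D\<^esub> fcmp F g f)"
    and fcmp_unit:
      "f \<in> Mor C a b \<Longrightarrow> fcmp F f (Unit1 C a) \<bullet>\<^bsub>D\<^esub> (Id2 D (fmor F f) \<star>\<^bsub>D\<^esub> funit F a) = Id2 D (fmor F f)"
      "f \<in> Mor C a b \<Longrightarrow> fcmp F (Unit1 C b) f \<bullet>\<^bsub>D\<^esub> (funit F b \<star>\<^bsub>D\<^esub> Id2 D (fmor F f)) = Id2 D (fmor F f)"

text \<open>
  For a target with differential, the structure isomorphisms of a 2-functor have to be isomorphisms
  of p-DG 1-morphisms, i.e. annihilated by the differential (for strict 2-functors this is automatic).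
\<close>

definition closed_coherence ::
    "('o, 'f, 'a, 'k::field) gr2cat \<Rightarrow> ('o1, 'f1, 'a1, 'k) gr2cat \<Rightarrow> ('a1 \<Rightarrow> 'a1) \<Rightarrow>
      ('o, 'f, 'a, 'o1, 'f1, 'a1) fun2 \<Rightarrow> bool"
  where "closed_coherence C D \<delta>D F \<longleftrightarrow>
    (\<forall>a b c. \<forall>f \<in> Mor C a b. \<forall>g \<in> Mor C b c.
      \<delta>D (fcmp F g f) = \<zero>\<^bsub>Hom2 D (fmor F g \<diamondop>\<^bsub>D\<^esub> fmor F f) (fmor F (g \<diamondop>\<^bsub>C\<^esub> f))\<^esub>) \<and>
    (\<forall>a \<in> Objs C. \<delta>D (funit F a) = \<zero>\<^bsub>Hom2 D (Unit1 D (fobj F a)) (fmor F (Unit1 C a))\<^esub>)"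

definition pdg_2functor ::
    "('o, 'f, 'a, 'k::field) gr2cat \<Rightarrow> ('a \<Rightarrow> 'a) \<Rightarrow> ('o1, 'f1, 'a1, 'k) gr2cat \<Rightarrow> ('a1 \<Rightarrow> 'a1) \<Rightarrow>
      ('o, 'f, 'a, 'o1, 'f1, 'a1) fun2 \<Rightarrow> bool"
  where "pdg_2functor C \<delta>C D \<delta>D F \<longleftrightarrow>
    graded_2functor C D F \<and> closed_coherence C D \<delta>D F \<and>
    (\<forall>a b. \<forall>f \<in> Mor C a b. \<forall>g \<in> Mor C a b. \<forall>\<alpha> \<in> Cells C f g. \<delta>D (fcell F \<alpha>) = fcell F (\<delta>C \<alpha>))"


section \<open>Adjoining direct sums and grading shifts\<close>

text \<open>
  A 1-morphism \<open>(a, b, [(n\<^sub>1, f\<^sub>1), \<dots>, (n\<^sub>r, f\<^sub>r)])\<close> from \<open>a\<close> to \<open>b\<close> is the formal direct sum of the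
  shifts \<open>q\<^sup>n\<^sup>i f\<^sub>i\<close>. A 2-morphism is a matrix of 2-morphisms of the given 2-category, recorded with its
  source and target; the entry in row \<open>i\<close> and column \<open>j\<close> goes from summand \<open>j\<close> of the source to
  summand \<open>i\<close> of the target. A 2-morphism \<open>f \<rightarrow> g\<close> of degree \<open>d\<close> has degree \<open>d + m - n\<close> as a
  2-morphism \<open>q\<^sup>n f \<rightarrow> q\<^sup>m g\<close>.
\<close>

type_synonym ('o, 'f) sum1 = "'o \<times> 'o \<times> (int \<times> 'f) list"
type_synonym ('o, 'f, 'a) sum2 = "('o, 'f) sum1 \<times> ('o, 'f) sum1 \<times> (nat \<Rightarrow> nat \<Rightarrow> 'a)"

definition rk :: "('o, 'f) sum1 \<Rightarrow> nat"
  where "rk A = length (snd (snd A))"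

definition summand :: "('o, 'f) sum1 \<Rightarrow> nat \<Rightarrow> 'f"
  where "summand A i = snd (snd (snd A) ! i)"

definition shift_of :: "('o, 'f) sum1 \<Rightarrow> nat \<Rightarrow> int"
  where "shift_of A i = fst (snd (snd A) ! i)"

definition mk2 :: "('o, 'f) sum1 \<Rightarrow> ('o, 'f) sum1 \<Rightarrow> (nat \<Rightarrow> nat \<Rightarrow> 'a) \<Rightarrow> ('o, 'f, 'a) sum2"
  where "mk2 A B M = (A, B, \<lambda>i j. if i < rk B \<and> j < rk A then M i j else undefined)"

definition comp_sum1 :: "('o, 'f, 'a, 'k) gr2cat \<Rightarrow> ('o, 'f) sum1 \<Rightarrow> ('o, 'f) sum1 \<Rightarrow> ('o, 'f) sum1"
  where "comp_sum1 C B A = (fst A, fst (snd B),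
    concat (map (\<lambda>(m, g). map (\<lambda>(n, f). (m + n, g \<diamondop>\<^bsub>C\<^esub> f)) (snd (snd A))) (snd (snd B))))"

definition hom_sum2 ::
    "('o, 'f, 'a, 'k) gr2cat \<Rightarrow> ('o, 'f) sum1 \<Rightarrow> ('o, 'f) sum1 \<Rightarrow> ('k, ('o, 'f, 'a) sum2) module"
  where "hom_sum2 C A B =
    \<lparr> carrier = {mk2 A B M | M. \<forall>i < rk B. \<forall>j < rk A. M i j \<in> Cells C (summand A j) (summand B i)},
      monoid.mult = undefined,
      one = undefined,
      ring.zero = mk2 A B (\<lambda>i j. \<zero>\<^bsub>Hom2 C (summand A j) (summand B i)\<^esub>),
      add = (\<lambda>(_, _, M) (_, _, N). mk2 A B (\<lambda>i j. M i j \<oplus>\<^bsub>Hom2 C (summand A j) (summand B i)\<^esub> N i j)),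
      module.smult = (\<lambda>r (_, _, M). mk2 A B (\<lambda>i j. r \<odot>\<^bsub>Hom2 C (summand A j) (summand B i)\<^esub> M i j)) \<rparr>"

definition id_sum2 :: "('o, 'f, 'a, 'k) gr2cat \<Rightarrow> ('o, 'f) sum1 \<Rightarrow> ('o, 'f, 'a) sum2"
  where "id_sum2 C A = mk2 A A (\<lambda>i j. if i = j then Id2 C (summand A i)
      else \<zero>\<^bsub>Hom2 C (summand A j) (summand A i)\<^esub>)"

definition add_closure ::
    "('o, 'f, 'a, 'k) gr2cat \<Rightarrow> ('o, ('o, 'f) sum1, ('o, 'f, 'a) sum2, 'k) gr2cat"
  where "add_closure C =
    \<lparr> Objs = Objs C,
      Mor = (\<lambda>a b. {(a, b, L) | L. a \<in> Objs C \<and> b \<in> Objs C \<and> snd ` set L \<subseteq> Mor C a b}),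
      Unit1 = (\<lambda>a. (a, a, [(0, Unit1 C a)])),
      Comp1 = comp_sum1 C,
      Hom2 = hom_sum2 C,
      Deg2 = (\<lambda>A B d. {mk2 A B M | M. \<forall>i < rk B. \<forall>j < rk A.
        M i j \<in> Deg2 C (summand A j) (summand B i) (d - shift_of B i + shift_of A j)}),
      Id2 = id_sum2 C,
      Vcomp = (\<lambda>(B, D, N) (A, _, M). mk2 A D (\<lambda>i k.
        finsum (Hom2 C (summand A k) (summand D i)) (\<lambda>j. N i j \<bullet>\<^bsub>C\<^esub> M j k) {..<rk B})),
      Hcomp = (\<lambda>(A', B', N) (A, B, M). mk2 (comp_sum1 C A' A) (comp_sum1 C B' B) (\<lambda>i j.
        N (i div rk B) (j div rk A) \<star>\<^bsub>C\<^esub> M (i mod rk B) (j mod rk A))) \<rparr>"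

definition incl :: "('o, 'f, 'a, 'k) gr2cat \<Rightarrow> ('o, 'f) sum1 \<Rightarrow> nat \<Rightarrow> ('o, 'f, 'a) sum2"
  where "incl C A i = mk2 (fst A, fst (snd A), [snd (snd A) ! i]) A (\<lambda>j _.
    if j = i then Id2 C (summand A i) else \<zero>\<^bsub>Hom2 C (summand A i) (summand A j)\<^esub>)"

definition shift_iso :: "('o, 'f, 'a, 'k) gr2cat \<Rightarrow> 'o \<Rightarrow> 'o \<Rightarrow> int \<Rightarrow> 'f \<Rightarrow> ('o, 'f, 'a) sum2"
  where "shift_iso C a b n f = mk2 (a, b, [(0, f)]) (a, b, [(n, f)]) (\<lambda>_ _. Id2 C f)"

text \<open>
  A 2-functor on \<open>add_closure C\<close> with values in a p-DG 2-category sends formal direct sums and formal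
  shifts to direct sums and shifts of p-DG 1-morphisms if the images of their structure maps are
  annihilated by the differential. (For projections and inverse shift isomorphisms this then follows
  from the Leibniz rule.)
\<close>

definition closed_sums_shifts ::
    "('o, 'f, 'a, 'k::field) gr2cat \<Rightarrow> ('o1, 'f1, 'a1, 'k) gr2cat \<Rightarrow> ('a1 \<Rightarrow> 'a1) \<Rightarrow>
      ('o, ('o, 'f) sum1, ('o, 'f, 'a) sum2, 'o1, 'f1, 'a1) fun2 \<Rightarrow> bool"
  where "closed_sums_shifts C D \<delta>D F \<longleftrightarrow>
    (\<forall>a b. \<forall>A \<in> Mor (add_closure C) a b. \<forall>i < rk A. \<delta>D (fcell F (incl C A i)) =
      \<zero>\<^bsub>Hom2 D (fmor F (a, b, [snd (snd A) ! i])) (fmor F A)\<^esub>) \<and>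
    (\<forall>a b. \<forall>f \<in> Mor C a b. \<forall>n. \<delta>D (fcell F (shift_iso C a b n f)) =
      \<zero>\<^bsub>Hom2 D (fmor F (a, b, [(0, f)])) (fmor F (a, b, [(n, f)]))\<^esub>)"


section \<open>Presentations by generators and relations\<close>

datatype letter = \<E> | \<F>

text \<open>\<open>(w, m)\<close> is the composite of \<open>\<E>\<close>s and \<open>\<F>\<close>s spelled by \<open>w\<close>, starting at the object \<open>m\<close>: e.g.
  \<open>([\<E>, \<F>], m)\<close> is \<open>\<E>\<F>1\<^sub>m\<close>.\<close>

type_synonym word = "letter list \<times> int"

definition tgt :: "word \<Rightarrow> int"
  where "tgt f = snd f + (\<Sum>l\<leftarrow>fst f. case l of \<E> \<Rightarrow> 2 | \<F> \<Rightarrow> - 2)"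

definition wcomp :: "word \<Rightarrow> word \<Rightarrow> word"
  where "wcomp g f = (fst g @ fst f, snd f)"

text \<open>
  The generators of both 2-categories. \<open>Dot\<close>, \<open>Cross\<close>, \<open>Eta\<close>, \<open>Epsilon\<close> are the common ones, \<open>Dot\<close> and \<open>Cross\<close> being
  indexed by the source of the 1-morphism on which they act.
  \<open>DotF\<close>, \<open>CrossF\<close>, \<open>Eta'\<close>, \<open>Epsilon'\<close> are the other generators of Khovanov and Lauda's 2-category, and
  \<open>Fake m k\<close>, \<open>Fake' m k\<close> its formal symbols \<open>c\<^sub>k(m)\<close> and \<open>c'\<^sub>k(m)\<close> (for the counterclockwise bubble).
  \<open>InvS\<close>, \<open>InvP\<close>, \<open>InvI\<close> are the matrix entries of the formal inverses in Rouquier's 2-category.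
\<close>

datatype gen = Dot int | Cross int | Eta int | Epsilon int
  | DotF int | CrossF int | Eta' int | Epsilon' int | Fake int int | Fake' int int
  | InvS int | InvP int nat | InvI int nat

primrec gsrc :: "gen \<Rightarrow> word" where
  "gsrc (Dot m) = ([\<E>], m)"
| "gsrc (Cross m) = ([\<E>, \<E>], m)"
| "gsrc (Eta m) = ([], m)"
| "gsrc (Epsilon m) = ([\<F>, \<E>], m)"
| "gsrc (DotF m) = ([\<F>], m)"
| "gsrc (CrossF m) = ([\<F>, \<F>], m)"
| "gsrc (Eta' m) = ([], m)"
| "gsrc (Epsilon' m) = ([\<E>, \<F>], m)"
| "gsrc (Fake m k) = ([], m)"
| "gsrc (Fake' m k) = ([], m)"
| "gsrc (InvS m) = ([\<E>, \<F>], m)"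
| "gsrc (InvP m j) = ([\<E>, \<F>], m)"
| "gsrc (InvI m j) = ([], m)"

primrec gtgt :: "gen \<Rightarrow> word" where
  "gtgt (Dot m) = ([\<E>], m)"
| "gtgt (Cross m) = ([\<E>, \<E>], m)"
| "gtgt (Eta m) = ([\<E>, \<F>], m)"
| "gtgt (Epsilon m) = ([], m)"
| "gtgt (DotF m) = ([\<F>], m)"
| "gtgt (CrossF m) = ([\<F>, \<F>], m)"
| "gtgt (Eta' m) = ([\<F>, \<E>], m)"
| "gtgt (Epsilon' m) = ([], m)"
| "gtgt (Fake m k) = ([], m)"
| "gtgt (Fake' m k) = ([], m)"
| "gtgt (InvS m) = ([\<F>, \<E>], m)"
| "gtgt (InvP m j) = ([], m)"
| "gtgt (InvI m j) = ([\<F>, \<E>], m)"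

primrec gdeg :: "gen \<Rightarrow> int" where
  "gdeg (Dot m) = 2"
| "gdeg (Cross m) = - 2"
| "gdeg (Eta m) = 1 - m"
| "gdeg (Epsilon m) = 1 + m"
| "gdeg (DotF m) = 2"
| "gdeg (CrossF m) = - 2"
| "gdeg (Eta' m) = 1 + m"
| "gdeg (Epsilon' m) = 1 - m"
| "gdeg (Fake m k) = 2 * k"
| "gdeg (Fake' m k) = 2 * k"
| "gdeg (InvS m) = 0"
| "gdeg (InvP m j) = - (2 * int j + 1 - m)"
| "gdeg (InvI m j) = - (2 * int j + 1 + m)"

datatype 'k trm = Gen gen | Idt word | Ze word word
  | Ad "'k trm" "'k trm" (infixl \<open>+\<^sub>t\<close> 65)
  | Sm 'k "'k trm"  (infixr \<open>*\<^sub>t\<close> 68)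
  | Vc "'k trm" "'k trm"  (infixr \<open>\<bullet>\<^sub>t\<close> 70)
  | Hc "'k trm" "'k trm"  (infixr \<open>\<star>\<^sub>t\<close> 75)

primrec tdom :: "'k trm \<Rightarrow> word" where
  "tdom (Gen g) = gsrc g"
| "tdom (Idt f) = f"
| "tdom (Ze f g) = f"
| "tdom (s +\<^sub>t t) = tdom s"
| "tdom (r *\<^sub>t t) = tdom t"
| "tdom (s \<bullet>\<^sub>t t) = tdom t"
| "tdom (s \<star>\<^sub>t t) = wcomp (tdom s) (tdom t)"

primrec tcod :: "'k trm \<Rightarrow> word" where
  "tcod (Gen g) = gtgt g"
| "tcod (Idt f) = f"
| "tcod (Ze f g) = g"
| "tcod (s +\<^sub>t t) = tcod s"
| "tcod (r *\<^sub>t t) = tcod t"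
| "tcod (s \<bullet>\<^sub>t t) = tcod s"
| "tcod (s \<star>\<^sub>t t) = wcomp (tcod s) (tcod t)"

primrec wft :: "gen set \<Rightarrow> 'k trm \<Rightarrow> bool" where
  "wft G (Gen g) \<longleftrightarrow> g \<in> G"
| "wft G (Idt f) \<longleftrightarrow> True"
| "wft G (Ze f g) \<longleftrightarrow> snd f = snd g \<and> tgt f = tgt g"
| "wft G (s +\<^sub>t t) \<longleftrightarrow> wft G s \<and> wft G t \<and> tdom s = tdom t \<and> tcod s = tcod t"
| "wft G (r *\<^sub>t t) \<longleftrightarrow> wft G t"
| "wft G (s \<bullet>\<^sub>t t) \<longleftrightarrow> wft G s \<and> wft G t \<and> tdom s = tcod t"
| "wft G (s \<star>\<^sub>t t) \<longleftrightarrow> wft G s \<and> wft G t \<and> snd (tdom s) = tgt (tdom t)"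

primrec homog :: "int \<Rightarrow> 'k trm \<Rightarrow> bool" where
  "homog d (Gen g) \<longleftrightarrow> d = gdeg g"
| "homog d (Idt f) \<longleftrightarrow> d = 0"
| "homog d (Ze f g) \<longleftrightarrow> True"
| "homog d (s +\<^sub>t t) \<longleftrightarrow> homog d s \<and> homog d t"
| "homog d (r *\<^sub>t t) \<longleftrightarrow> homog d t"
| "homog d (s \<bullet>\<^sub>t t) \<longleftrightarrow> (\<exists>e. homog e s \<and> homog (d - e) t)"
| "homog d (s \<star>\<^sub>t t) \<longleftrightarrow> (\<exists>e. homog e s \<and> homog (d - e) t)"

text \<open>The congruence generated by the relations \<open>R\<close> and the axioms of a linear 2-category, on the
  well-formed terms in the generators \<open>G\<close>.\<close>

inductive teq :: "gen set \<Rightarrow> ('k::field trm \<times> 'k trm) set \<Rightarrow> 'k trm \<Rightarrow> 'k trm \<Rightarrow> bool"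
  for G :: "gen set" and R :: "('k::field trm \<times> 'k trm) set" where
  rel: "\<lbrakk>(s, t) \<in> R; wft G s; wft G t\<rbrakk> \<Longrightarrow> teq G R s t"
| refl: "wft G t \<Longrightarrow> teq G R t t"
| sym: "teq G R s t \<Longrightarrow> teq G R t s"
| trans: "\<lbrakk>teq G R s t; teq G R t u\<rbrakk> \<Longrightarrow> teq G R s u"
| cong_Ad: "\<lbrakk>teq G R s s'; teq G R t t'; wft G (s +\<^sub>t t)\<rbrakk> \<Longrightarrow> teq G R (s +\<^sub>t t) (s' +\<^sub>t t')"
| cong_Sm: "teq G R t t' \<Longrightarrow> teq G R (r *\<^sub>t t) (r *\<^sub>t t')"
| cong_Vc: "\<lbrakk>teq G R s s'; teq G R t t'; wft G (s \<bullet>\<^sub>t t)\<rbrakk> \<Longrightarrow> teq G R (s \<bullet>\<^sub>t t) (s' \<bullet>\<^sub>t t')"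
| cong_Hc: "\<lbrakk>teq G R s s'; teq G R t t'; wft G (s \<star>\<^sub>t t)\<rbrakk> \<Longrightarrow> teq G R (s \<star>\<^sub>t t) (s' \<star>\<^sub>t t')"
| Ad_assoc: "wft G (s +\<^sub>t t +\<^sub>t u) \<Longrightarrow> teq G R (s +\<^sub>t t +\<^sub>t u) (s +\<^sub>t (t +\<^sub>t u))"
| Ad_comm: "wft G (s +\<^sub>t t) \<Longrightarrow> teq G R (s +\<^sub>t t) (t +\<^sub>t s)"
| Ad_zero: "wft G t \<Longrightarrow> teq G R (Ze (tdom t) (tcod t) +\<^sub>t t) t"
| Ad_minus: "wft G t \<Longrightarrow> teq G R (t +\<^sub>t (- 1) *\<^sub>t t) (Ze (tdom t) (tcod t))"
| Sm_Ad: "wft G (s +\<^sub>t t) \<Longrightarrow> teq G R (r *\<^sub>t (s +\<^sub>t t)) (r *\<^sub>t s +\<^sub>t r *\<^sub>t t)"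
| Sm_add: "wft G t \<Longrightarrow> teq G R ((r + r') *\<^sub>t t) (r *\<^sub>t t +\<^sub>t r' *\<^sub>t t)"
| Sm_mult: "wft G t \<Longrightarrow> teq G R ((r * r') *\<^sub>t t) (r *\<^sub>t r' *\<^sub>t t)"
| Sm_one: "wft G t \<Longrightarrow> teq G R (1 *\<^sub>t t) t"
| Vc_assoc: "wft G ((s \<bullet>\<^sub>t t) \<bullet>\<^sub>t u) \<Longrightarrow> teq G R ((s \<bullet>\<^sub>t t) \<bullet>\<^sub>t u) (s \<bullet>\<^sub>t (t \<bullet>\<^sub>t u))"
| Vc_id_right: "wft G t \<Longrightarrow> teq G R (t \<bullet>\<^sub>t Idt (tdom t)) t"
| Vc_id_left: "wft G t \<Longrightarrow> teq G R (Idt (tcod t) \<bullet>\<^sub>t t) t"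
| Vc_Ad_left: "wft G ((s +\<^sub>t s') \<bullet>\<^sub>t t) \<Longrightarrow> teq G R ((s +\<^sub>t s') \<bullet>\<^sub>t t) (s \<bullet>\<^sub>t t +\<^sub>t s' \<bullet>\<^sub>t t)"
| Vc_Ad_right: "wft G (s \<bullet>\<^sub>t (t +\<^sub>t t')) \<Longrightarrow> teq G R (s \<bullet>\<^sub>t (t +\<^sub>t t')) (s \<bullet>\<^sub>t t +\<^sub>t s \<bullet>\<^sub>t t')"
| Vc_Sm_left: "wft G (s \<bullet>\<^sub>t t) \<Longrightarrow> teq G R ((r *\<^sub>t s) \<bullet>\<^sub>t t) (r *\<^sub>t (s \<bullet>\<^sub>t t))"
| Vc_Sm_right: "wft G (s \<bullet>\<^sub>t t) \<Longrightarrow> teq G R (s \<bullet>\<^sub>t (r *\<^sub>t t)) (r *\<^sub>t (s \<bullet>\<^sub>t t))"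
| Hc_assoc: "wft G ((s \<star>\<^sub>t t) \<star>\<^sub>t u) \<Longrightarrow> teq G R ((s \<star>\<^sub>t t) \<star>\<^sub>t u) (s \<star>\<^sub>t (t \<star>\<^sub>t u))"
| Hc_unit_right: "wft G t \<Longrightarrow> teq G R (t \<star>\<^sub>t Idt ([], snd (tdom t))) t"
| Hc_unit_left: "wft G t \<Longrightarrow> teq G R (Idt ([], tgt (tdom t)) \<star>\<^sub>t t) t"
| Hc_Idt: "snd g = tgt f \<Longrightarrow> teq G R (Idt g \<star>\<^sub>t Idt f) (Idt (wcomp g f))"
| interchange: "\<lbrakk>wft G (s' \<bullet>\<^sub>t s); wft G (t' \<bullet>\<^sub>t t); wft G (s \<star>\<^sub>t t)\<rbrakk>
    \<Longrightarrow> teq G R ((s' \<bullet>\<^sub>t s) \<star>\<^sub>t (t' \<bullet>\<^sub>t t)) ((s' \<star>\<^sub>t t') \<bullet>\<^sub>t (s \<star>\<^sub>t t))"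
| Hc_Ad_left: "wft G ((s +\<^sub>t s') \<star>\<^sub>t t) \<Longrightarrow> teq G R ((s +\<^sub>t s') \<star>\<^sub>t t) (s \<star>\<^sub>t t +\<^sub>t s' \<star>\<^sub>t t)"
| Hc_Ad_right: "wft G (s \<star>\<^sub>t (t +\<^sub>t t')) \<Longrightarrow> teq G R (s \<star>\<^sub>t (t +\<^sub>t t')) (s \<star>\<^sub>t t +\<^sub>t s \<star>\<^sub>t t')"
| Hc_Sm_left: "wft G (s \<star>\<^sub>t t) \<Longrightarrow> teq G R ((r *\<^sub>t s) \<star>\<^sub>t t) (r *\<^sub>t (s \<star>\<^sub>t t))"
| Hc_Sm_right: "wft G (s \<star>\<^sub>t t) \<Longrightarrow> teq G R (s \<star>\<^sub>t (r *\<^sub>t t)) (r *\<^sub>t (s \<star>\<^sub>t t))"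

definition cls :: "gen set \<Rightarrow> ('k::field trm \<times> 'k trm) set \<Rightarrow> 'k trm \<Rightarrow> 'k trm set"
  where "cls G R t = {s. teq G R t s}"

definition pres_hom ::
    "gen set \<Rightarrow> ('k::field trm \<times> 'k trm) set \<Rightarrow> word \<Rightarrow> word \<Rightarrow> ('k, 'k trm set) module"
  where "pres_hom G R f g =
    \<lparr> carrier = {cls G R t | t. wft G t \<and> tdom t = f \<and> tcod t = g},
      monoid.mult = undefined,
      one = undefined,
      ring.zero = cls G R (Ze f g),
      add = (\<lambda>S S'. \<Union>s\<in>S. \<Union>t\<in>S'. cls G R (s +\<^sub>t t)),
      module.smult = (\<lambda>r S. \<Union>s\<in>S. cls G R (r *\<^sub>t s)) \<rparr>"

definition presented ::
    "gen set \<Rightarrow> ('k::field trm \<times> 'k trm) set \<Rightarrow> (int, word, 'k trm set, 'k) gr2cat"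
  where "presented G R =
    \<lparr> Objs = UNIV,
      Mor = (\<lambda>a b. {f. snd f = a \<and> tgt f = b}),
      Unit1 = (\<lambda>a. ([], a)),
      Comp1 = wcomp,
      Hom2 = pres_hom G R,
      Deg2 = (\<lambda>f g d. {cls G R t | t. wft G t \<and> tdom t = f \<and> tcod t = g \<and> homog d t}),
      Id2 = (\<lambda>f. cls G R (Idt f)),
      Vcomp = (\<lambda>S S'. \<Union>s\<in>S. \<Union>t\<in>S'. cls G R (s \<bullet>\<^sub>t t)),
      Hcomp = (\<lambda>S S'. \<Union>s\<in>S. \<Union>t\<in>S'. cls G R (s \<star>\<^sub>t t)) \<rparr>"

text \<open>The class of a term as a 2-morphism between unshifted one-summand 1-morphisms.\<close>

type_synonym mor1 = "(int, word) sum1"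
type_synonym 'k mor2 = "(int, word, 'k trm set) sum2"

definition wrd :: "word \<Rightarrow> mor1"
  where "wrd f = (snd f, tgt f, [(0, f)])"

definition cell :: "gen set \<Rightarrow> ('k::field trm \<times> 'k trm) set \<Rightarrow> 'k trm \<Rightarrow> 'k mor2"
  where "cell G R t = mk2 (wrd (tdom t)) (wrd (tcod t)) (\<lambda>_ _. cls G R t)"


section \<open>The 2-categories of Khovanov--Lauda and of Rouquier\<close>

abbreviation idE :: "int \<Rightarrow> 'k trm" where "idE m \<equiv> Idt ([\<E>], m)"
abbreviation idF :: "int \<Rightarrow> 'k trm" where "idF m \<equiv> Idt ([\<F>], m)"
abbreviation idEE :: "int \<Rightarrow> 'k trm" where "idEE m \<equiv> Idt ([\<E>, \<E>], m)"
abbreviation idFF :: "int \<Rightarrow> 'k trm" where "idFF m \<equiv> Idt ([\<F>, \<F>], m)"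
abbreviation idEF :: "int \<Rightarrow> 'k trm" where "idEF m \<equiv> Idt ([\<E>, \<F>], m)"
abbreviation idFE :: "int \<Rightarrow> 'k trm" where "idFE m \<equiv> Idt ([\<F>, \<E>], m)"
abbreviation id1 :: "int \<Rightarrow> 'k trm" where "id1 m \<equiv> Idt ([], m)"

abbreviation minus_trm :: "'k::field trm \<Rightarrow> 'k trm \<Rightarrow> 'k trm"  (infixl \<open>-\<^sub>t\<close> 65)
  where "s -\<^sub>t t \<equiv> s +\<^sub>t (- 1) *\<^sub>t t"

definition tsum :: "word \<Rightarrow> word \<Rightarrow> 'k trm list \<Rightarrow> 'k trm"
  where "tsum f g ts = foldr Ad ts (Ze f g)"

definition dots :: "int \<Rightarrow> nat \<Rightarrow> 'k trm"
  where "dots m n = ((\<lambda>t. Gen (Dot m) \<bullet>\<^sub>t t) ^^ n) (idE m)"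

definition bub :: "int \<Rightarrow> int \<Rightarrow> 'k trm"
  where "bub m k = (if k + m - 1 \<ge> 0
    then Gen (Epsilon' m) \<bullet>\<^sub>t (dots (m - 2) (nat (k + m - 1)) \<star>\<^sub>t idF m) \<bullet>\<^sub>t Gen (Eta m)
    else Gen (Fake m k))"

definition bub' :: "int \<Rightarrow> int \<Rightarrow> 'k trm"
  where "bub' m k = (if k - m - 1 \<ge> 0
    then Gen (Epsilon m) \<bullet>\<^sub>t (idF (m + 2) \<star>\<^sub>t dots m (nat (k - m - 1))) \<bullet>\<^sub>t Gen (Eta' m)
    else Gen (Fake' m k))"

definition sig :: "int \<Rightarrow> 'k trm"
  where "sig m = (Gen (Epsilon m) \<star>\<^sub>t idEF m) \<bullet>\<^sub>t (idF (m + 2) \<star>\<^sub>t Gen (Cross (m - 2)) \<star>\<^sub>t idF m)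
    \<bullet>\<^sub>t (idFE m \<star>\<^sub>t Gen (Eta m))"

definition sig' :: "int \<Rightarrow> 'k trm"
  where "sig' m = (idFE m \<star>\<^sub>t Gen (Epsilon' m)) \<bullet>\<^sub>t (idF (m + 2) \<star>\<^sub>t Gen (Cross (m - 2)) \<star>\<^sub>t idF m)
    \<bullet>\<^sub>t (Gen (Eta' m) \<star>\<^sub>t idEF m)"

text \<open>The relations common to both 2-categories: zigzag relations and nilHecke relations.\<close>

inductive_set common_rels :: "('k::field trm \<times> 'k trm) set" where
  zigzag_E: "((idE m \<star>\<^sub>t Gen (Epsilon m)) \<bullet>\<^sub>t (Gen (Eta (m + 2)) \<star>\<^sub>t idE m), idE m) \<in> common_rels"
| zigzag_F: "((Gen (Epsilon (m - 2)) \<star>\<^sub>t idF m) \<bullet>\<^sub>t (idF m \<star>\<^sub>t Gen (Eta m)), idF m) \<in> common_rels"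
| Cross_square: "(Gen (Cross m) \<bullet>\<^sub>t Gen (Cross m), Ze ([\<E>, \<E>], m) ([\<E>, \<E>], m)) \<in> common_rels"
| braid:
    "((Gen (Cross (m + 2)) \<star>\<^sub>t idE m) \<bullet>\<^sub>t (idE (m + 4) \<star>\<^sub>t Gen (Cross m)) \<bullet>\<^sub>t (Gen (Cross (m + 2)) \<star>\<^sub>t idE m),
      (idE (m + 4) \<star>\<^sub>t Gen (Cross m)) \<bullet>\<^sub>t (Gen (Cross (m + 2)) \<star>\<^sub>t idE m) \<bullet>\<^sub>t (idE (m + 4) \<star>\<^sub>t Gen (Cross m)))
      \<in> common_rels"
| slide1: "(Gen (Cross m) \<bullet>\<^sub>t (Gen (Dot (m + 2)) \<star>\<^sub>t idE m) -\<^sub>t (idE (m + 2) \<star>\<^sub>t Gen (Dot m)) \<bullet>\<^sub>t Gen (Cross m),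
    idEE m) \<in> common_rels"
| slide2: "((Gen (Dot (m + 2)) \<star>\<^sub>t idE m) \<bullet>\<^sub>t Gen (Cross m) -\<^sub>t Gen (Cross m) \<bullet>\<^sub>t (idE (m + 2) \<star>\<^sub>t Gen (Dot m)),
    idEE m) \<in> common_rels"

definition U_gens :: "gen set"
  where "U_gens = range Dot \<union> range Cross \<union> range Eta \<union> range Epsilon
    \<union> range DotF \<union> range CrossF \<union> range Eta' \<union> range Epsilon'
    \<union> {Fake m k | m k. k + m - 1 < 0} \<union> {Fake' m k | m k. k - m - 1 < 0}"

text \<open>
  In \<open>bub_inverse\<close> only the terms \<open>c\<^sub>i c'\<^sub>j\<close> with \<open>i, j \<ge> 0\<close> of the sum over \<open>i + j = k\<close> are written
  down, the others being zero by \<open>bub_neg\<close> and \<open>bub'_neg\<close>; the same applies to the other sums. As the fake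
  bubbles are determined by the rules from \<open>bub_neg\<close> to \<open>bub_inverse\<close>, treating them as generators
  does not enlarge the 2-category.
\<close>

inductive_set U_rels :: "('k::field trm \<times> 'k trm) set" where
  common: "st \<in> common_rels \<Longrightarrow> st \<in> U_rels"
| zigzag'_E: "((Gen (Epsilon' (m + 2)) \<star>\<^sub>t idE m) \<bullet>\<^sub>t (idE m \<star>\<^sub>t Gen (Eta' m)), idE m) \<in> U_rels"
| zigzag'_F: "((idF m \<star>\<^sub>t Gen (Epsilon' m)) \<bullet>\<^sub>t (Gen (Eta' (m - 2)) \<star>\<^sub>t idF m), idF m) \<in> U_rels"
| dot_Eps: "(Gen (Epsilon m) \<bullet>\<^sub>t (idF (m + 2) \<star>\<^sub>t Gen (Dot m)),
    Gen (Epsilon m) \<bullet>\<^sub>t (Gen (DotF (m + 2)) \<star>\<^sub>t idE m)) \<in> U_rels"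
| dot_Eps': "(Gen (Epsilon' m) \<bullet>\<^sub>t (Gen (Dot (m - 2)) \<star>\<^sub>t idF m),
    Gen (Epsilon' m) \<bullet>\<^sub>t (idE (m - 2) \<star>\<^sub>t Gen (DotF m))) \<in> U_rels"
| cross_Eps:
    "(Gen (Epsilon m) \<bullet>\<^sub>t (idF (m + 2) \<star>\<^sub>t Gen (Epsilon (m + 2)) \<star>\<^sub>t idE m) \<bullet>\<^sub>t (Gen (CrossF (m + 4)) \<star>\<^sub>t idEE m),
      Gen (Epsilon m) \<bullet>\<^sub>t (idF (m + 2) \<star>\<^sub>t Gen (Epsilon (m + 2)) \<star>\<^sub>t idE m) \<bullet>\<^sub>t (idFF (m + 4) \<star>\<^sub>t Gen (Cross m)))
      \<in> U_rels"
| cross_Eps':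
    "(Gen (Epsilon' m) \<bullet>\<^sub>t (idE (m - 2) \<star>\<^sub>t Gen (Epsilon' (m - 2)) \<star>\<^sub>t idF m) \<bullet>\<^sub>t (Gen (Cross (m - 4)) \<star>\<^sub>t idFF m),
      Gen (Epsilon' m) \<bullet>\<^sub>t (idE (m - 2) \<star>\<^sub>t Gen (Epsilon' (m - 2)) \<star>\<^sub>t idF m) \<bullet>\<^sub>t (idEE (m - 4) \<star>\<^sub>t Gen (CrossF m)))
      \<in> U_rels"
| bub_neg: "k < 0 \<Longrightarrow> (bub m k, Ze ([], m) ([], m)) \<in> U_rels"
| bub'_neg: "k < 0 \<Longrightarrow> (bub' m k, Ze ([], m) ([], m)) \<in> U_rels"
| bub_0: "(bub m 0, id1 m) \<in> U_rels"
| bub'_0: "(bub' m 0, id1 m) \<in> U_rels"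
| bub_inverse: "(tsum ([], m) ([], m) [bub m i \<bullet>\<^sub>t bub' m (k - i). i \<leftarrow> [0..k]],
    if k = 0 then id1 m else Ze ([], m) ([], m)) \<in> U_rels"
| curl: "((idE m \<star>\<^sub>t Gen (Epsilon' m)) \<bullet>\<^sub>t (Gen (Cross (m - 2)) \<star>\<^sub>t idF m) \<bullet>\<^sub>t (idE m \<star>\<^sub>t Gen (Eta m)),
    (- 1) *\<^sub>t tsum ([\<E>], m) ([\<E>], m) [dots m (nat j) \<star>\<^sub>t bub m (- m - j). j \<leftarrow> [0..- m]]) \<in> U_rels"
| curl': "((Gen (Epsilon m) \<star>\<^sub>t idE (m - 2)) \<bullet>\<^sub>t (idF (m + 2) \<star>\<^sub>t Gen (Cross (m - 2))) \<bullet>\<^sub>t (Gen (Eta' m) \<star>\<^sub>t idE (m - 2)),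
    tsum ([\<E>], m - 2) ([\<E>], m - 2) [bub' m (m - j) \<star>\<^sub>t dots (m - 2) (nat j). j \<leftarrow> [0..m]]) \<in> U_rels"
| EF_decomp: "(idEF m, (- 1) *\<^sub>t (sig m \<bullet>\<^sub>t sig' m) +\<^sub>t tsum ([\<E>, \<F>], m) ([\<E>, \<F>], m)
    [(dots (m - 2) (nat k) \<star>\<^sub>t idF m) \<bullet>\<^sub>t Gen (Eta m) \<bullet>\<^sub>t bub' m (m - 1 - i - k) \<bullet>\<^sub>t
       Gen (Epsilon' m) \<bullet>\<^sub>t (dots (m - 2) (nat i) \<star>\<^sub>t idF m). i \<leftarrow> [0..m - 1], k \<leftarrow> [0..m - 1 - i]]) \<in> U_rels"
| FE_decomp: "(idFE m, (- 1) *\<^sub>t (sig' m \<bullet>\<^sub>t sig m) +\<^sub>t tsum ([\<F>, \<E>], m) ([\<F>, \<E>], m)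
    [(idF (m + 2) \<star>\<^sub>t dots m (nat k)) \<bullet>\<^sub>t Gen (Eta' m) \<bullet>\<^sub>t bub m (- m - 1 - i - k) \<bullet>\<^sub>t
       Gen (Epsilon m) \<bullet>\<^sub>t (idF (m + 2) \<star>\<^sub>t dots m (nat i)). i \<leftarrow> [0..- m - 1], k \<leftarrow> [0..- m - 1 - i]]) \<in> U_rels"

definition UR_gens :: "gen set"
  where "UR_gens = range Dot \<union> range Cross \<union> range Eta \<union> range Epsilon
    \<union> range InvS \<union> {InvP m j | m j. int j < m} \<union> {InvI m j | m j. int j < - m}"

definition eta_dots :: "int \<Rightarrow> nat \<Rightarrow> 'k trm"
  where "eta_dots m j = (dots (m - 2) j \<star>\<^sub>t idF m) \<bullet>\<^sub>t Gen (Eta m)"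

definition eps_dots :: "int \<Rightarrow> nat \<Rightarrow> 'k trm"
  where "eps_dots m j = Gen (Epsilon m) \<bullet>\<^sub>t (idF (m + 2) \<star>\<^sub>t dots m j)"

text \<open>
  Formally inverting a 2-morphism between direct sums amounts to adjoining the matrix entries of its inverse.
  For \<open>m \<ge> 0\<close> the rules \<open>inv_pos\<close> say that the row \<open>(sig m, eta_dots m 0, \<dots>, eta_dots m (m - 1))\<close> is inverse
  to the column with entries \<open>InvS m, InvP m 0, \<dots>, InvP m (m - 1)\<close>. For \<open>m \<le> 0\<close> the rules \<open>inv_neg\<close>
  say that the column with entries \<open>sig m, eps_dots m 0, \<dots>, eps_dots m (- m - 1)\<close> is inverse to the row
  \<open>(InvS m, InvI m 0, \<dots>, InvI m (- m - 1))\<close>.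
\<close>

inductive_set UR_rels :: "('k::field trm \<times> 'k trm) set" where
  common: "st \<in> common_rels \<Longrightarrow> st \<in> UR_rels"
| inv_pos_id: "m \<ge> 0 \<Longrightarrow> (sig m \<bullet>\<^sub>t Gen (InvS m) +\<^sub>t tsum ([\<E>, \<F>], m) ([\<E>, \<F>], m)
    [eta_dots m j \<bullet>\<^sub>t Gen (InvP m j). j \<leftarrow> [0..<nat m]], idEF m) \<in> UR_rels"
| inv_pos_SS: "m \<ge> 0 \<Longrightarrow> (Gen (InvS m) \<bullet>\<^sub>t sig m, idFE m) \<in> UR_rels"
| inv_pos_SP: "int j < m \<Longrightarrow> (Gen (InvS m) \<bullet>\<^sub>t eta_dots m j, Ze ([], m) ([\<F>, \<E>], m)) \<in> UR_rels"
| inv_pos_PS: "int i < m \<Longrightarrow> (Gen (InvP m i) \<bullet>\<^sub>t sig m, Ze ([\<F>, \<E>], m) ([], m)) \<in> UR_rels"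
| inv_pos_PP: "\<lbrakk>int i < m; int j < m\<rbrakk> \<Longrightarrow>
    (Gen (InvP m i) \<bullet>\<^sub>t eta_dots m j, if i = j then id1 m else Ze ([], m) ([], m)) \<in> UR_rels"
| inv_neg_id: "m \<le> 0 \<Longrightarrow> (Gen (InvS m) \<bullet>\<^sub>t sig m +\<^sub>t tsum ([\<F>, \<E>], m) ([\<F>, \<E>], m)
    [Gen (InvI m j) \<bullet>\<^sub>t eps_dots m j. j \<leftarrow> [0..<nat (- m)]], idFE m) \<in> UR_rels"
| inv_neg_SS: "m \<le> 0 \<Longrightarrow> (sig m \<bullet>\<^sub>t Gen (InvS m), idEF m) \<in> UR_rels"
| inv_neg_SI: "int j < - m \<Longrightarrow> (sig m \<bullet>\<^sub>t Gen (InvI m j), Ze ([], m) ([\<E>, \<F>], m)) \<in> UR_rels"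
| inv_neg_IS: "int i < - m \<Longrightarrow> (eps_dots m i \<bullet>\<^sub>t Gen (InvS m), Ze ([\<E>, \<F>], m) ([], m)) \<in> UR_rels"
| inv_neg_II: "\<lbrakk>int i < - m; int j < - m\<rbrakk> \<Longrightarrow>
    (eps_dots m i \<bullet>\<^sub>t Gen (InvI m j), if i = j then id1 m else Ze ([], m) ([], m)) \<in> UR_rels"

abbreviation U_base :: "(int, word, 'k::field trm set, 'k) gr2cat"
  where "U_base \<equiv> presented U_gens U_rels"

abbreviation UR_base :: "(int, word, 'k::field trm set, 'k) gr2cat"
  where "UR_base \<equiv> presented UR_gens UR_rels"

definition UU :: "(int, mor1, 'k::field mor2, 'k) gr2cat"
  where "UU = add_closure U_base"

definition UR :: "(int, mor1, 'k::field mor2, 'k) gr2cat"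
  where "UR = add_closure UR_base"

abbreviation Ucell :: "'k::field trm \<Rightarrow> 'k mor2"
  where "Ucell \<equiv> cell U_gens U_rels"

abbreviation URcell :: "'k::field trm \<Rightarrow> 'k mor2"
  where "URcell \<equiv> cell UR_gens UR_rels"

text \<open>
  The images of the generators under the differential, as terms:
  \<open>x\<^sup>2\<close>, \<open>1 - 2 (x\<E>) \<tau>\<close>, \<open>\<epsilon>\<^sub>m (\<F> x)\<close> and \<open>(x \<F>) \<eta>\<^sub>m\<close> (the last two without their coefficients).
\<close>

definition Dot_sq :: "int \<Rightarrow> 'k trm"
  where "Dot_sq m = Gen (Dot m) \<bullet>\<^sub>t Gen (Dot m)"

definition d_Cross :: "int \<Rightarrow> 'k::field trm"
  where "d_Cross m = idEE m -\<^sub>t 2 *\<^sub>t ((Gen (Dot (m + 2)) \<star>\<^sub>t idE m) \<bullet>\<^sub>t Gen (Cross m))"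

definition Eps_Dot :: "int \<Rightarrow> 'k trm"
  where "Eps_Dot m = Gen (Epsilon m) \<bullet>\<^sub>t (idF (m + 2) \<star>\<^sub>t Gen (Dot m))"

definition Dot_Eta :: "int \<Rightarrow> 'k trm"
  where "Dot_Eta m = (Gen (Dot (m - 2)) \<star>\<^sub>t idF m) \<bullet>\<^sub>t Gen (Eta m)"

text \<open>
  The p-differential of \<open>UU\<close>: it annihilates the structure maps of formal direct sums and shifts (so it
  is given entrywise by a differential on \<open>U_base\<close>) and has the prescribed values on generators.
\<close>

definition U_differential :: "nat \<Rightarrow> ('k::field mor2 \<Rightarrow> 'k mor2) \<Rightarrow> bool"
  where "U_differential p \<delta> \<longleftrightarrow> p_differential p (UU :: (int, mor1, 'k mor2, 'k) gr2cat) \<delta> \<and>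
    (\<forall>a b. \<forall>A \<in> Mor (UU :: (int, mor1, 'k mor2, 'k) gr2cat) a b. \<forall>i < rk A.
      \<delta> (incl U_base A i) = \<zero>\<^bsub>Hom2 UU (a, b, [snd (snd A) ! i]) A\<^esub>) \<and>
    (\<forall>f n. \<delta> (shift_iso U_base (snd f) (tgt f) n f) =
      \<zero>\<^bsub>Hom2 UU (wrd f) (snd f, tgt f, [(n, f)])\<^esub>) \<and>
    (\<forall>m. \<delta> (Ucell (Gen (Dot m))) = Ucell (Dot_sq m)) \<and>
    (\<forall>m. \<delta> (Ucell (Gen (Cross m))) = Ucell (d_Cross m)) \<and>
    (\<forall>m. \<delta> (Ucell (Gen (Eta m))) =
      of_int (1 - m) \<odot>\<^bsub>Hom2 UU (wrd ([], m)) (wrd ([\<E>, \<F>], m))\<^esub> Ucell (Dot_Eta m)) \<and>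
    (\<forall>m. \<delta> (Ucell (Gen (Epsilon m))) =
      of_int (m + 1) \<odot>\<^bsub>Hom2 UU (wrd ([\<F>, \<E>], m)) (wrd ([], m))\<^esub> Ucell (Eps_Dot m))"

text \<open>
  Equivalences \<open>UU \<rightarrow> UR\<close> matching the generators. Both 2-categories have the same objects and
  1-morphisms, so such an equivalence is a fully faithful strict 2-functor that is the identity on
  objects and 1-morphisms (hence also compatible with the structure maps of formal sums and shifts).
\<close>

definition fun2_on_cells ::
    "('o, 'f, 'b, 'k) gr2cat \<Rightarrow> ('a \<Rightarrow> 'b) \<Rightarrow> ('o, 'f, 'a, 'o, 'f, 'b) fun2"
  where "fun2_on_cells D \<Theta> = \<lparr> fobj = (\<lambda>a. a), fmor = (\<lambda>f. f), fcell = \<Theta>,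
    fcmp = (\<lambda>g f. Id2 D (g \<diamondop>\<^bsub>D\<^esub> f)), funit = (\<lambda>a. Id2 D (Unit1 D a)) \<rparr>"

definition matching_equivalence :: "('k::field mor2 \<Rightarrow> 'k mor2) \<Rightarrow> bool"
  where "matching_equivalence \<Theta> \<longleftrightarrow>
    graded_2functor UU UR (fun2_on_cells (UR :: (int, mor1, 'k mor2, 'k) gr2cat) \<Theta>) \<and>
    (\<forall>a b. \<forall>A \<in> Mor (UU :: (int, mor1, 'k mor2, 'k) gr2cat) a b. \<forall>B \<in> Mor (UU :: (int, mor1, 'k mor2, 'k) gr2cat) a b.
      bij_betw \<Theta> (Cells UU A B) (Cells UR A B)) \<and>
    (\<forall>a b. \<forall>A \<in> Mor (UU :: (int, mor1, 'k mor2, 'k) gr2cat) a b. \<forall>i < rk A. \<Theta> (incl U_base A i) = incl UR_base A i) \<and>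
    (\<forall>f n. \<Theta> (shift_iso U_base (snd f) (tgt f) n f) = shift_iso UR_base (snd f) (tgt f) n f) \<and>
    (\<forall>m. \<Theta> (Ucell (Gen (Dot m))) = URcell (Gen (Dot m))) \<and>
    (\<forall>m. \<Theta> (Ucell (Gen (Cross m))) = URcell (Gen (Cross m))) \<and>
    (\<forall>m. \<Theta> (Ucell (Gen (Eta m))) = URcell (Gen (Eta m))) \<and>
    (\<forall>m. \<Theta> (Ucell (Gen (Epsilon m))) = URcell (Gen (Epsilon m)))"

definition transport :: "('a \<Rightarrow> 'b) \<Rightarrow> ('o, 'f, 'b, 'o1, 'f1, 'a1) fun2 \<Rightarrow> ('o, 'f, 'a, 'o1, 'f1, 'a1) fun2"
  where "transport \<Theta> \<Phi> = \<lparr> fobj = fobj \<Phi>, fmor = fmor \<Phi>, fcell = fcell \<Phi> \<circ> \<Theta>,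
    fcmp = fcmp \<Phi>, funit = funit \<Phi> \<rparr>"

end

theory Submission
  imports Defs
begin

text \<open>
  Carry the differential of \<open>UU\<close> over to \<open>UR\<close> along the equivalence \<open>\<Theta>\<close>. The result is a derivation \<open>\<partial>\<close> of \<open>UR\<close>
  (\<open>derivation_transported\<close>), and the claim becomes that the defect \<open>D \<alpha> = \<partial> (\<Phi> \<alpha>) - \<Phi> (\<partial> \<alpha>)\<close> of \<open>\<Phi>\<close>
  vanishes on every 2-morphism of \<open>UR\<close>. The defect is additive and satisfies the Leibniz rule
  \<open>D (\<beta> \<bullet> \<alpha>) = D \<beta> \<bullet> \<Phi> \<alpha> + \<Phi> \<beta> \<bullet> D \<alpha>\<close> (\<open>defect_Vcomp\<close>), and the same is true for horizontal composites up
  to the structure isomorphisms of \<open>\<Phi>\<close>, which are closed (\<open>commutes_Hcomp\<close>). So the 2-morphisms without defect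
  form a linear sub-2-category. By hypothesis it contains \<open>x\<close>, \<open>\<tau>\<close>, \<open>\<eta>\<close> and \<open>\<epsilon>\<close>, hence also \<open>\<sigma>\<close> and the
  2-morphisms \<open>(x\<^sup>j\<F>) \<eta>\<close> and \<open>\<epsilon> (\<F>x\<^sup>j)\<close>.

  The other generators of \<open>UR\<close> are the entries of the formal inverses of matrices built from these 2-morphisms.
  An inverse is determined by the matrix, and so is the value of a derivation on it: from \<open>e \<bullet> c = 1\<close> and \<open>D e = 0\<close> one gets
  \<open>\<Phi> e \<bullet> D c = 0\<close>, and composing with \<open>\<Phi> c\<close> gives \<open>D c = 0\<close>. Writing this out entry by entry gives
  \<open>commutes_inverse_column\<close> for \<open>m \<ge> 0\<close> and \<open>commutes_inverse_row\<close> for \<open>m \<le> 0\<close>. In this way the second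
  adjunction, the downward dots and crossings and the bubbles of \<open>UU\<close> are treated all at once, without computing
  their differentials.

  It remains to pass from terms in the generators to matrices of such terms. The inclusions of summands and the
  shift isomorphisms have no defect, the projections inherit this from \<open>prj \<bullet> emb = \<delta>\<close>, and an identity is the sum of the
  \<open>emb \<bullet> prj\<close>; therefore the defect of a matrix is detected on its entries (\<open>commutes_if_entries_commute\<close>).
\<close>

section \<open>Matrices over a linear 2-category\<close>

text \<open>
  What matrix calculus over a linear 2-category rests on: groups of 2-morphisms, closure under the
  operations, identities, and composites with zero. Together these properties pass from a 2-category to
  matrices over it (\<open>add_closure_linear_2cat_part\<close>).
\<close>

locale linear_2cat_part =
  fixes C :: "('o, 'f, 'a, 'k::field) gr2cat" (structure)
  assumes Mor_objs: "f \<in> Mor C a b \<Longrightarrow> a \<in> Objs C \<and> b \<in> Objs C"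
    and Comp1_closed: "\<lbrakk>f \<in> Mor C a b; g \<in> Mor C b c\<rbrakk> \<Longrightarrow> g \<diamondop> f \<in> Mor C a c"
    and Hom2_group: "\<lbrakk>f \<in> Mor C a b; g \<in> Mor C a b\<rbrakk> \<Longrightarrow> abelian_group (Hom2 C f g)"
    and smult_closed:
      "\<lbrakk>f \<in> Mor C a b; g \<in> Mor C a b; \<alpha> \<in> Cells C f g\<rbrakk> \<Longrightarrow> r \<odot>\<^bsub>Hom2 C f g\<^esub> \<alpha> \<in> Cells C f g"
    and Id2_closed: "f \<in> Mor C a b \<Longrightarrow> Id2 C f \<in> Cells C f f"
    and Vcomp_closed:
      "\<lbrakk>f \<in> Mor C a b; g \<in> Mor C a b; h \<in> Mor C a b; \<alpha> \<in> Cells C f g; \<beta> \<in> Cells C g h\<rbrakk>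
        \<Longrightarrow> \<beta> \<bullet> \<alpha> \<in> Cells C f h"
    and Vcomp_id:
      "\<lbrakk>f \<in> Mor C a b; g \<in> Mor C a b; \<alpha> \<in> Cells C f g\<rbrakk> \<Longrightarrow> \<alpha> \<bullet> Id2 C f = \<alpha>"
      "\<lbrakk>f \<in> Mor C a b; g \<in> Mor C a b; \<alpha> \<in> Cells C f g\<rbrakk> \<Longrightarrow> Id2 C g \<bullet> \<alpha> = \<alpha>"
    and Vcomp_zero:
      "\<lbrakk>f \<in> Mor C a b; g \<in> Mor C a b; h \<in> Mor C a b; \<beta> \<in> Cells C g h\<rbrakk>
        \<Longrightarrow> \<beta> \<bullet> \<zero>\<^bsub>Hom2 C f g\<^esub> = \<zero>\<^bsub>Hom2 C f h\<^esub>"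
      "\<lbrakk>f \<in> Mor C a b; g \<in> Mor C a b; h \<in> Mor C a b; \<alpha> \<in> Cells C f g\<rbrakk>
        \<Longrightarrow> \<zero>\<^bsub>Hom2 C g h\<^esub> \<bullet> \<alpha> = \<zero>\<^bsub>Hom2 C f h\<^esub>"
    and Hcomp_closed:
      "\<lbrakk>f \<in> Mor C a b; f' \<in> Mor C a b; g \<in> Mor C b c; g' \<in> Mor C b c; \<alpha> \<in> Cells C f f'; \<beta> \<in> Cells C g g'\<rbrakk>
        \<Longrightarrow> \<beta> \<star> \<alpha> \<in> Cells C (g \<diamondop> f) (g' \<diamondop> f')"
begin

lemma zero_closed: "\<lbrakk>f \<in> Mor C a b; g \<in> Mor C a b\<rbrakk> \<Longrightarrow> \<zero>\<^bsub>Hom2 C f g\<^esub> \<in> Cells C f g"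
  using Hom2_group abelian_group.axioms(1) abelian_monoid.zero_closed by blast

lemma add_closed: "\<lbrakk>f \<in> Mor C a b; g \<in> Mor C a b; \<alpha> \<in> Cells C f g; \<beta> \<in> Cells C f g\<rbrakk>
    \<Longrightarrow> \<alpha> \<oplus>\<^bsub>Hom2 C f g\<^esub> \<beta> \<in> Cells C f g"
  using Hom2_group abelian_group.axioms(1) abelian_monoid.a_closed by metis

end

lemma mk2_eq_iff: "mk2 A B M = mk2 A B N \<longleftrightarrow> (\<forall>i < rk B. \<forall>j < rk A. M i j = N i j)"
  by (auto simp: mk2_def fun_eq_iff)

lemma mk2_cong: "(\<And>i j. \<lbrakk>i < rk B; j < rk A\<rbrakk> \<Longrightarrow> M i j = N i j) \<Longrightarrow> mk2 A B M = mk2 A B N"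
  by (simp add: mk2_eq_iff)

lemma length_concat_map_map:
  "length (concat (map (\<lambda>x. map (h x) ys) xs)) = length xs * length ys"
  by (induction xs) auto

lemma nth_concat_map_map:
  "i < length xs * length ys \<Longrightarrow>
    concat (map (\<lambda>x. map (h x) ys) xs) ! i = h (xs ! (i div length ys)) (ys ! (i mod length ys))"
proof (induction xs arbitrary: i)
  case (Cons x xs)
  show ?case
  proof (cases "i < length ys")
    case False
    hence "i - length ys < length xs * length ys" using Cons.prems by simp
    moreover have "0 < length ys" using Cons.prems by (cases ys) auto
    ultimately show ?thesis using Cons.IH False
      by (simp add: nth_append le_div_geq le_mod_geq)
  qed (simp add: nth_append)
qed simp

lemma rk_comp_sum1: "rk (comp_sum1 C B A) = rk B * rk A"
  unfolding rk_def comp_sum1_def using length_concat_map_map[of "\<lambda>(m, g) (n, f). (m + n, g \<diamondop>\<^bsub>C\<^esub> f)"]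
  by (simp add: case_prod_unfold)

lemma summand_comp_sum1:
  "i < rk B * rk A \<Longrightarrow> summand (comp_sum1 C B A) i = summand B (i div rk A) \<diamondop>\<^bsub>C\<^esub> summand A (i mod rk A)"
  unfolding rk_def comp_sum1_def summand_def
  using nth_concat_map_map[of i "snd (snd B)" "snd (snd A)" "\<lambda>x y. (fst x + fst y, snd x \<diamondop>\<^bsub>C\<^esub> snd y)"]
  by (simp add: case_prod_unfold)

context linear_2cat_part
begin

abbreviation AC :: "('o, ('o, 'f) sum1, ('o, 'f, 'a) sum2, 'k) gr2cat" where "AC \<equiv> add_closure C"

abbreviation matrix :: "('o, 'f) sum1 \<Rightarrow> ('o, 'f) sum1 \<Rightarrow> (nat \<Rightarrow> nat \<Rightarrow> 'a) \<Rightarrow> bool"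
  where "matrix A B M \<equiv> \<forall>i < rk B. \<forall>j < rk A. M i j \<in> Cells C (summand A j) (summand B i)"

lemma summand_Mor: "\<lbrakk>A \<in> Mor AC a b; i < rk A\<rbrakk> \<Longrightarrow> summand A i \<in> Mor C a b"
  by (auto simp: add_closure_def rk_def summand_def subset_iff)

lemma Mor_AC_ends: "A \<in> Mor AC a b \<Longrightarrow> fst A = a \<and> fst (snd A) = b \<and> a \<in> Objs C \<and> b \<in> Objs C"
  by (auto simp: add_closure_def)

lemma Cells_AC: "Cells AC A B = {mk2 A B M | M. matrix A B M}"
  by (simp add: add_closure_def hom_sum2_def)

lemma Cells_AC_E:
  assumes "\<alpha> \<in> Cells AC A B"
  obtains M where "\<alpha> = mk2 A B M" "matrix A B M"
  using assms unfolding Cells_AC by blast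

lemma Cells_AC_I: "matrix A B M \<Longrightarrow> mk2 A B M \<in> Cells AC A B"
  unfolding Cells_AC by blast

lemma zero_AC: "\<zero>\<^bsub>Hom2 AC A B\<^esub> = mk2 A B (\<lambda>i j. \<zero>\<^bsub>Hom2 C (summand A j) (summand B i)\<^esub>)"
  by (simp add: add_closure_def hom_sum2_def)

lemma add_AC: "mk2 A B M \<oplus>\<^bsub>Hom2 AC A B\<^esub> mk2 A B N
    = mk2 A B (\<lambda>i j. M i j \<oplus>\<^bsub>Hom2 C (summand A j) (summand B i)\<^esub> N i j)"
  by (auto simp: add_closure_def hom_sum2_def mk2_def fun_eq_iff)

lemma smult_AC: "r \<odot>\<^bsub>Hom2 AC A B\<^esub> mk2 A B M
    = mk2 A B (\<lambda>i j. r \<odot>\<^bsub>Hom2 C (summand A j) (summand B i)\<^esub> M i j)"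
  by (auto simp: add_closure_def hom_sum2_def mk2_def fun_eq_iff)

lemma Id2_AC: "Id2 AC A = mk2 A A (\<lambda>i j. if i = j then Id2 C (summand A i)
      else \<zero>\<^bsub>Hom2 C (summand A j) (summand A i)\<^esub>)"
  by (simp add: add_closure_def id_sum2_def)

lemma Vcomp_AC_entry_closed:
  assumes mor: "A \<in> Mor AC a b" "B \<in> Mor AC a b" "D \<in> Mor AC a b" and M: "matrix A B M" and N: "matrix B D N"
    and "i < rk D" "k < rk A"
  shows "(\<lambda>j. N i j \<bullet> M j k) \<in> {..<rk B} \<rightarrow> Cells C (summand A k) (summand D i)"
proof
  fix j assume "j \<in> {..<rk B}"
  thus "N i j \<bullet> M j k \<in> Cells C (summand A k) (summand D i)"
    using assms(6,7) M N by (intro Vcomp_closed[where g = "summand B j"]) (auto intro: summand_Mor mor)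
qed

lemma Vcomp_AC:
  assumes mor: "A \<in> Mor AC a b" "B \<in> Mor AC a b" "D \<in> Mor AC a b" and M: "matrix A B M" and N: "matrix B D N"
  shows "mk2 B D N \<bullet>\<^bsub>AC\<^esub> mk2 A B M = mk2 A D (\<lambda>i k.
        finsum (Hom2 C (summand A k) (summand D i)) (\<lambda>j. N i j \<bullet> M j k) {..<rk B})"
proof -
  have "finsum (Hom2 C (summand A k) (summand D i))
        (\<lambda>j. (if i < rk D \<and> j < rk B then N i j else undefined) \<bullet>
             (if j < rk B \<and> k < rk A then M j k else undefined)) {..<rk B}
      = finsum (Hom2 C (summand A k) (summand D i)) (\<lambda>j. N i j \<bullet> M j k) {..<rk B}"
    if "i < rk D" "k < rk A" for i k
  proof -
    have ag: "abelian_monoid (Hom2 C (summand A k) (summand D i))"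
      using Hom2_group abelian_group.axioms(1) summand_Mor mor that by blast
    show ?thesis
    proof (rule abelian_monoid.finsum_cong'[OF ag])
      show "(\<lambda>j. N i j \<bullet> M j k) \<in> {..<rk B} \<rightarrow> Cells C (summand A k) (summand D i)"
        by (rule Vcomp_AC_entry_closed[OF mor M N that])
    qed (use that in auto)
  qed
  thus ?thesis by (simp add: add_closure_def mk2_def fun_eq_iff)
qed

text \<open>
  If a matrix product has at most one non-zero term in each of its entry sums, the sums collapse. All products
  with identities, inclusions and projections below have this shape; \<open>l i k\<close> names the surviving index.
\<close>

lemma Vcomp_AC_single:
  assumes mor: "A \<in> Mor AC a b" "B \<in> Mor AC a b" "D \<in> Mor AC a b" and M: "matrix A B M" and N: "matrix B D N"
    and l: "\<And>i k. \<lbrakk>i < rk D; k < rk A\<rbrakk> \<Longrightarrow> l i k < rk B"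
    and z: "\<And>i k j. \<lbrakk>i < rk D; k < rk A; j < rk B; j \<noteq> l i k\<rbrakk> \<Longrightarrow>
        N i j \<bullet> M j k = \<zero>\<^bsub>Hom2 C (summand A k) (summand D i)\<^esub>"
  shows "mk2 B D N \<bullet>\<^bsub>AC\<^esub> mk2 A B M = mk2 A D (\<lambda>i k. N i (l i k) \<bullet> M (l i k) k)"
  unfolding Vcomp_AC[OF mor M N]
proof (rule mk2_cong)
  fix i k assume ik: "i < rk D" "k < rk A"
  let ?H = "Hom2 C (summand A k) (summand D i)"
  have ag: "abelian_monoid ?H"
    using Hom2_group abelian_group.axioms(1) summand_Mor mor ik by blast
  note cl = Vcomp_AC_entry_closed[OF mor M N ik]
  have "finsum ?H (\<lambda>j. N i j \<bullet> M j k) {..<rk B}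
      = finsum ?H (\<lambda>j. if l i k = j then N i j \<bullet> M j k else \<zero>\<^bsub>?H\<^esub>) {..<rk B}"
    using ik z cl by (intro abelian_monoid.finsum_cong'[OF ag]) (auto simp: abelian_monoid.zero_closed[OF ag])
  also have "\<dots> = N i (l i k) \<bullet> M (l i k) k"
    using l[OF ik] cl by (intro abelian_monoid.finsum_singleton[OF ag]) auto
  finally show "finsum ?H (\<lambda>j. N i j \<bullet> M j k) {..<rk B} = N i (l i k) \<bullet> M (l i k) k" .
qed

lemma matrix_Id2: "A \<in> Mor AC a b \<Longrightarrow> matrix A A (\<lambda>i j. if i = j then Id2 C (summand A i)
      else \<zero>\<^bsub>Hom2 C (summand A j) (summand A i)\<^esub>)"
  using Id2_closed zero_closed summand_Mor by (metis (no_types, lifting))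

lemma Vcomp_AC_id:
  assumes mor: "A \<in> Mor AC a b" "B \<in> Mor AC a b" and M: "matrix A B M"
  shows "mk2 A B M \<bullet>\<^bsub>AC\<^esub> Id2 AC A = mk2 A B M" "Id2 AC B \<bullet>\<^bsub>AC\<^esub> mk2 A B M = mk2 A B M"
proof -
  show "mk2 A B M \<bullet>\<^bsub>AC\<^esub> Id2 AC A = mk2 A B M"
    unfolding Id2_AC
    using M by (subst Vcomp_AC_single[OF mor(1) mor matrix_Id2[OF mor(1)] M, where l = "\<lambda>i k. k"])
       (auto intro!: mk2_cong Vcomp_zero Vcomp_id(1)[OF summand_Mor[OF mor(1)] summand_Mor[OF mor(2)]]
         intro: summand_Mor mor)
  show "Id2 AC B \<bullet>\<^bsub>AC\<^esub> mk2 A B M = mk2 A B M"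
    unfolding Id2_AC
    using M by (subst Vcomp_AC_single[OF mor mor(2) M matrix_Id2[OF mor(2)], where l = "\<lambda>i k. i"])
       (auto intro!: mk2_cong Vcomp_zero Vcomp_id(2)[OF summand_Mor[OF mor(1)] summand_Mor[OF mor(2)]]
         intro: summand_Mor mor)
qed

lemma Hom2_AC_group:
  assumes mor: "A \<in> Mor AC a b" "B \<in> Mor AC a b"
  shows "abelian_group (Hom2 AC A B)"
proof -
  have H: "abelian_group (Hom2 C (summand A j) (summand B i))" if "i < rk B" "j < rk A" for i j
    using that mor Hom2_group summand_Mor by blast
  have Hm: "abelian_monoid (Hom2 C (summand A j) (summand B i))" if "i < rk B" "j < rk A" for i j
    using H[OF that] abelian_group.axioms(1) by blast
  show ?thesis
  proof (rule abelian_groupI)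
    show "\<zero>\<^bsub>Hom2 AC A B\<^esub> \<in> Cells AC A B"
      unfolding zero_AC by (rule Cells_AC_I) (simp add: Hm abelian_monoid.zero_closed)
  next
    fix x y assume "x \<in> Cells AC A B" "y \<in> Cells AC A B"
    thus "x \<oplus>\<^bsub>Hom2 AC A B\<^esub> y \<in> Cells AC A B"
      by (elim Cells_AC_E) (simp add: add_AC, intro Cells_AC_I, simp add: Hm abelian_monoid.a_closed)
  next
    fix x y assume "x \<in> Cells AC A B" "y \<in> Cells AC A B"
    thus "x \<oplus>\<^bsub>Hom2 AC A B\<^esub> y = y \<oplus>\<^bsub>Hom2 AC A B\<^esub> x"
      by (elim Cells_AC_E) (simp add: add_AC mk2_eq_iff Hm abelian_monoid.a_comm)
  next
    fix x y z assume "x \<in> Cells AC A B" "y \<in> Cells AC A B" "z \<in> Cells AC A B"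
    thus "x \<oplus>\<^bsub>Hom2 AC A B\<^esub> y \<oplus>\<^bsub>Hom2 AC A B\<^esub> z = x \<oplus>\<^bsub>Hom2 AC A B\<^esub> (y \<oplus>\<^bsub>Hom2 AC A B\<^esub> z)"
      by (elim Cells_AC_E) (simp add: add_AC mk2_eq_iff Hm abelian_monoid.a_assoc)
  next
    fix x assume "x \<in> Cells AC A B"
    thus "\<zero>\<^bsub>Hom2 AC A B\<^esub> \<oplus>\<^bsub>Hom2 AC A B\<^esub> x = x"
      by (elim Cells_AC_E) (simp add: zero_AC add_AC mk2_eq_iff Hm abelian_monoid.l_zero)
  next
    fix x assume "x \<in> Cells AC A B"
    then obtain M where M: "x = mk2 A B M" "matrix A B M" by (rule Cells_AC_E)
    let ?N = "\<lambda>i j. a_inv (Hom2 C (summand A j) (summand B i)) (M i j)"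
    have "matrix A B ?N" using M H by (simp add: abelian_group.a_inv_closed)
    moreover have "mk2 A B ?N \<oplus>\<^bsub>Hom2 AC A B\<^esub> x = \<zero>\<^bsub>Hom2 AC A B\<^esub>"
      using M H by (simp add: zero_AC add_AC mk2_eq_iff abelian_group.l_neg)
    ultimately show "\<exists>y\<in>Cells AC A B. y \<oplus>\<^bsub>Hom2 AC A B\<^esub> x = \<zero>\<^bsub>Hom2 AC A B\<^esub>"
      by (intro bexI[OF _ Cells_AC_I])
  qed
qed

lemma finsum_zero_entries:
  assumes "abelian_monoid H" "\<And>j. j < n \<Longrightarrow> u j = \<zero>\<^bsub>H\<^esub>"
  shows "finsum H u {..<n::nat} = \<zero>\<^bsub>H\<^esub>"
  using assms by (intro comm_monoid.finprod_one_eqI[OF abelian_monoid.a_comm_monoid, folded finsum_def, simplified]) auto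

text \<open>
  This lets the same comparison of differentials run both on a presented 2-category and on its closure under
  sums and shifts.
\<close>

lemma add_closure_linear_2cat_part: "linear_2cat_part AC"
proof (rule linear_2cat_part.intro)
  show "f \<in> Mor AC a b \<Longrightarrow> a \<in> Objs AC \<and> b \<in> Objs AC" for f a b
    by (auto simp: add_closure_def)
  show "B \<diamondop>\<^bsub>AC\<^esub> A \<in> Mor AC a c" if "A \<in> Mor AC a b" "B \<in> Mor AC b c" for A B a b c
    using that by (fastforce simp: add_closure_def comp_sum1_def intro: Comp1_closed)
  show "\<lbrakk>f \<in> Mor AC a b; g \<in> Mor AC a b\<rbrakk> \<Longrightarrow> abelian_group (Hom2 AC f g)" for f g a b
    by (rule Hom2_AC_group)
  show "\<lbrakk>A \<in> Mor AC a b; B \<in> Mor AC a b; \<alpha> \<in> Cells AC A B\<rbrakk> \<Longrightarrow> r \<odot>\<^bsub>Hom2 AC A B\<^esub> \<alpha> \<in> Cells AC A B"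
    for A B a b r \<alpha>
    by (elim Cells_AC_E) (auto simp: smult_AC intro!: Cells_AC_I smult_closed intro: summand_Mor)
  show "Id2 AC A \<in> Cells AC A A" if "A \<in> Mor AC a b" for A a b
    unfolding Id2_AC using Cells_AC_I[OF matrix_Id2[OF that]] .
  show "\<lbrakk>A \<in> Mor AC a b; B \<in> Mor AC a b; \<alpha> \<in> Cells AC A B\<rbrakk> \<Longrightarrow> \<alpha> \<bullet>\<^bsub>AC\<^esub> Id2 AC A = \<alpha>" for A B a b \<alpha>
    by (elim Cells_AC_E) (auto simp: Vcomp_AC_id)
  show "\<lbrakk>A \<in> Mor AC a b; B \<in> Mor AC a b; \<alpha> \<in> Cells AC A B\<rbrakk> \<Longrightarrow> Id2 AC B \<bullet>\<^bsub>AC\<^esub> \<alpha> = \<alpha>" for A B a b \<alpha>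
    by (elim Cells_AC_E) (auto simp: Vcomp_AC_id)
next
  fix A B D a b \<alpha> \<beta>
  assume mor: "A \<in> Mor AC a b" "B \<in> Mor AC a b" "D \<in> Mor AC a b" 
  have Hm: "abelian_monoid (Hom2 C (summand A k) (summand D i))" if "i < rk D" "k < rk A" for i k
    using Hom2_group abelian_group.axioms(1) summand_Mor mor that by blast
  show "\<beta> \<bullet>\<^bsub>AC\<^esub> \<alpha> \<in> Cells AC A D" if "\<alpha> \<in> Cells AC A B" "\<beta> \<in> Cells AC B D"
    using that(1)
  proof (rule Cells_AC_E)
    fix M assume M: "\<alpha> = mk2 A B M" "matrix A B M"
    from that(2) obtain N where N: "\<beta> = mk2 B D N" "matrix B D N" by (rule Cells_AC_E)
    show ?thesis
      unfolding M(1) N(1) Vcomp_AC[OF mor M(2) N(2)]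
      using Vcomp_AC_entry_closed[OF mor M(2) N(2)] Hm
      by (intro Cells_AC_I) (auto intro!: abelian_monoid.finsum_closed)
  qed
  show "\<beta> \<bullet>\<^bsub>AC\<^esub> \<zero>\<^bsub>Hom2 AC A B\<^esub> = \<zero>\<^bsub>Hom2 AC A D\<^esub>" if "\<beta> \<in> Cells AC B D"
  proof -
    from that obtain N where N: "\<beta> = mk2 B D N" "matrix B D N" by (rule Cells_AC_E)
    have Z: "matrix A B (\<lambda>i j. \<zero>\<^bsub>Hom2 C (summand A j) (summand B i)\<^esub>)"
      using zero_closed summand_Mor mor by blast
    show ?thesis unfolding N(1) zero_AC Vcomp_AC[OF mor Z N(2)]
      using N(2) by (intro mk2_cong finsum_zero_entries Hm Vcomp_zero(1)) (auto intro: summand_Mor mor)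
  qed
  show "\<zero>\<^bsub>Hom2 AC B D\<^esub> \<bullet>\<^bsub>AC\<^esub> \<alpha> = \<zero>\<^bsub>Hom2 AC A D\<^esub>" if "\<alpha> \<in> Cells AC A B"
  proof -
    from that obtain M where M: "\<alpha> = mk2 A B M" "matrix A B M" by (rule Cells_AC_E)
    have Z: "matrix B D (\<lambda>i j. \<zero>\<^bsub>Hom2 C (summand B j) (summand D i)\<^esub>)"
      using zero_closed summand_Mor mor by blast
    show ?thesis unfolding M(1) zero_AC Vcomp_AC[OF mor M(2) Z]
      using M(2) by (intro mk2_cong finsum_zero_entries Hm Vcomp_zero(2)) (auto intro: summand_Mor mor)
  qed
next
  fix A A' B B' a b c \<alpha> \<beta>
  assume mor: "A \<in> Mor AC a b" "B \<in> Mor AC a b" "A' \<in> Mor AC b c" "B' \<in> Mor AC b c"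
    and \<alpha>: "\<alpha> \<in> Cells AC A B" and \<beta>: "\<beta> \<in> Cells AC A' B'"
  from \<alpha> obtain M where M: "\<alpha> = mk2 A B M" "matrix A B M" by (rule Cells_AC_E)
  from \<beta> obtain N where N: "\<beta> = mk2 A' B' N" "matrix A' B' N" by (rule Cells_AC_E)
  have bnd: "i div n < m" "i mod n < n" if "i < m * n" for i m n :: nat
    using that by (auto simp: less_mult_imp_div_less intro!: mod_less_divisor gr0I)
  show "\<beta> \<star>\<^bsub>AC\<^esub> \<alpha> \<in> Cells AC (A' \<diamondop>\<^bsub>AC\<^esub> A) (B' \<diamondop>\<^bsub>AC\<^esub> B)"
    unfolding M N
    apply (simp add: add_closure_def hom_sum2_def mk2_def[of A B] mk2_def[of A' B'])
    apply (intro exI conjI, rule HOL.refl)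
    using M(2) N(2) mor
    by (auto simp: rk_comp_sum1 summand_comp_sum1 bnd intro!: Hcomp_closed intro: summand_Mor)
qed

end

section \<open>2-categories presented by generators and relations\<close>

lemma gen_parallel: "snd (gsrc g) = snd (gtgt g) \<and> tgt (gsrc g) = tgt (gtgt g)"
  by (cases g) (auto simp: tgt_def)

lemma tgt_wcomp: "snd g = tgt f \<Longrightarrow> tgt (wcomp g f) = tgt g"
  by (simp add: tgt_def wcomp_def)

lemma snd_wcomp: "snd (wcomp g f) = snd f"
  by (simp add: wcomp_def)

lemma wcomp_assoc: "wcomp (wcomp h g) f = wcomp h (wcomp g f)"
  by (simp add: wcomp_def)

lemma wcomp_unit: "a = snd f \<Longrightarrow> wcomp f ([], a) = f" "wcomp ([], a) f = f"
  by (simp_all add: wcomp_def)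

lemma tgt_unit: "tgt ([], a) = a"
  by (simp add: tgt_def)

lemma wft_parallel: "wft G t \<Longrightarrow> snd (tdom t) = snd (tcod t) \<and> tgt (tdom t) = tgt (tcod t)"
  by (induction t) (auto simp: gen_parallel tgt_wcomp snd_wcomp)

lemma tsum_typed: "wft G (tsum f g ts) \<Longrightarrow> tdom (tsum f g ts) = f \<and> tcod (tsum f g ts) = g"
  by (induction ts) (auto simp: tsum_def)

text \<open>
  The rule \<open>rel\<close> of the congruence \<open>teq\<close> identifies whatever is listed in \<open>R\<close>; only for relations between
  parallel 2-morphisms do congruence classes have a well-defined source and target.
\<close>

locale typed_presentation =
  fixes G :: "gen set" and R :: "('k::field trm \<times> 'k trm) set"
  assumes typed: "\<lbrakk>(s, t) \<in> R; wft G s; wft G t\<rbrakk> \<Longrightarrow> tdom s = tdom t \<and> tcod s = tcod t"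
begin

lemma teq_typed: "teq G R s t \<Longrightarrow> wft G s \<and> wft G t \<and> tdom s = tdom t \<and> tcod s = tcod t"
proof (induction rule: teq.induct)
  case (rel s t) thus ?case using typed by blast
next
  case (interchange s' s t' t)
  then show ?case using wft_parallel[of G s] wft_parallel[of G t] wft_parallel[of G s'] wft_parallel[of G t']
    by (simp add: tgt_wcomp)
next
  case (Ad_zero t)
  then show ?case using wft_parallel[of G t] by simp
next
  case (Ad_minus t)
  then show ?case using wft_parallel[of G t] by simp
next
  case (Hc_assoc s t u)
  then show ?case by (simp add: snd_wcomp tgt_wcomp wcomp_assoc)
next
  case (Hc_unit_right t)
  then show ?case using wft_parallel[of G t] by (simp add: wcomp_unit tgt_unit)
next
  case (Hc_unit_left t)
  then show ?case by (simp add: wcomp_unit)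
next
  case (Hc_Idt g f)
  then show ?case by simp
qed (simp_all, (elim conjE, simp)+)

lemma cls_eq: "teq G R s t \<Longrightarrow> cls G R s = cls G R t"
  unfolding cls_def using teq.sym teq.trans by blast

text \<open>
  The operations on classes are unions over representatives; since \<open>teq\<close> is a congruence these unions
  collapse to the class of a single term. The same holds for two arguments in \<open>UN_cls2\<close>.
\<close>

lemma UN_cls:
  assumes "wft G t" "\<And>s. teq G R t s \<Longrightarrow> teq G R (h t) (h s)"
  shows "(\<Union>s\<in>cls G R t. cls G R (h s)) = cls G R (h t)"
proof -
  have "t \<in> cls G R t" using teq.refl assms(1) by (simp add: cls_def)
  moreover have "cls G R (h s) = cls G R (h t)" if "s \<in> cls G R t" for s
    using that assms(2) cls_eq by (metis cls_def mem_Collect_eq)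
  ultimately show ?thesis by blast
qed

lemma UN_cls2:
  assumes "wft G s" "wft G t" "\<And>s' t'. \<lbrakk>teq G R s s'; teq G R t t'\<rbrakk> \<Longrightarrow> teq G R (h s t) (h s' t')"
  shows "(\<Union>s'\<in>cls G R s. \<Union>t'\<in>cls G R t. cls G R (h s' t')) = cls G R (h s t)"
proof -
  have 1: "s \<in> cls G R s" "t \<in> cls G R t" using teq.refl assms(1,2) by (simp_all add: cls_def)
  have 2: "cls G R (h s' t') = cls G R (h s t)" if "s' \<in> cls G R s" "t' \<in> cls G R t" for s' t'
    using that assms(3) cls_eq by (metis cls_def mem_Collect_eq)
  show ?thesis using 1 2 by blast
qed

abbreviation P :: "(int, word, 'k trm set, 'k) gr2cat" where "P \<equiv> presented G R"

lemma Cells_P: "Cells P f g = {cls G R t | t. wft G t \<and> tdom t = f \<and> tcod t = g}"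
  by (simp add: presented_def pres_hom_def)

lemma Cells_P_E:
  assumes "\<alpha> \<in> Cells P f g"
  obtains t where "\<alpha> = cls G R t" "wft G t" "tdom t = f" "tcod t = g"
  using assms unfolding Cells_P by blast

lemma cls_Cells: "wft G t \<Longrightarrow> cls G R t \<in> Cells P (tdom t) (tcod t)"
  unfolding Cells_P by blast

lemma zero_P: "\<zero>\<^bsub>Hom2 P f g\<^esub> = cls G R (Ze f g)"
  by (simp add: presented_def pres_hom_def)

lemma add_P: "wft G (s +\<^sub>t t) \<Longrightarrow> cls G R s \<oplus>\<^bsub>Hom2 P f g\<^esub> cls G R t = cls G R (s +\<^sub>t t)"
  by (simp add: presented_def pres_hom_def) (rule UN_cls2, simp, simp, rule teq.cong_Ad, simp_all)

lemma smult_P: "wft G t \<Longrightarrow> r \<odot>\<^bsub>Hom2 P f g\<^esub> cls G R t = cls G R (r *\<^sub>t t)"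
  by (simp add: presented_def pres_hom_def) (rule UN_cls, simp, rule teq.cong_Sm, simp)

lemma Vcomp_P: "wft G (s \<bullet>\<^sub>t t) \<Longrightarrow> cls G R s \<bullet>\<^bsub>P\<^esub> cls G R t = cls G R (s \<bullet>\<^sub>t t)"
  by (simp add: presented_def) (rule UN_cls2, simp, simp, rule teq.cong_Vc, simp_all)

lemma Hcomp_P: "wft G (s \<star>\<^sub>t t) \<Longrightarrow> cls G R s \<star>\<^bsub>P\<^esub> cls G R t = cls G R (s \<star>\<^sub>t t)"
  by (simp add: presented_def) (rule UN_cls2, simp, simp, rule teq.cong_Hc, simp_all)

lemma Id2_P: "Id2 P f = cls G R (Idt f)"
  by (simp add: presented_def)

lemma Mor_P: "f \<in> Mor P a b \<longleftrightarrow> snd f = a \<and> tgt f = b"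
  by (simp add: presented_def)

lemma Hom2_P_group:
  assumes "snd f = snd g" "tgt f = tgt g"
  shows "abelian_group (Hom2 P f g)"
proof (rule abelian_groupI)
  show "\<zero>\<^bsub>Hom2 P f g\<^esub> \<in> Cells P f g"
    using cls_Cells[of "Ze f g"] assms by (simp add: zero_P)
next
  fix x y assume "x \<in> Cells P f g" "y \<in> Cells P f g"
  thus "x \<oplus>\<^bsub>Hom2 P f g\<^esub> y \<in> Cells P f g"
    by (elim Cells_P_E) (simp add: add_P, simp add: Cells_P, force)
next
  fix x y assume "x \<in> Cells P f g" "y \<in> Cells P f g"
  thus "x \<oplus>\<^bsub>Hom2 P f g\<^esub> y = y \<oplus>\<^bsub>Hom2 P f g\<^esub> x"
    by (elim Cells_P_E) (simp add: add_P cls_eq teq.Ad_comm)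
next
  fix x y z assume "x \<in> Cells P f g" "y \<in> Cells P f g" "z \<in> Cells P f g"
  thus "x \<oplus>\<^bsub>Hom2 P f g\<^esub> y \<oplus>\<^bsub>Hom2 P f g\<^esub> z = x \<oplus>\<^bsub>Hom2 P f g\<^esub> (y \<oplus>\<^bsub>Hom2 P f g\<^esub> z)"
    by (elim Cells_P_E) (simp add: add_P cls_eq teq.Ad_assoc)
next
  fix x assume "x \<in> Cells P f g"
  thus "\<zero>\<^bsub>Hom2 P f g\<^esub> \<oplus>\<^bsub>Hom2 P f g\<^esub> x = x"
  proof (rule Cells_P_E)
    fix t assume "x = cls G R t" "wft G t" "tdom t = f" "tcod t = g"
    thus ?thesis using assms teq.Ad_zero[of G t R] by (simp add: zero_P add_P cls_eq)
  qed
next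
  fix x assume "x \<in> Cells P f g"
  then obtain t where t: "x = cls G R t" "wft G t" "tdom t = f" "tcod t = g" by (rule Cells_P_E)
  have "teq G R ((- 1) *\<^sub>t t +\<^sub>t t) (Ze f g)"
    using t teq.Ad_minus[of G t R] teq.Ad_comm[of G "(- 1) *\<^sub>t t" t R] teq.trans by auto
  hence "cls G R ((- 1) *\<^sub>t t) \<oplus>\<^bsub>Hom2 P f g\<^esub> x = \<zero>\<^bsub>Hom2 P f g\<^esub>"
    using t by (simp add: zero_P add_P cls_eq)
  moreover have "cls G R ((- 1) *\<^sub>t t) \<in> Cells P f g"
    using t cls_Cells[of "(- 1) *\<^sub>t t"] by simp
  ultimately show "\<exists>y\<in>Cells P f g. y \<oplus>\<^bsub>Hom2 P f g\<^esub> x = \<zero>\<^bsub>Hom2 P f g\<^esub>" by blast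
qed

lemma presented_linear_2cat_part: "linear_2cat_part P"
proof (rule linear_2cat_part.intro)
  \<comment> \<open>Both zero laws follow from \<open>0 + 0 = 0\<close> by distributivity: the composite is an idempotent of the addition.\<close>
  have idem: "x = \<zero>\<^bsub>Hom2 P f g\<^esub>"
    if "snd f = snd g" "tgt f = tgt g" "x \<in> Cells P f g" "x \<oplus>\<^bsub>Hom2 P f g\<^esub> x = x" for f g x
  proof -
    interpret abelian_group "Hom2 P f g" using Hom2_P_group that by blast
    show ?thesis using that(3,4) by (metis add.l_cancel_one)
  qed
  have zz: "cls G R (Ze f g +\<^sub>t Ze f g) = cls G R (Ze f g)" if "snd f = snd g" "tgt f = tgt g" for f g
    using that teq.Ad_zero[of G "Ze f g" R] by (simp add: cls_eq)
  fix a b f g h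
  assume mor: "f \<in> Mor P a b" "g \<in> Mor P a b" "h \<in> Mor P a b"
  show "\<beta> \<bullet>\<^bsub>P\<^esub> \<zero>\<^bsub>Hom2 P f g\<^esub> = \<zero>\<^bsub>Hom2 P f h\<^esub>" if "\<beta> \<in> Cells P g h" for \<beta>
  proof -
    from that obtain t where t: "\<beta> = cls G R t" "wft G t" "tdom t = g" "tcod t = h" by (rule Cells_P_E)
    let ?z = "Ze f g"
    have w: "wft G (t \<bullet>\<^sub>t ?z)" using t mor by (simp add: Mor_P)
    have "cls G R (t \<bullet>\<^sub>t ?z) \<oplus>\<^bsub>Hom2 P f h\<^esub> cls G R (t \<bullet>\<^sub>t ?z) = cls G R (t \<bullet>\<^sub>t (?z +\<^sub>t ?z))"
      using w t teq.Vc_Ad_right[of G t ?z ?z R] by (simp add: add_P cls_eq)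
    also have "\<dots> = cls G R (t \<bullet>\<^sub>t ?z)"
      using w zz[of f g] Vcomp_P[of t "?z +\<^sub>t ?z"] Vcomp_P[of t ?z] by simp
    finally have "cls G R (t \<bullet>\<^sub>t ?z) = \<zero>\<^bsub>Hom2 P f h\<^esub>"
      using cls_Cells[OF w] t mor by (intro idem) (auto simp: Mor_P)
    thus ?thesis using w t by (simp add: zero_P Vcomp_P)
  qed
  show "\<zero>\<^bsub>Hom2 P g h\<^esub> \<bullet>\<^bsub>P\<^esub> \<alpha> = \<zero>\<^bsub>Hom2 P f h\<^esub>" if "\<alpha> \<in> Cells P f g" for \<alpha>
  proof -
    from that obtain t where t: "\<alpha> = cls G R t" "wft G t" "tdom t = f" "tcod t = g" by (rule Cells_P_E)
    let ?z = "Ze g h"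
    have w: "wft G (?z \<bullet>\<^sub>t t)" using t mor by (simp add: Mor_P)
    have "cls G R (?z \<bullet>\<^sub>t t) \<oplus>\<^bsub>Hom2 P f h\<^esub> cls G R (?z \<bullet>\<^sub>t t) = cls G R ((?z +\<^sub>t ?z) \<bullet>\<^sub>t t)"
      using w t teq.Vc_Ad_left[of G ?z ?z t R] by (simp add: add_P cls_eq)
    also have "\<dots> = cls G R (?z \<bullet>\<^sub>t t)"
    proof -
      have "snd g = snd h" "tgt g = tgt h" using mor by (auto simp: Mor_P)
      thus ?thesis using w zz[of g h] Vcomp_P[of "?z +\<^sub>t ?z" t] Vcomp_P[of ?z t] by simp
    qed
    finally have "cls G R (?z \<bullet>\<^sub>t t) = \<zero>\<^bsub>Hom2 P f h\<^esub>"
      using cls_Cells[OF w] t mor by (intro idem) (auto simp: Mor_P)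
    thus ?thesis using w t by (simp add: zero_P Vcomp_P)
  qed
  show "\<beta> \<bullet>\<^bsub>P\<^esub> \<alpha> \<in> Cells P f h" if "\<alpha> \<in> Cells P f g" "\<beta> \<in> Cells P g h" for \<alpha> \<beta>
    using that by (elim Cells_P_E) (simp add: Vcomp_P, simp add: Cells_P, force)
next
  fix a b f g
  assume mor: "f \<in> Mor P a b" "g \<in> Mor P a b"
  show "abelian_group (Hom2 P f g)" using mor by (intro Hom2_P_group) (auto simp: Mor_P)
  show "r \<odot>\<^bsub>Hom2 P f g\<^esub> \<alpha> \<in> Cells P f g" if "\<alpha> \<in> Cells P f g" for r \<alpha>
    using that by (elim Cells_P_E) (simp add: smult_P, simp add: Cells_P, force)
  show "\<alpha> \<bullet>\<^bsub>P\<^esub> Id2 P f = \<alpha>" "Id2 P g \<bullet>\<^bsub>P\<^esub> \<alpha> = \<alpha>" if "\<alpha> \<in> Cells P f g" for \<alpha>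
  proof -
    from that obtain t where t: "\<alpha> = cls G R t" "wft G t" "tdom t = f" "tcod t = g" by (rule Cells_P_E)
    show "\<alpha> \<bullet>\<^bsub>P\<^esub> Id2 P f = \<alpha>" "Id2 P g \<bullet>\<^bsub>P\<^esub> \<alpha> = \<alpha>"
      using t teq.Vc_id_right[of G t R] teq.Vc_id_left[of G t R] by (auto simp: Id2_P Vcomp_P cls_eq)
  qed
next
  show "f \<in> Mor P a b \<Longrightarrow> a \<in> Objs P \<and> b \<in> Objs P" for f a b
    by (simp add: presented_def)
  show "f \<in> Mor P a b \<Longrightarrow> g \<in> Mor P b c \<Longrightarrow> g \<diamondop>\<^bsub>P\<^esub> f \<in> Mor P a c" for f g a b c
    by (auto simp: presented_def tgt_wcomp snd_wcomp)
  show "f \<in> Mor P a b \<Longrightarrow> Id2 P f \<in> Cells P f f" for f a b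
    using cls_Cells[of "Idt f"] by (simp add: Id2_P)
next
  fix a b c f f' g g' \<alpha> \<beta>
  assume mor: "f \<in> Mor P a b" "f' \<in> Mor P a b" "g \<in> Mor P b c" "g' \<in> Mor P b c"
    and \<alpha>: "\<alpha> \<in> Cells P f f'" and \<beta>: "\<beta> \<in> Cells P g g'"
  obtain s where s: "\<alpha> = cls G R s" "wft G s" "tdom s = f" "tcod s = f'" using \<alpha> by (rule Cells_P_E)
  obtain t where t: "\<beta> = cls G R t" "wft G t" "tdom t = g" "tcod t = g'" using \<beta> by (rule Cells_P_E)
  show "\<beta> \<star>\<^bsub>P\<^esub> \<alpha> \<in> Cells P (g \<diamondop>\<^bsub>P\<^esub> f) (g' \<diamondop>\<^bsub>P\<^esub> f')"
    using cls_Cells[of "t \<star>\<^sub>t s"] s t mor by (simp add: Mor_P Hcomp_P) (simp add: presented_def)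
qed

abbreviation AP :: "(int, mor1, 'k mor2, 'k) gr2cat" where "AP \<equiv> add_closure P"

lemma wrd_simps [simp]: "rk (wrd f) = 1" "summand (wrd f) 0 = f"
  by (simp_all add: wrd_def rk_def summand_def)

lemma Mor_wrd: "wrd f \<in> Mor AP (snd f) (tgt f)"
  by (simp add: wrd_def add_closure_def presented_def)

lemma cell_Cells: "wft G t \<Longrightarrow> cell G R t \<in> Cells AP (wrd (tdom t)) (wrd (tcod t))"
  unfolding cell_def using cls_Cells
  by (intro linear_2cat_part.Cells_AC_I[OF presented_linear_2cat_part]) simp

lemma cell_eq: "teq G R s t \<Longrightarrow> cell G R s = cell G R t"
  unfolding cell_def using teq_typed cls_eq by metis

lemma cell_Ze: "cell G R (Ze f g) = \<zero>\<^bsub>Hom2 AP (wrd f) (wrd g)\<^esub>"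
  by (simp add: cell_def linear_2cat_part.zero_AC[OF presented_linear_2cat_part] mk2_eq_iff zero_P)

lemma cell_Idt: "cell G R (Idt f) = Id2 AP (wrd f)"
  by (simp add: cell_def linear_2cat_part.Id2_AC[OF presented_linear_2cat_part] mk2_eq_iff Id2_P)

lemma cell_Ad: "wft G (s +\<^sub>t t) \<Longrightarrow>
    cell G R (s +\<^sub>t t) = cell G R s \<oplus>\<^bsub>Hom2 AP (wrd (tdom s)) (wrd (tcod s))\<^esub> cell G R t"
  by (simp add: cell_def linear_2cat_part.add_AC[OF presented_linear_2cat_part] add_P)

lemma cell_Sm: "wft G t \<Longrightarrow>
    cell G R (r *\<^sub>t t) = r \<odot>\<^bsub>Hom2 AP (wrd (tdom t)) (wrd (tcod t))\<^esub> cell G R t"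
  by (simp add: cell_def linear_2cat_part.smult_AC[OF presented_linear_2cat_part] smult_P)

text \<open>
  Passing from terms to \<open>1 \<times> 1\<close> matrices is compatible with the operations, so a calculation with terms
  is a calculation in the closure under sums and shifts.
\<close>

lemma cell_Vc: assumes "wft G (s \<bullet>\<^sub>t t)" shows "cell G R (s \<bullet>\<^sub>t t) = cell G R s \<bullet>\<^bsub>AP\<^esub> cell G R t"
proof -
  let ?a = "snd (tdom t)" and ?b = "tgt (tdom t)"
  have mor: "wrd (tdom t) \<in> Mor AP ?a ?b" "wrd (tcod t) \<in> Mor AP ?a ?b" "wrd (tcod s) \<in> Mor AP ?a ?b"
    using assms wft_parallel[of G t] wft_parallel[of G s] Mor_wrd[of "tdom t"] Mor_wrd[of "tcod t"] Mor_wrd[of "tcod s"]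
    by auto
  have st: "tdom s = tcod t" using assms by simp
  show ?thesis
    using assms cls_Cells[of s] cls_Cells[of t] unfolding cell_def st tdom.simps tcod.simps
    by (subst linear_2cat_part.Vcomp_AC_single[OF presented_linear_2cat_part mor, where l = "\<lambda>_ _. 0"])
      (auto simp: Vcomp_P)
qed

lemma wrd_comp: "snd g = tgt f \<Longrightarrow> wrd g \<diamondop>\<^bsub>AP\<^esub> wrd f = wrd (wcomp g f)"
  by (simp add: wrd_def add_closure_def comp_sum1_def presented_def tgt_wcomp snd_wcomp)

lemma cell_Hc: assumes "wft G (s \<star>\<^sub>t t)" shows "cell G R (s \<star>\<^sub>t t) = cell G R s \<star>\<^bsub>AP\<^esub> cell G R t"
proof -
  have comp: "comp_sum1 P (wrd g) (wrd f) = wrd (wcomp g f)" if "snd g = tgt f" for g f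
    using wrd_comp[OF that] by (simp add: add_closure_def)
  have "cell G R s \<star>\<^bsub>AP\<^esub> cell G R t
      = mk2 (comp_sum1 P (wrd (tdom s)) (wrd (tdom t))) (comp_sum1 P (wrd (tcod s)) (wrd (tcod t)))
          (\<lambda>i j. cls G R s \<star>\<^bsub>P\<^esub> cls G R t)"
    by (simp add: cell_def add_closure_def) (auto simp: mk2_def fun_eq_iff rk_comp_sum1)
  also have "\<dots> = cell G R (s \<star>\<^sub>t t)"
    using assms wft_parallel[of G s] wft_parallel[of G t] by (simp add: comp Hcomp_P cell_def)
  finally show ?thesis ..
qed

end

lemma common_rels_typed: "(s, t) \<in> common_rels \<Longrightarrow> tdom s = tdom t \<and> tcod s = tcod t"
  by (cases rule: common_rels.cases) (auto simp: wcomp_def)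

lemma dots_typed: "tdom (dots m n) = ([\<E>], m) \<and> tcod (dots m n) = ([\<E>], m)"
  by (induction n) (auto simp: dots_def)

lemma bub_typed: "tdom (bub m k) = ([], m) \<and> tcod (bub m k) = ([], m)"
  "tdom (bub' m k) = ([], m) \<and> tcod (bub' m k) = ([], m)"
  by (auto simp: bub_def bub'_def)

lemma U_presentation: "typed_presentation U_gens (U_rels :: ('k::field trm \<times> 'k trm) set)"
proof
  fix s t :: "'k trm" assume "(s, t) \<in> U_rels" "wft U_gens s" "wft U_gens t"
  thus "tdom s = tdom t \<and> tcod s = tcod t"
    by (cases rule: U_rels.cases)
      (auto simp: common_rels_typed wcomp_def bub_typed dots_typed sig_def sig'_def dest: tsum_typed)
qed

lemma UR_presentation: "typed_presentation UR_gens (UR_rels :: ('k::field trm \<times> 'k trm) set)"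
proof
  fix s t :: "'k trm" assume "(s, t) \<in> UR_rels" "wft UR_gens s" "wft UR_gens t"
  thus "tdom s = tdom t \<and> tcod s = tcod t"
    by (cases rule: UR_rels.cases)
      (auto simp: common_rels_typed wcomp_def sig_def eta_dots_def eps_dots_def dots_typed dest: tsum_typed)
qed

section \<open>The defect of a 2-functor\<close>

lemma (in abelian_group) diff_add_add:
  assumes "x \<in> carrier G" "y \<in> carrier G" "x' \<in> carrier G" "y' \<in> carrier G"
  shows "(x \<oplus> y) \<ominus> (x' \<oplus> y') = (x \<ominus> x') \<oplus> (y \<ominus> y')"
  using assms by (simp add: minus_eq minus_add a_ac)

lemma (in abelian_group) diff_eq_zero_iff:
  assumes "x \<in> carrier G" "y \<in> carrier G"
  shows "x \<ominus> y = \<zero> \<longleftrightarrow> x = y"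
  using assms by (metis minus_eq minus_equality r_neg a_inv_closed minus_minus)

lemma (in abelian_group) eq_diffI:
  assumes "x \<in> carrier G" "y \<in> carrier G" "x \<oplus> y = z"
  shows "x = z \<ominus> y"
  using assms by (metis minus_eq a_assoc r_neg a_inv_closed r_zero)

lemma (in abelian_group) idem_zero: "\<lbrakk>x \<in> carrier G; x = x \<oplus> x\<rbrakk> \<Longrightarrow> x = \<zero>"
  by (metis add.l_cancel_one)

context graded_2cat
begin

lemma Deg2_Cells: "\<lbrakk>f \<in> Mor C a b; g \<in> Mor C a b; \<alpha> \<in> Deg2 C f g d\<rbrakk> \<Longrightarrow> \<alpha> \<in> Cells C f g"
  using Deg2_submodule[of f a b g d] submodule.axioms(1) subgroup.subset by fastforce

lemma abelian_Hom2: "\<lbrakk>f \<in> Mor C a b; g \<in> Mor C a b\<rbrakk> \<Longrightarrow> abelian_group (Hom2 C f g)"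
  using Hom2_module module.axioms(2) by blast

lemma Vcomp_diff_right:
  assumes "f \<in> Mor C a b" "g \<in> Mor C a b" "h \<in> Mor C a b" "x \<in> Cells C f g" "y \<in> Cells C f g" "\<beta> \<in> Cells C g h"
  shows "\<beta> \<bullet> (x \<ominus>\<^bsub>Hom2 C f g\<^esub> y) = (\<beta> \<bullet> x) \<ominus>\<^bsub>Hom2 C f h\<^esub> (\<beta> \<bullet> y)"
proof -
  interpret H: abelian_group "Hom2 C f g" using assms abelian_Hom2 by blast
  interpret H': abelian_group "Hom2 C f h" using assms abelian_Hom2 by blast
  have "(x \<ominus>\<^bsub>Hom2 C f g\<^esub> y) \<oplus>\<^bsub>Hom2 C f g\<^esub> y = x"
    using assms(4,5) by (simp add: H.minus_eq H.a_assoc H.l_neg)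
  thus ?thesis
    using assms Vcomp_add(1)[of f a b g h "x \<ominus>\<^bsub>Hom2 C f g\<^esub> y" y \<beta>]
    by (intro H'.eq_diffI) (auto intro: Vcomp_closed[of f a b g h])
qed

lemma Vcomp_diff_left:
  assumes "f \<in> Mor C a b" "g \<in> Mor C a b" "h \<in> Mor C a b" "x \<in> Cells C g h" "y \<in> Cells C g h" "\<alpha> \<in> Cells C f g"
  shows "(x \<ominus>\<^bsub>Hom2 C g h\<^esub> y) \<bullet> \<alpha> = (x \<bullet> \<alpha>) \<ominus>\<^bsub>Hom2 C f h\<^esub> (y \<bullet> \<alpha>)"
proof -
  interpret H: abelian_group "Hom2 C g h" using assms abelian_Hom2 by blast
  interpret H': abelian_group "Hom2 C f h" using assms abelian_Hom2 by blast
  have "(x \<ominus>\<^bsub>Hom2 C g h\<^esub> y) \<oplus>\<^bsub>Hom2 C g h\<^esub> y = x"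
    using assms(4,5) by (simp add: H.minus_eq H.a_assoc H.l_neg)
  thus ?thesis
    using assms Vcomp_add(2)[of f a b g h \<alpha> "x \<ominus>\<^bsub>Hom2 C g h\<^esub> y" y]
    by (intro H'.eq_diffI) (auto intro: Vcomp_closed[of f a b g h])
qed

lemma Vcomp_zero_right:
  assumes "f \<in> Mor C a b" "g \<in> Mor C a b" "h \<in> Mor C a b" "\<beta> \<in> Cells C g h"
  shows "\<beta> \<bullet> \<zero>\<^bsub>Hom2 C f g\<^esub> = \<zero>\<^bsub>Hom2 C f h\<^esub>"
proof -
  interpret H: abelian_group "Hom2 C f g" using assms abelian_Hom2 by blast
  interpret H': abelian_group "Hom2 C f h" using assms abelian_Hom2 by blast
  show ?thesis using assms Vcomp_add(1)[of f a b g h "\<zero>\<^bsub>Hom2 C f g\<^esub>" "\<zero>\<^bsub>Hom2 C f g\<^esub>" \<beta>]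
    by (intro H'.idem_zero) (auto intro: Vcomp_closed[of f a b g h])
qed

lemma Vcomp_zero_left:
  assumes "f \<in> Mor C a b" "g \<in> Mor C a b" "h \<in> Mor C a b" "\<alpha> \<in> Cells C f g"
  shows "\<zero>\<^bsub>Hom2 C g h\<^esub> \<bullet> \<alpha> = \<zero>\<^bsub>Hom2 C f h\<^esub>"
proof -
  interpret H: abelian_group "Hom2 C g h" using assms abelian_Hom2 by blast
  interpret H': abelian_group "Hom2 C f h" using assms abelian_Hom2 by blast
  show ?thesis using assms Vcomp_add(2)[of f a b g h \<alpha> "\<zero>\<^bsub>Hom2 C g h\<^esub>" "\<zero>\<^bsub>Hom2 C g h\<^esub>"]
    by (intro H'.idem_zero) (auto intro: Vcomp_closed[of f a b g h])
qed

end

text \<open>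
  Additivity forces the image of zero to be an idempotent of the addition.
\<close>

lemma graded_2functor_zero:
  assumes F: "graded_2functor C D F" and mor: "A \<in> Mor C a b" "B \<in> Mor C a b"
    and C: "abelian_group (Hom2 C A B)" and D: "abelian_group (Hom2 D (fmor F A) (fmor F B))"
  shows "fcell F \<zero>\<^bsub>Hom2 C A B\<^esub> = \<zero>\<^bsub>Hom2 D (fmor F A) (fmor F B)\<^esub>"
proof -
  interpret C: abelian_group "Hom2 C A B" by (fact C)
  interpret D: abelian_group "Hom2 D (fmor F A) (fmor F B)" by (fact D)
  show ?thesis
    using graded_2functor.fcell_add[OF F mor C.zero_closed C.zero_closed]
      graded_2functor.fcell_closed[OF F mor C.zero_closed]
    by (intro D.idem_zero) auto
qed

locale derivation =
  fixes C :: "('o, 'f, 'a, 'k::field) gr2cat" (structure) and \<delta> :: "'a \<Rightarrow> 'a"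
  assumes d_closed: "\<lbrakk>f \<in> Mor C a b; g \<in> Mor C a b; \<alpha> \<in> Cells C f g\<rbrakk> \<Longrightarrow> \<delta> \<alpha> \<in> Cells C f g"
    and d_add: "\<lbrakk>f \<in> Mor C a b; g \<in> Mor C a b; \<alpha> \<in> Cells C f g; \<beta> \<in> Cells C f g\<rbrakk>
        \<Longrightarrow> \<delta> (\<alpha> \<oplus>\<^bsub>Hom2 C f g\<^esub> \<beta>) = \<delta> \<alpha> \<oplus>\<^bsub>Hom2 C f g\<^esub> \<delta> \<beta>"
    and d_smult: "\<lbrakk>f \<in> Mor C a b; g \<in> Mor C a b; \<alpha> \<in> Cells C f g\<rbrakk>
        \<Longrightarrow> \<delta> (r \<odot>\<^bsub>Hom2 C f g\<^esub> \<alpha>) = r \<odot>\<^bsub>Hom2 C f g\<^esub> \<delta> \<alpha>"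
    and Leibniz_Vcomp:
      "\<lbrakk>f \<in> Mor C a b; g \<in> Mor C a b; h \<in> Mor C a b; \<alpha> \<in> Cells C f g; \<beta> \<in> Cells C g h\<rbrakk>
        \<Longrightarrow> \<delta> (\<beta> \<bullet> \<alpha>) = (\<delta> \<beta> \<bullet> \<alpha>) \<oplus>\<^bsub>Hom2 C f h\<^esub> (\<beta> \<bullet> \<delta> \<alpha>)"
    and Leibniz_Hcomp:
      "\<lbrakk>f \<in> Mor C a b; f' \<in> Mor C a b; g \<in> Mor C b c; g' \<in> Mor C b c; \<alpha> \<in> Cells C f f'; \<beta> \<in> Cells C g g'\<rbrakk>
        \<Longrightarrow> \<delta> (\<beta> \<star> \<alpha>) = (\<delta> \<beta> \<star> \<alpha>) \<oplus>\<^bsub>Hom2 C (g \<diamondop> f) (g' \<diamondop> f')\<^esub> (\<beta> \<star> \<delta> \<alpha>)"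

lemma p_differential_derivation: "p_differential p C \<delta> \<Longrightarrow> derivation C \<delta>"
  unfolding p_differential_def derivation_def by auto

text \<open>
  A 2-functor \<open>F\<close> between 2-categories with derivations, with closed structure isomorphisms. The question
  when \<open>F\<close> commutes with the derivations is studied through the difference of the two sides.
\<close>

locale derivation_comparison =
  C: linear_2cat_part C + dC: derivation C \<delta> + K: graded_2cat K + dK: derivation K \<delta>K + F: graded_2functor C K F
  for C :: "('o, 'f, 'a, 'k::field) gr2cat" and \<delta> :: "'a \<Rightarrow> 'a"
    and K :: "('o1, 'f1, 'a1, 'k) gr2cat" and \<delta>K :: "'a1 \<Rightarrow> 'a1"
    and F :: "('o, 'f, 'a, 'o1, 'f1, 'a1) fun2" +
  assumes coherence: "closed_coherence C K \<delta>K F"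
begin

abbreviation HK :: "'f \<Rightarrow> 'f \<Rightarrow> ('k, 'a1) module" where "HK A B \<equiv> Hom2 K (fmor F A) (fmor F B)"

text \<open>
  The difference is a derivation along \<open>F\<close> (\<open>defect_Vcomp\<close>), which is why its vanishing propagates along
  composites and, more importantly, to inverses.
\<close>

definition defect :: "'f \<Rightarrow> 'f \<Rightarrow> 'a \<Rightarrow> 'a1"
  where "defect A B \<alpha> = \<delta>K (fcell F \<alpha>) \<ominus>\<^bsub>HK A B\<^esub> fcell F (\<delta> \<alpha>)"

lemma HK_group: "\<lbrakk>A \<in> Mor C a b; B \<in> Mor C a b\<rbrakk> \<Longrightarrow> abelian_group (HK A B)"
  using K.abelian_Hom2 F.fmor_closed by blast

lemma F_zero:
  assumes "A \<in> Mor C a b" "B \<in> Mor C a b"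
  shows "fcell F \<zero>\<^bsub>Hom2 C A B\<^esub> = \<zero>\<^bsub>HK A B\<^esub>"
  using graded_2functor_zero[OF F.graded_2functor_axioms assms C.Hom2_group[OF assms] HK_group[OF assms]] .

lemma image_closed:
  assumes "A \<in> Mor C a b" "B \<in> Mor C a b" "\<alpha> \<in> Cells C A B"
  shows "fcell F \<alpha> \<in> carrier (HK A B)" "\<delta>K (fcell F \<alpha>) \<in> carrier (HK A B)" "fcell F (\<delta> \<alpha>) \<in> carrier (HK A B)"
proof -
  note m = F.fmor_closed[OF assms(1)] F.fmor_closed[OF assms(2)]
  show "fcell F \<alpha> \<in> carrier (HK A B)" using F.fcell_closed assms by blast
  thus "\<delta>K (fcell F \<alpha>) \<in> carrier (HK A B)" by (rule dK.d_closed[OF m])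
  show "fcell F (\<delta> \<alpha>) \<in> carrier (HK A B)" using F.fcell_closed dC.d_closed assms by blast
qed

lemma defect_closed:
  assumes "A \<in> Mor C a b" "B \<in> Mor C a b" "\<alpha> \<in> Cells C A B"
  shows "defect A B \<alpha> \<in> carrier (HK A B)"
  unfolding defect_def using image_closed[OF assms] abelian_group.minus_closed[OF HK_group[OF assms(1,2)]] by blast

lemma defect_eq_zero_iff:
  assumes "A \<in> Mor C a b" "B \<in> Mor C a b" "\<alpha> \<in> Cells C A B"
  shows "defect A B \<alpha> = \<zero>\<^bsub>HK A B\<^esub> \<longleftrightarrow> \<delta>K (fcell F \<alpha>) = fcell F (\<delta> \<alpha>)"
  unfolding defect_def using image_closed[OF assms] abelian_group.diff_eq_zero_iff[OF HK_group[OF assms(1,2)]] by blast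

lemma defect_add:
  assumes "A \<in> Mor C a b" "B \<in> Mor C a b" "\<alpha> \<in> Cells C A B" "\<beta> \<in> Cells C A B"
  shows "defect A B (\<alpha> \<oplus>\<^bsub>Hom2 C A B\<^esub> \<beta>) = defect A B \<alpha> \<oplus>\<^bsub>HK A B\<^esub> defect A B \<beta>"
proof -
  note m = F.fmor_closed[OF assms(1)] F.fmor_closed[OF assms(2)]
  note ab = assms(1,2)
  show ?thesis
    unfolding defect_def
    using abelian_group.diff_add_add[OF HK_group[OF ab]] image_closed[OF ab assms(3)] image_closed[OF ab assms(4)]
    by (simp add: F.fcell_add[OF ab assms(3,4)] dK.d_add[OF m] dC.d_add[OF ab assms(3,4)]
        F.fcell_add[OF ab] dC.d_closed[OF ab] assms(3,4))
qed

lemma commutes_smult: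
  assumes "A \<in> Mor C a b" "B \<in> Mor C a b" "\<alpha> \<in> Cells C A B" "\<delta>K (fcell F \<alpha>) = fcell F (\<delta> \<alpha>)"
  shows "\<delta>K (fcell F (r \<odot>\<^bsub>Hom2 C A B\<^esub> \<alpha>)) = fcell F (\<delta> (r \<odot>\<^bsub>Hom2 C A B\<^esub> \<alpha>))"
proof -
  note m = F.fmor_closed[OF assms(1)] F.fmor_closed[OF assms(2)]
  note ab = assms(1,2)
  show ?thesis
    using assms by (simp add: F.fcell_smult[OF ab] dK.d_smult[OF m] dC.d_smult[OF ab] dC.d_closed[OF ab] image_closed[OF ab])
qed

lemma defect_Vcomp:
  assumes mor: "A \<in> Mor C a b" "B \<in> Mor C a b" "D \<in> Mor C a b" and \<alpha>: "\<alpha> \<in> Cells C A B" and \<beta>: "\<beta> \<in> Cells C B D"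
  shows "defect A D (\<beta> \<bullet>\<^bsub>C\<^esub> \<alpha>)
      = (defect B D \<beta> \<bullet>\<^bsub>K\<^esub> fcell F \<alpha>) \<oplus>\<^bsub>HK A D\<^esub> (fcell F \<beta> \<bullet>\<^bsub>K\<^esub> defect A B \<alpha>)"
proof -
  note m = F.fmor_closed[OF mor(1)] F.fmor_closed[OF mor(2)] F.fmor_closed[OF mor(3)]
  note ia = image_closed[OF mor(1,2) \<alpha>] and ib = image_closed[OF mor(2,3) \<beta>]
  note da = dC.d_closed[OF mor(1,2) \<alpha>] and db = dC.d_closed[OF mor(2,3) \<beta>]
  interpret H: abelian_group "HK A D" using HK_group mor by blast
  have 1: "\<delta>K (fcell F (\<beta> \<bullet>\<^bsub>C\<^esub> \<alpha>)) = (\<delta>K (fcell F \<beta>) \<bullet>\<^bsub>K\<^esub> fcell F \<alpha>) \<oplus>\<^bsub>HK A D\<^esub> (fcell F \<beta> \<bullet>\<^bsub>K\<^esub> \<delta>K (fcell F \<alpha>))"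
    by (simp add: F.fcell_Vcomp[OF mor \<alpha> \<beta>] dK.Leibniz_Vcomp[OF m ia(1) ib(1)])
  have 2: "fcell F (\<delta> (\<beta> \<bullet>\<^bsub>C\<^esub> \<alpha>)) = (fcell F (\<delta> \<beta>) \<bullet>\<^bsub>K\<^esub> fcell F \<alpha>) \<oplus>\<^bsub>HK A D\<^esub> (fcell F \<beta> \<bullet>\<^bsub>K\<^esub> fcell F (\<delta> \<alpha>))"
    by (simp add: dC.Leibniz_Vcomp[OF mor \<alpha> \<beta>] F.fcell_add[OF mor(1,3)] C.Vcomp_closed[OF mor] \<alpha> \<beta> da db
        F.fcell_Vcomp[OF mor])
  note cl = K.Vcomp_closed[OF m ia(1) ib(2)] K.Vcomp_closed[OF m ia(2) ib(1)]
    K.Vcomp_closed[OF m ia(1) ib(3)] K.Vcomp_closed[OF m ia(3) ib(1)]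
  show ?thesis
    unfolding defect_def 1 2 H.diff_add_add[OF cl]
    by (simp add: K.Vcomp_diff_left[OF m ib(2,3) ia(1)] K.Vcomp_diff_right[OF m ia(2,3) ib(1)])
qed

lemma defect_zero:
  assumes "A \<in> Mor C a b" "B \<in> Mor C a b"
  shows "defect A B \<zero>\<^bsub>Hom2 C A B\<^esub> = \<zero>\<^bsub>HK A B\<^esub>"
proof -
  interpret H: abelian_group "HK A B" using HK_group assms .
  have "\<zero>\<^bsub>Hom2 C A B\<^esub> \<oplus>\<^bsub>Hom2 C A B\<^esub> \<zero>\<^bsub>Hom2 C A B\<^esub> = \<zero>\<^bsub>Hom2 C A B\<^esub>"
    using C.Hom2_group[OF assms] by (simp add: abelian_group.axioms(1) abelian_monoid.l_zero C.zero_closed[OF assms])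
  thus ?thesis
    using defect_add[OF assms C.zero_closed[OF assms] C.zero_closed[OF assms]]
      defect_closed[OF assms C.zero_closed[OF assms]]
    by (intro H.idem_zero) auto
qed

text \<open>
  The Leibniz rule for \<open>1 = 1 \<bullet> 1\<close> makes the defect of an identity an idempotent of the addition.
\<close>

lemma defect_Id2:
  assumes "A \<in> Mor C a b"
  shows "defect A A (Id2 C A) = \<zero>\<^bsub>HK A A\<^esub>"
proof -
  note I = C.Id2_closed[OF assms]
  note m = F.fmor_closed[OF assms]
  interpret H: abelian_group "HK A A" using HK_group assms by blast
  show ?thesis
    using defect_Vcomp[OF assms assms assms I I] defect_closed[OF assms assms I]
    by (intro H.idem_zero)
       (auto simp: C.Vcomp_id[OF assms assms I] F.fcell_id[OF assms] K.Vcomp_id[OF m m])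
qed

lemma defect_Vcomp_left:
  assumes mor: "A \<in> Mor C a b" "B \<in> Mor C a b" "D \<in> Mor C a b" and \<alpha>: "\<alpha> \<in> Cells C A B" and \<beta>: "\<beta> \<in> Cells C B D"
    and "defect B D \<beta> = \<zero>\<^bsub>HK B D\<^esub>"
  shows "defect A D (\<beta> \<bullet>\<^bsub>C\<^esub> \<alpha>) = fcell F \<beta> \<bullet>\<^bsub>K\<^esub> defect A B \<alpha>"
proof -
  note m = F.fmor_closed[OF mor(1)] F.fmor_closed[OF mor(2)] F.fmor_closed[OF mor(3)]
  interpret H: abelian_group "HK A D" using HK_group mor by blast
  show ?thesis
    unfolding defect_Vcomp[OF mor \<alpha> \<beta>] assms(6) K.Vcomp_zero_left[OF m image_closed(1)[OF mor(1,2) \<alpha>]]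
    using K.Vcomp_closed[OF m defect_closed[OF mor(1,2) \<alpha>] image_closed(1)[OF mor(2,3) \<beta>]]
    by simp
qed

lemma defect_Vcomp_right:
  assumes mor: "A \<in> Mor C a b" "B \<in> Mor C a b" "D \<in> Mor C a b" and \<alpha>: "\<alpha> \<in> Cells C A B" and \<beta>: "\<beta> \<in> Cells C B D"
    and "defect A B \<alpha> = \<zero>\<^bsub>HK A B\<^esub>"
  shows "defect A D (\<beta> \<bullet>\<^bsub>C\<^esub> \<alpha>) = defect B D \<beta> \<bullet>\<^bsub>K\<^esub> fcell F \<alpha>"
proof -
  note m = F.fmor_closed[OF mor(1)] F.fmor_closed[OF mor(2)] F.fmor_closed[OF mor(3)]
  interpret H: abelian_group "HK A D" using HK_group mor by blast
  show ?thesis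
    unfolding defect_Vcomp[OF mor \<alpha> \<beta>] assms(6) K.Vcomp_zero_right[OF m image_closed(1)[OF mor(2,3) \<beta>]]
    using K.Vcomp_closed[OF m image_closed(1)[OF mor(1,2) \<alpha>] defect_closed[OF mor(2,3) \<beta>]]
    by simp
qed

text \<open>
  A 2-functor preserves horizontal composition only up to its structure isomorphisms \<open>fcmp\<close>. These are closed,
  so differentiating the naturality square gives the claim after composition with \<open>fcmp\<close>, which can be cancelled.
\<close>

lemma commutes_Hcomp:
  assumes mor: "A \<in> Mor C a b" "A' \<in> Mor C a b" "B \<in> Mor C b c" "B' \<in> Mor C b c"
    and \<alpha>: "\<alpha> \<in> Cells C A A'" and \<beta>: "\<beta> \<in> Cells C B B'"
    and ca: "\<delta>K (fcell F \<alpha>) = fcell F (\<delta> \<alpha>)" and cb: "\<delta>K (fcell F \<beta>) = fcell F (\<delta> \<beta>)"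
  shows "\<delta>K (fcell F (\<beta> \<star>\<^bsub>C\<^esub> \<alpha>)) = fcell F (\<delta> (\<beta> \<star>\<^bsub>C\<^esub> \<alpha>))"
proof -
  let ?BA = "B \<diamondop>\<^bsub>C\<^esub> A" and ?BA' = "B' \<diamondop>\<^bsub>C\<^esub> A'"
  let ?FF = "fmor F B \<diamondop>\<^bsub>K\<^esub> fmor F A" and ?FF' = "fmor F B' \<diamondop>\<^bsub>K\<^esub> fmor F A'"
  let ?c = "fcmp F B A" and ?c' = "fcmp F B' A'"
  note mA = F.fmor_closed[OF mor(1)] and mA' = F.fmor_closed[OF mor(2)]
    and mB = F.fmor_closed[OF mor(3)] and mB' = F.fmor_closed[OF mor(4)]
  note BA = C.Comp1_closed[OF mor(1,3)] C.Comp1_closed[OF mor(2,4)]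
  note mBA = F.fmor_closed[OF BA(1)] F.fmor_closed[OF BA(2)]
  note mFF = K.Comp1_closed[OF mA mB] K.Comp1_closed[OF mA' mB']
  note ia = image_closed[OF mor(1,2) \<alpha>] and ib = image_closed[OF mor(3,4) \<beta>]
  note da = dC.d_closed[OF mor(1,2) \<alpha>] and db = dC.d_closed[OF mor(3,4) \<beta>]
  note h = C.Hcomp_closed[OF mor \<alpha> \<beta>]
  note ih = image_closed[OF BA h]
  from F.fcmp_iso[OF mor(1,3)] obtain d where
    c: "?c \<in> Cells K ?FF (fmor F ?BA)" and d: "d \<in> Cells K (fmor F ?BA) ?FF" and cd: "?c \<bullet>\<^bsub>K\<^esub> d = Id2 K (fmor F ?BA)"
    unfolding homogeneous_iso_def using K.Deg2_Cells mFF mBA by metis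
  have c': "?c' \<in> Cells K ?FF' (fmor F ?BA')"
    using F.fcmp_iso[OF mor(2,4)] K.Deg2_Cells mFF mBA unfolding homogeneous_iso_def by metis
  have dc: "\<delta>K ?c = \<zero>\<^bsub>Hom2 K ?FF (fmor F ?BA)\<^esub>" "\<delta>K ?c' = \<zero>\<^bsub>Hom2 K ?FF' (fmor F ?BA')\<^esub>"
    using coherence mor unfolding closed_coherence_def by blast+
  have kc: "fcell F \<beta> \<star>\<^bsub>K\<^esub> fcell F \<alpha> \<in> Cells K ?FF ?FF'"
    by (rule K.Hcomp_closed[OF mA mA' mB mB' ia(1) ib(1)])
  interpret H: abelian_group "Hom2 K ?FF (fmor F ?BA')" using K.abelian_Hom2 mFF mBA by blast
  have nat: "fcell F (\<beta> \<star>\<^bsub>C\<^esub> \<alpha>) \<bullet>\<^bsub>K\<^esub> ?c = ?c' \<bullet>\<^bsub>K\<^esub> (fcell F \<beta> \<star>\<^bsub>K\<^esub> fcell F \<alpha>)"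
    by (rule F.fcmp_natural[OF mor \<alpha> \<beta>])
  have "\<delta>K (fcell F (\<beta> \<star>\<^bsub>C\<^esub> \<alpha>)) \<bullet>\<^bsub>K\<^esub> ?c = \<delta>K (fcell F (\<beta> \<star>\<^bsub>C\<^esub> \<alpha>) \<bullet>\<^bsub>K\<^esub> ?c)"
    using K.Vcomp_closed[OF mFF(1) mBA c ih(2)]
    by (simp add: dK.Leibniz_Vcomp[OF mFF(1) mBA c ih(1)] dc K.Vcomp_zero_right[OF mFF(1) mBA ih(1)])
  also have "\<dots> = ?c' \<bullet>\<^bsub>K\<^esub> \<delta>K (fcell F \<beta> \<star>\<^bsub>K\<^esub> fcell F \<alpha>)"
    using K.Vcomp_closed[OF mFF mBA(2) dK.d_closed[OF mFF kc] c']
    by (simp add: nat dK.Leibniz_Vcomp[OF mFF mBA(2) kc c'] dc K.Vcomp_zero_left[OF mFF mBA(2) kc])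
  also have "\<dots> = ?c' \<bullet>\<^bsub>K\<^esub> ((fcell F (\<delta> \<beta>) \<star>\<^bsub>K\<^esub> fcell F \<alpha>) \<oplus>\<^bsub>Hom2 K ?FF ?FF'\<^esub> (fcell F \<beta> \<star>\<^bsub>K\<^esub> fcell F (\<delta> \<alpha>)))"
    by (simp add: dK.Leibniz_Hcomp[OF mA mA' mB mB' ia(1) ib(1)] ca cb)
  also have "\<dots> = (?c' \<bullet>\<^bsub>K\<^esub> (fcell F (\<delta> \<beta>) \<star>\<^bsub>K\<^esub> fcell F \<alpha>)) \<oplus>\<^bsub>Hom2 K ?FF (fmor F ?BA')\<^esub> (?c' \<bullet>\<^bsub>K\<^esub> (fcell F \<beta> \<star>\<^bsub>K\<^esub> fcell F (\<delta> \<alpha>)))"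
    by (rule K.Vcomp_add(1)[OF mFF mBA(2) K.Hcomp_closed[OF mA mA' mB mB' ia(1) ib(3)]
        K.Hcomp_closed[OF mA mA' mB mB' ia(3) ib(1)] c'])
  also have "\<dots> = (fcell F (\<delta> \<beta> \<star>\<^bsub>C\<^esub> \<alpha>) \<bullet>\<^bsub>K\<^esub> ?c) \<oplus>\<^bsub>Hom2 K ?FF (fmor F ?BA')\<^esub> (fcell F (\<beta> \<star>\<^bsub>C\<^esub> \<delta> \<alpha>) \<bullet>\<^bsub>K\<^esub> ?c)"
    by (simp add: F.fcmp_natural[OF mor \<alpha> db] F.fcmp_natural[OF mor da \<beta>])
  also have "\<dots> = (fcell F (\<delta> \<beta> \<star>\<^bsub>C\<^esub> \<alpha>) \<oplus>\<^bsub>HK ?BA ?BA'\<^esub> fcell F (\<beta> \<star>\<^bsub>C\<^esub> \<delta> \<alpha>)) \<bullet>\<^bsub>K\<^esub> ?c"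
    by (rule K.Vcomp_add(2)[OF mFF(1) mBA c, symmetric])
       (rule image_closed(1)[OF BA C.Hcomp_closed[OF mor \<alpha> db]] image_closed(1)[OF BA C.Hcomp_closed[OF mor da \<beta>]])+
  also have "\<dots> = fcell F (\<delta> (\<beta> \<star>\<^bsub>C\<^esub> \<alpha>)) \<bullet>\<^bsub>K\<^esub> ?c"
    by (simp add: dC.Leibniz_Hcomp[OF mor \<alpha> \<beta>] F.fcell_add[OF BA C.Hcomp_closed[OF mor \<alpha> db] C.Hcomp_closed[OF mor da \<beta>]])
  finally have eq: "\<delta>K (fcell F (\<beta> \<star>\<^bsub>C\<^esub> \<alpha>)) \<bullet>\<^bsub>K\<^esub> ?c = fcell F (\<delta> (\<beta> \<star>\<^bsub>C\<^esub> \<alpha>)) \<bullet>\<^bsub>K\<^esub> ?c" .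
  \<comment> \<open>\<open>d\<close> is the inverse of the structure isomorphism, so precomposition with the latter is injective.\<close>
  have canc: "(x \<bullet>\<^bsub>K\<^esub> ?c) \<bullet>\<^bsub>K\<^esub> d = x" if x: "x \<in> Cells K (fmor F ?BA) (fmor F ?BA')" for x
  proof -
    have "(x \<bullet>\<^bsub>K\<^esub> ?c) \<bullet>\<^bsub>K\<^esub> d = x \<bullet>\<^bsub>K\<^esub> (?c \<bullet>\<^bsub>K\<^esub> d)"
      by (rule K.Vcomp_assoc[OF mBA(1) mFF(1) mBA d c x])
    also have "\<dots> = x" unfolding cd by (rule K.Vcomp_id(1)[OF mBA x])
    finally show ?thesis .
  qed
  have "\<delta>K (fcell F (\<beta> \<star>\<^bsub>C\<^esub> \<alpha>)) = (\<delta>K (fcell F (\<beta> \<star>\<^bsub>C\<^esub> \<alpha>)) \<bullet>\<^bsub>K\<^esub> ?c) \<bullet>\<^bsub>K\<^esub> d"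
    by (rule canc[OF ih(2), symmetric])
  also have "\<dots> = fcell F (\<delta> (\<beta> \<star>\<^bsub>C\<^esub> \<alpha>))"
    unfolding eq by (rule canc[OF ih(3)])
  finally show ?thesis .
qed

end

section \<open>Reduction to single matrix entries\<close>

text \<open>
  The injection of a summand with its shift removed: \<open>emb\<close> is the composite of \<open>incl\<close> with \<open>shift_iso\<close>, and \<open>prj\<close> the
  projection onto the unshifted summand. Unshifted summands are the 1-morphisms whose 2-morphisms are given by terms.
\<close>

definition emb :: "('o, 'f, 'a, 'k) gr2cat \<Rightarrow> ('o, 'f) sum1 \<Rightarrow> nat \<Rightarrow> ('o, 'f, 'a) sum2"
  where "emb C A i = mk2 (fst A, fst (snd A), [(0, summand A i)]) A (\<lambda>j _.
    if j = i then Id2 C (summand A i) else \<zero>\<^bsub>Hom2 C (summand A i) (summand A j)\<^esub>)"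

definition prj :: "('o, 'f, 'a, 'k) gr2cat \<Rightarrow> ('o, 'f) sum1 \<Rightarrow> nat \<Rightarrow> ('o, 'f, 'a) sum2"
  where "prj C A i = mk2 A (fst A, fst (snd A), [(0, summand A i)]) (\<lambda>_ j.
    if j = i then Id2 C (summand A i) else \<zero>\<^bsub>Hom2 C (summand A j) (summand A i)\<^esub>)"

text \<open>
  The sum of the first \<open>n\<close> terms of the decomposition of an identity into \<open>emb \<bullet> prj\<close>, written as a diagonal
  matrix; it makes inductions on the number of summands possible without finite sums of 2-morphisms in the target.
\<close>

definition partial_id :: "('o, 'f, 'a, 'k) gr2cat \<Rightarrow> ('o, 'f) sum1 \<Rightarrow> nat \<Rightarrow> ('o, 'f, 'a) sum2"
  where "partial_id C A n = mk2 A A (\<lambda>i j.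
    if i = j \<and> i < n then Id2 C (summand A i) else \<zero>\<^bsub>Hom2 C (summand A j) (summand A i)\<^esub>)"

lemma single_simps [simp]:
  "rk (a, b, [(n, f)]) = 1" "summand (a, b, [(n, f)]) 0 = f"
  by (simp_all add: rk_def summand_def)

context linear_2cat_part
begin

lemma single_Mor: "f \<in> Mor C a b \<Longrightarrow> (a, b, [(n, f)]) \<in> Mor AC a b"
  using Mor_objs by (auto simp: add_closure_def)

lemma shift_iso_Cells: "f \<in> Mor C a b \<Longrightarrow> shift_iso C a b n f \<in> Cells AC (a, b, [(0, f)]) (a, b, [(n, f)])"
  unfolding shift_iso_def by (auto intro!: Cells_AC_I intro: Id2_closed)

context
  fixes A a b assumes A: "A \<in> Mor AC a b"
begin

abbreviation "single_summand i \<equiv> (a, b, [(0 :: int, summand A i)])"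

lemma summand_single_Mor: "i < rk A \<Longrightarrow> single_summand i \<in> Mor AC a b"
  using single_Mor summand_Mor A by blast

lemma emb_matrix: "i < rk A \<Longrightarrow> matrix (single_summand i) A (\<lambda>j _.
    if j = i then Id2 C (summand A i) else \<zero>\<^bsub>Hom2 C (summand A i) (summand A j)\<^esub>)"
  by (auto intro: Id2_closed zero_closed summand_Mor A)

lemma prj_matrix: "i < rk A \<Longrightarrow> matrix A (single_summand i) (\<lambda>_ j.
    if j = i then Id2 C (summand A i) else \<zero>\<^bsub>Hom2 C (summand A j) (summand A i)\<^esub>)"
  by (auto intro: Id2_closed zero_closed summand_Mor A)

lemma emb_eq: "emb C A i = mk2 (single_summand i) A (\<lambda>j _.
    if j = i then Id2 C (summand A i) else \<zero>\<^bsub>Hom2 C (summand A i) (summand A j)\<^esub>)"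
  using Mor_AC_ends[OF A] by (simp add: emb_def)

lemma prj_eq: "prj C A i = mk2 A (single_summand i) (\<lambda>_ j.
    if j = i then Id2 C (summand A i) else \<zero>\<^bsub>Hom2 C (summand A j) (summand A i)\<^esub>)"
  using Mor_AC_ends[OF A] by (simp add: prj_def)

lemma emb_Cells: "i < rk A \<Longrightarrow> emb C A i \<in> Cells AC (single_summand i) A"
  unfolding emb_eq using emb_matrix by (rule Cells_AC_I)

lemma prj_Cells: "i < rk A \<Longrightarrow> prj C A i \<in> Cells AC A (single_summand i)"
  unfolding prj_eq using prj_matrix by (rule Cells_AC_I)

lemma summand_eq: "i < rk A \<Longrightarrow> snd (snd A) ! i = (shift_of A i, summand A i)"
  by (simp add: shift_of_def summand_def)

lemma incl_Cells: "i < rk A \<Longrightarrow> incl C A i \<in> Cells AC (a, b, [snd (snd A) ! i]) A"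
  unfolding incl_def Mor_AC_ends[OF A, THEN conjunct1] Mor_AC_ends[OF A, THEN conjunct2, THEN conjunct1]
  by (rule Cells_AC_I) (auto simp: summand_eq intro: Id2_closed zero_closed summand_Mor A)

lemma emb_decomp:
  assumes i: "i < rk A"
  shows "emb C A i = incl C A i \<bullet>\<^bsub>AC\<^esub> shift_iso C a b (shift_of A i) (summand A i)"
proof -
  have f: "summand A i \<in> Mor C a b" using A i by (rule summand_Mor)
  let ?M = "\<lambda>j (_::nat). if j = i then Id2 C (summand A i) else \<zero>\<^bsub>Hom2 C (summand A i) (summand A j)\<^esub>"
  let ?s = "(a, b, [(shift_of A i, summand A i)])"
  have M: "matrix ?s A ?M" by (auto intro: Id2_closed zero_closed summand_Mor A f)
  have N: "matrix (single_summand i) ?s (\<lambda>_ _. Id2 C (summand A i))" by (auto intro: Id2_closed f)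
  have "incl C A i \<bullet>\<^bsub>AC\<^esub> shift_iso C a b (shift_of A i) (summand A i) = mk2 (single_summand i) A (\<lambda>j k. ?M j 0 \<bullet> Id2 C (summand A i))"
    unfolding incl_def shift_iso_def summand_eq[OF i] using Mor_AC_ends[OF A]
    by (simp, subst Vcomp_AC_single[OF single_Mor[OF f] single_Mor[OF f] A N M, where l = "\<lambda>_ _. 0"]) auto
  also have "\<dots> = emb C A i"
    unfolding emb_eq
  proof (rule mk2_cong)
    fix j k assume "j < rk A"
    thus "?M j 0 \<bullet> Id2 C (summand A i) = ?M j k"
      using M Vcomp_id(1)[OF f summand_Mor[OF A], of j "?M j 0"] by simp
  qed
  finally show ?thesis ..
qed

lemma prj_emb:
  assumes i: "i < rk A" and j: "j < rk A"
  shows "prj C A i \<bullet>\<^bsub>AC\<^esub> emb C A j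
      = (if i = j then Id2 AC (single_summand i) else \<zero>\<^bsub>Hom2 AC (single_summand j) (single_summand i)\<^esub>)"
proof -
  have f: "summand A i \<in> Mor C a b" "summand A j \<in> Mor C a b" using A i j summand_Mor by blast+
  have "prj C A i \<bullet>\<^bsub>AC\<^esub> emb C A j = mk2 (single_summand j) (single_summand i) (\<lambda>_ _.
      (if j = i then Id2 C (summand A i) else \<zero>\<^bsub>Hom2 C (summand A j) (summand A i)\<^esub>) \<bullet> Id2 C (summand A j))"
    unfolding prj_eq emb_eq
    using i j f by (subst Vcomp_AC_single[OF summand_single_Mor[OF j] A summand_single_Mor[OF i]
          emb_matrix[OF j] prj_matrix[OF i], where l = "\<lambda>_ _. j"])
      (auto intro!: Vcomp_zero intro: Id2_closed zero_closed summand_Mor A)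
  also have "\<dots> = (if i = j then Id2 AC (single_summand i) else \<zero>\<^bsub>Hom2 AC (single_summand j) (single_summand i)\<^esub>)"
    using f by (auto simp: Id2_AC zero_AC mk2_eq_iff Vcomp_id(1)[OF f(2) f(2) Id2_closed[OF f(2)]] Id2_closed Vcomp_zero(2)[OF f(2) f(2) f(1)])
  finally show ?thesis .
qed

lemma partial_id_Cells: "partial_id C A n \<in> Cells AC A A"
  unfolding partial_id_def by (rule Cells_AC_I) (auto intro: Id2_closed zero_closed summand_Mor A)

lemma partial_id_0: "partial_id C A 0 = \<zero>\<^bsub>Hom2 AC A A\<^esub>"
  by (simp add: partial_id_def zero_AC)

lemma partial_id_rk: "partial_id C A (rk A) = Id2 AC A"
  by (simp add: partial_id_def Id2_AC mk2_eq_iff)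

lemma partial_id_Suc:
  assumes n: "n < rk A"
  shows "partial_id C A (Suc n) = partial_id C A n \<oplus>\<^bsub>Hom2 AC A A\<^esub> (emb C A n \<bullet>\<^bsub>AC\<^esub> prj C A n)"
proof -
  let ?I = "Id2 C (summand A n)"
  have f: "summand A i \<in> Mor C a b" if "i < rk A" for i using A that by (rule summand_Mor)
  have G: "abelian_monoid (Hom2 C (summand A j) (summand A i))" if "i < rk A" "j < rk A" for i j
    using Hom2_group[OF f f] that abelian_group.axioms(1) by blast
  have ep: "emb C A n \<bullet>\<^bsub>AC\<^esub> prj C A n = mk2 A A (\<lambda>i j.
      (if i = n then ?I else \<zero>\<^bsub>Hom2 C (summand A n) (summand A i)\<^esub>) \<bullet>
      (if j = n then ?I else \<zero>\<^bsub>Hom2 C (summand A j) (summand A n)\<^esub>))"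
    unfolding prj_eq emb_eq
    by (subst Vcomp_AC_single[OF A summand_single_Mor[OF n] A prj_matrix[OF n] emb_matrix[OF n], where l = "\<lambda>_ _. 0"]) auto
  have z: "\<zero>\<^bsub>Hom2 C (summand A n) (summand A i)\<^esub> \<bullet> \<zero>\<^bsub>Hom2 C (summand A j) (summand A n)\<^esub>
      = \<zero>\<^bsub>Hom2 C (summand A j) (summand A i)\<^esub>"
    if "i < rk A" "j < rk A" for i j
    using that n by (intro Vcomp_zero(2)[OF f f f]) (auto intro: zero_closed f)
  have zI: "\<zero>\<^bsub>Hom2 C (summand A n) (summand A i)\<^esub> \<bullet> ?I = \<zero>\<^bsub>Hom2 C (summand A n) (summand A i)\<^esub>"
    if "i < rk A" for i
    using that n by (intro Vcomp_zero(2)[OF f f f]) (auto intro: Id2_closed f)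
  have z': "?I \<bullet> \<zero>\<^bsub>Hom2 C (summand A j) (summand A n)\<^esub> = \<zero>\<^bsub>Hom2 C (summand A j) (summand A n)\<^esub>" if "j < rk A" for j
    using that n by (intro Vcomp_zero(1)[OF f f f]) (auto intro: Id2_closed f)
  have ii: "?I \<bullet> ?I = ?I" using n by (intro Vcomp_id(1)[OF f f]) (auto intro: Id2_closed f)
  have cl: "Id2 C (summand A i) \<in> Cells C (summand A i) (summand A i)" if "i < rk A" for i
    using f[OF that] by (rule Id2_closed)
  show ?thesis
    unfolding partial_id_def ep add_AC
    by (rule mk2_cong) (auto simp: z zI z' ii less_Suc_eq cl n G abelian_monoid.zero_closed abelian_monoid.l_zero abelian_monoid.r_zero)
qed

lemma emb_column:
  assumes M: "matrix A B M" and B: "B \<in> Mor AC a b" and j: "j < rk A"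
  shows "mk2 A B M \<bullet>\<^bsub>AC\<^esub> emb C A j = mk2 (single_summand j) B (\<lambda>i _. M i j)"
proof -
  have f: "summand A j \<in> Mor C a b" using A j by (rule summand_Mor)
  have "mk2 A B M \<bullet>\<^bsub>AC\<^esub> emb C A j = mk2 (single_summand j) B (\<lambda>i _. M i j \<bullet> Id2 C (summand A j))"
    unfolding emb_eq
    using j M by (subst Vcomp_AC_single[OF summand_single_Mor[OF j] A B emb_matrix[OF j] M, where l = "\<lambda>_ _. j"])
      (auto intro!: Vcomp_zero(1) intro: summand_Mor A B)
  also have "\<dots> = mk2 (single_summand j) B (\<lambda>i _. M i j)"
    using M j by (intro mk2_cong Vcomp_id(1)[OF f]) (auto intro: summand_Mor B)
  finally show ?thesis .
qed

lemma prj_row: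
  assumes M: "matrix B A M" and B: "B \<in> Mor AC a b" and i: "i < rk A"
  shows "prj C A i \<bullet>\<^bsub>AC\<^esub> mk2 B A M = mk2 B (single_summand i) (\<lambda>_ j. M i j)"
proof -
  have f: "summand A i \<in> Mor C a b" using A i by (rule summand_Mor)
  have "prj C A i \<bullet>\<^bsub>AC\<^esub> mk2 B A M = mk2 B (single_summand i) (\<lambda>_ j. Id2 C (summand A i) \<bullet> M i j)"
    unfolding prj_eq
    using i M by (subst Vcomp_AC_single[OF B A summand_single_Mor[OF i] M prj_matrix[OF i], where l = "\<lambda>_ _. i"])
      (auto intro!: Vcomp_zero(2) intro: summand_Mor A B)
  also have "\<dots> = mk2 B (single_summand i) (\<lambda>_ j. M i j)"
    using M i by (intro mk2_cong Vcomp_id(2)[OF _ f]) (auto intro: summand_Mor B)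
  finally show ?thesis .
qed

end
end

locale matrix_comparison =
  P: linear_2cat_part P + derivation_comparison "add_closure P" \<delta> K \<delta>K F
  for P :: "('o, 'f, 'a, 'k::field) gr2cat" and \<delta> :: "('o, 'f, 'a) sum2 \<Rightarrow> ('o, 'f, 'a) sum2"
    and K :: "('o1, 'f1, 'a1, 'k) gr2cat" and \<delta>K :: "'a1 \<Rightarrow> 'a1"
    and F :: "('o, ('o, 'f) sum1, ('o, 'f, 'a) sum2, 'o1, 'f1, 'a1) fun2" +
  assumes commutes_incl: "\<lbrakk>A \<in> Mor (add_closure P) a b; i < rk A\<rbrakk>
      \<Longrightarrow> \<delta>K (fcell F (incl P A i)) = fcell F (\<delta> (incl P A i))"
    and commutes_shift: "f \<in> Mor P a b
      \<Longrightarrow> \<delta>K (fcell F (shift_iso P a b n f)) = fcell F (\<delta> (shift_iso P a b n f))"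
begin

lemma defect_emb:
  assumes A: "A \<in> Mor P.AC a b" and i: "i < rk A"
  shows "defect (a, b, [(0, summand A i)]) A (emb P A i) = \<zero>\<^bsub>HK (a, b, [(0, summand A i)]) A\<^esub>"
proof -
  let ?f = "summand A i" and ?n = "shift_of A i"
  have f: "?f \<in> Mor P a b" using A i by (rule P.summand_Mor)
  note S = P.single_Mor[OF f, of 0] P.single_Mor[OF f, of ?n]
  note sc = P.shift_iso_Cells[OF f, of ?n] and ic = P.incl_Cells[OF A i, unfolded P.summand_eq[OF A i]]
  have s: "defect (a, b, [(0, ?f)]) (a, b, [(?n, ?f)]) (shift_iso P a b ?n ?f) = \<zero>\<^bsub>HK (a, b, [(0, ?f)]) (a, b, [(?n, ?f)])\<^esub>"
    using defect_eq_zero_iff[OF S sc] commutes_shift[OF f] by blast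
  have inc: "defect (a, b, [(?n, ?f)]) A (incl P A i) = \<zero>\<^bsub>HK (a, b, [(?n, ?f)]) A\<^esub>"
    using defect_eq_zero_iff[OF S(2) A ic] commutes_incl[OF A i] by blast
  show ?thesis
    unfolding P.emb_decomp[OF A i] defect_Vcomp_left[OF S A sc ic inc] s
    by (rule K.Vcomp_zero_right[OF F.fmor_closed[OF S(1)] F.fmor_closed[OF S(2)] F.fmor_closed[OF A] image_closed(1)[OF S(2) A ic]])
qed

text \<open>
  The injections are jointly epic after any additive 2-functor, because the identity is the sum of the
  \<open>emb \<bullet> prj\<close>. Dually, \<open>zero_if_prj_zero\<close> says that the projections are jointly monic.
\<close>

lemma zero_if_emb_zero:
  assumes A: "A \<in> Mor P.AC a b" and Z: "Z \<in> Mor K (fobj F a) (fobj F b)" and \<xi>: "\<xi> \<in> Cells K (fmor F A) Z"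
    and 0: "\<And>i. i < rk A \<Longrightarrow> \<xi> \<bullet>\<^bsub>K\<^esub> fcell F (emb P A i) = \<zero>\<^bsub>Hom2 K (fmor F (a, b, [(0, summand A i)])) Z\<^esub>"
  shows "\<xi> = \<zero>\<^bsub>Hom2 K (fmor F A) Z\<^esub>"
proof -
  note mA = F.fmor_closed[OF A]
  interpret H: abelian_group "Hom2 K (fmor F A) Z" using K.abelian_Hom2[OF mA Z] .
  \<comment> \<open>At \<open>n = rk A\<close> the partial identity is the identity.\<close>
  have "n \<le> rk A \<Longrightarrow> \<xi> \<bullet>\<^bsub>K\<^esub> fcell F (partial_id P A n) = \<zero>\<^bsub>Hom2 K (fmor F A) Z\<^esub>" for n
  proof (induction n)
    case 0
    show ?case by (simp add: P.partial_id_0[OF A] F_zero[OF A A] K.Vcomp_zero_right[OF mA mA Z \<xi>])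
  next
    case (Suc n)
    hence n: "n < rk A" by simp
    let ?S = "(a, b, [(0, summand A n)])"
    note S = P.summand_single_Mor[OF A n] and e = P.emb_Cells[OF A n] and p = P.prj_Cells[OF A n]
    note mS = F.fmor_closed[OF S]
    note ep = C.Vcomp_closed[OF A S A p e]
    have "\<xi> \<bullet>\<^bsub>K\<^esub> fcell F (emb P A n \<bullet>\<^bsub>P.AC\<^esub> prj P A n)
        = (\<xi> \<bullet>\<^bsub>K\<^esub> fcell F (emb P A n)) \<bullet>\<^bsub>K\<^esub> fcell F (prj P A n)"
      by (simp add: F.fcell_Vcomp[OF A S A p e] K.Vcomp_assoc[OF mA mS mA Z image_closed(1)[OF A S p] image_closed(1)[OF S A e] \<xi>])
    also have "\<dots> = \<zero>\<^bsub>Hom2 K (fmor F A) Z\<^esub>"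
      unfolding 0[OF n] by (rule K.Vcomp_zero_left[OF mA mS Z image_closed(1)[OF A S p]])
    finally show ?case
      using Suc.IH n
      by (simp add: P.partial_id_Suc[OF A n] F.fcell_add[OF A A P.partial_id_Cells[OF A] ep]
          K.Vcomp_add(1)[OF mA mA Z image_closed(1)[OF A A P.partial_id_Cells[OF A]] image_closed(1)[OF A A ep] \<xi>])
  qed
  from this[of "rk A"] show ?thesis
    by (simp add: P.partial_id_rk[OF A] F.fcell_id[OF A] K.Vcomp_id(1)[OF mA Z \<xi>])
qed

lemma zero_if_prj_zero:
  assumes A: "A \<in> Mor P.AC a b" and Z: "Z \<in> Mor K (fobj F a) (fobj F b)" and \<xi>: "\<xi> \<in> Cells K Z (fmor F A)"
    and 0: "\<And>i. i < rk A \<Longrightarrow> fcell F (prj P A i) \<bullet>\<^bsub>K\<^esub> \<xi> = \<zero>\<^bsub>Hom2 K Z (fmor F (a, b, [(0, summand A i)]))\<^esub>"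
  shows "\<xi> = \<zero>\<^bsub>Hom2 K Z (fmor F A)\<^esub>"
proof -
  note mA = F.fmor_closed[OF A]
  interpret H: abelian_group "Hom2 K Z (fmor F A)" using K.abelian_Hom2[OF Z mA] .
  have "n \<le> rk A \<Longrightarrow> fcell F (partial_id P A n) \<bullet>\<^bsub>K\<^esub> \<xi> = \<zero>\<^bsub>Hom2 K Z (fmor F A)\<^esub>" for n
  proof (induction n)
    case 0
    show ?case by (simp add: P.partial_id_0[OF A] F_zero[OF A A] K.Vcomp_zero_left[OF Z mA mA \<xi>])
  next
    case (Suc n)
    hence n: "n < rk A" by simp
    let ?S = "(a, b, [(0, summand A n)])"
    note S = P.summand_single_Mor[OF A n] and e = P.emb_Cells[OF A n] and p = P.prj_Cells[OF A n]
    note mS = F.fmor_closed[OF S]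
    note ep = C.Vcomp_closed[OF A S A p e]
    have "fcell F (emb P A n \<bullet>\<^bsub>P.AC\<^esub> prj P A n) \<bullet>\<^bsub>K\<^esub> \<xi>
        = fcell F (emb P A n) \<bullet>\<^bsub>K\<^esub> (fcell F (prj P A n) \<bullet>\<^bsub>K\<^esub> \<xi>)"
      by (simp add: F.fcell_Vcomp[OF A S A p e] K.Vcomp_assoc[OF Z mA mS mA \<xi> image_closed(1)[OF A S p] image_closed(1)[OF S A e]])
    also have "\<dots> = \<zero>\<^bsub>Hom2 K Z (fmor F A)\<^esub>"
      unfolding 0[OF n] by (rule K.Vcomp_zero_right[OF Z mS mA image_closed(1)[OF S A e]])
    finally show ?case
      using Suc.IH n
      by (simp add: P.partial_id_Suc[OF A n] F.fcell_add[OF A A P.partial_id_Cells[OF A] ep]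
          K.Vcomp_add(2)[OF Z mA mA \<xi> image_closed(1)[OF A A P.partial_id_Cells[OF A]] image_closed(1)[OF A A ep]])
  qed
  from this[of "rk A"] show ?thesis
    by (simp add: P.partial_id_rk[OF A] F.fcell_id[OF A] K.Vcomp_id(2)[OF Z mA \<xi>])
qed

text \<open>
  The composites of a projection with the injections are identities or zero, and injections have no defect. By
  the Leibniz rule the defect of a projection is killed by all injections, which are jointly epic.
\<close>

lemma defect_prj:
  assumes A: "A \<in> Mor P.AC a b" and i: "i < rk A"
  shows "defect A (a, b, [(0, summand A i)]) (prj P A i) = \<zero>\<^bsub>HK A (a, b, [(0, summand A i)])\<^esub>"
proof (rule zero_if_emb_zero[OF A])
  note S = P.summand_single_Mor[OF A]
  note p = P.prj_Cells[OF A i]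
  show "fmor F (a, b, [(0, summand A i)]) \<in> Mor K (fobj F a) (fobj F b)" using F.fmor_closed[OF S[OF i]] .
  show "defect A (a, b, [(0, summand A i)]) (prj P A i) \<in> carrier (HK A (a, b, [(0, summand A i)]))"
    by (rule defect_closed[OF A S[OF i] p])
  fix j assume j: "j < rk A"
  have "defect A (a, b, [(0, summand A i)]) (prj P A i) \<bullet>\<^bsub>K\<^esub> fcell F (emb P A j)
      = defect (a, b, [(0, summand A j)]) (a, b, [(0, summand A i)]) (prj P A i \<bullet>\<^bsub>P.AC\<^esub> emb P A j)"
    by (rule defect_Vcomp_right[OF S[OF j] A S[OF i] P.emb_Cells[OF A j] p defect_emb[OF A j], symmetric])
  also have "\<dots> = \<zero>\<^bsub>HK (a, b, [(0, summand A j)]) (a, b, [(0, summand A i)])\<^esub>"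
    unfolding P.prj_emb[OF A i j]
    using defect_zero[OF S[OF j] S[OF i]] defect_Id2[OF S[OF i]] by (cases "i = j") simp_all
  finally show "defect A (a, b, [(0, summand A i)]) (prj P A i) \<bullet>\<^bsub>K\<^esub> fcell F (emb P A j)
      = \<zero>\<^bsub>HK (a, b, [(0, summand A j)]) (a, b, [(0, summand A i)])\<^esub>" .
qed

text \<open>
  Injections and projections have no defect, hence the defect of a matrix, cut down to a row and a column, is the
  defect of the entry there.
\<close>

lemma commutes_if_entries_commute:
  assumes A: "A \<in> Mor P.AC a b" and B: "B \<in> Mor P.AC a b" and \<alpha>: "\<alpha> \<in> Cells P.AC A B"
    and entries: "\<And>f g \<mu>. \<lbrakk>f \<in> Mor P a b; g \<in> Mor P a b; \<mu> \<in> Cells P f g\<rbrakk> \<Longrightarrow>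
      \<delta>K (fcell F (mk2 (a, b, [(0, f)]) (a, b, [(0, g)]) (\<lambda>_ _. \<mu>)))
        = fcell F (\<delta> (mk2 (a, b, [(0, f)]) (a, b, [(0, g)]) (\<lambda>_ _. \<mu>)))"
  shows "\<delta>K (fcell F \<alpha>) = fcell F (\<delta> \<alpha>)"
proof -
  obtain M where M: "\<alpha> = mk2 A B M" "P.matrix A B M" using \<alpha> by (rule P.Cells_AC_E)
  note mA = F.fmor_closed[OF A] and mB = F.fmor_closed[OF B]
  have "defect A B \<alpha> = \<zero>\<^bsub>HK A B\<^esub>"
  proof (rule zero_if_prj_zero[OF B mA defect_closed[OF A B \<alpha>]])
    fix i assume i: "i < rk B"
    let ?T = "(a, b, [(0, summand B i)])"
    note T = P.summand_single_Mor[OF B i] and p = P.prj_Cells[OF B i]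
    note mT = F.fmor_closed[OF T]
    note p\<alpha> = C.Vcomp_closed[OF A B T \<alpha> p]
    have "defect A ?T (prj P B i \<bullet>\<^bsub>P.AC\<^esub> \<alpha>) = \<zero>\<^bsub>HK A ?T\<^esub>"
    proof (rule zero_if_emb_zero[OF A mT defect_closed[OF A T p\<alpha>]])
      fix j assume j: "j < rk A"
      let ?S = "(a, b, [(0, summand A j)])"
      note S = P.summand_single_Mor[OF A j] and e = P.emb_Cells[OF A j]
      have M': "P.matrix A ?T (\<lambda>_ j. M i j)" using M(2) i by simp
      have "defect A ?T (prj P B i \<bullet>\<^bsub>P.AC\<^esub> \<alpha>) \<bullet>\<^bsub>K\<^esub> fcell F (emb P A j)
          = defect ?S ?T ((prj P B i \<bullet>\<^bsub>P.AC\<^esub> \<alpha>) \<bullet>\<^bsub>P.AC\<^esub> emb P A j)"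
        by (rule defect_Vcomp_right[OF S A T e p\<alpha> defect_emb[OF A j], symmetric])
      also have "(prj P B i \<bullet>\<^bsub>P.AC\<^esub> \<alpha>) \<bullet>\<^bsub>P.AC\<^esub> emb P A j = mk2 ?S ?T (\<lambda>_ _. M i j)"
        by (simp add: M(1) P.prj_row[OF B M(2) A i] P.emb_column[OF A M' T j])
      also have "defect ?S ?T \<dots> = \<zero>\<^bsub>HK ?S ?T\<^esub>"
        using M(2) i j
        by (subst defect_eq_zero_iff[OF S T])
           (auto intro!: P.Cells_AC_I entries P.summand_Mor[OF A] P.summand_Mor[OF B])
      finally show "defect A ?T (prj P B i \<bullet>\<^bsub>P.AC\<^esub> \<alpha>) \<bullet>\<^bsub>K\<^esub> fcell F (emb P A j) = \<zero>\<^bsub>HK ?S ?T\<^esub>" .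
    qed
    thus "fcell F (prj P B i) \<bullet>\<^bsub>K\<^esub> defect A B \<alpha> = \<zero>\<^bsub>HK A ?T\<^esub>"
      by (simp add: defect_Vcomp_left[OF A B T \<alpha> p defect_prj[OF B i]])
  qed
  thus ?thesis using defect_eq_zero_iff[OF A B \<alpha>] by blast
qed

end

section \<open>Formal inverses inherit compatibility\<close>

lemma wft_tsum:
  assumes "snd f = snd g" "tgt f = tgt g" "\<And>t. t \<in> set ts \<Longrightarrow> wft G t \<and> tdom t = f \<and> tcod t = g"
  shows "wft G (tsum f g ts) \<and> tdom (tsum f g ts) = f \<and> tcod (tsum f g ts) = g"
  using assms by (induction ts) (auto simp: tsum_def)

locale presented_comparison =
  typed_presentation G R + matrix_comparison "presented G R" \<delta> K \<delta>K F
  for G :: "gen set" and R :: "('k::field trm \<times> 'k trm) set" and \<delta> :: "'k mor2 \<Rightarrow> 'k mor2"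
    and K :: "('o1, 'f1, 'a1, 'k) gr2cat" and \<delta>K :: "'a1 \<Rightarrow> 'a1"
    and F :: "(int, mor1, 'k mor2, 'o1, 'f1, 'a1) fun2"
begin

abbreviation img :: "'k trm \<Rightarrow> 'a1" where "img t \<equiv> fcell F (cell G R t)"

definition commutes :: "'k trm \<Rightarrow> bool"
  where "commutes t \<longleftrightarrow> \<delta>K (img t) = fcell F (\<delta> (cell G R t))"

lemma wrd_Mor: "\<lbrakk>snd f = a; tgt f = b\<rbrakk> \<Longrightarrow> wrd f \<in> Mor AP a b"
  using Mor_wrd[of f] by simp

lemma cell_closed:
  assumes "wft G t" "tdom t = f" "tcod t = g"
  shows "cell G R t \<in> Cells AP (wrd f) (wrd g)"
  using cell_Cells[OF assms(1)] assms(2,3) by simp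

lemma commutes_iff:
  assumes "wft G t" "tdom t = f" "tcod t = g"
  shows "commutes t \<longleftrightarrow> defect (wrd f) (wrd g) (cell G R t) = \<zero>\<^bsub>HK (wrd f) (wrd g)\<^esub>"
proof -
  have m: "wrd f \<in> Mor AP (snd f) (tgt f)" "wrd g \<in> Mor AP (snd f) (tgt f)"
    using wft_parallel[OF assms(1)] assms(2,3) by (auto intro: wrd_Mor)
  show ?thesis unfolding commutes_def using defect_eq_zero_iff[OF m cell_closed[OF assms]] by simp
qed

lemma commutes_Ze: "\<lbrakk>snd f = snd g; tgt f = tgt g\<rbrakk> \<Longrightarrow> commutes (Ze f g)"
  using defect_zero[OF wrd_Mor[OF HOL.refl HOL.refl] wrd_Mor[of g "snd f" "tgt f"]]
  by (simp add: commutes_iff[OF _ HOL.refl HOL.refl] cell_Ze)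

lemma commutes_Idt: "commutes (Idt f)"
  using defect_Id2[OF wrd_Mor[OF HOL.refl HOL.refl]]
  by (simp add: commutes_iff[OF _ HOL.refl HOL.refl] cell_Idt)

lemma commutes_Ad:
  assumes w: "wft G (s +\<^sub>t t)" and "commutes s" "commutes t"
  shows "commutes (s +\<^sub>t t)"
proof -
  let ?f = "tdom s" and ?g = "tcod s"
  have m: "wrd ?f \<in> Mor AP (snd ?f) (tgt ?f)" "wrd ?g \<in> Mor AP (snd ?f) (tgt ?f)"
    using wft_parallel[of G s] w by (auto intro: wrd_Mor)
  have c: "cell G R s \<in> Cells AP (wrd ?f) (wrd ?g)" "cell G R t \<in> Cells AP (wrd ?f) (wrd ?g)"
    using w by (auto intro: cell_closed)
  interpret H: abelian_group "HK (wrd ?f) (wrd ?g)" using HK_group[OF m] .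
  have "defect (wrd ?f) (wrd ?g) (cell G R s) = \<zero>\<^bsub>HK (wrd ?f) (wrd ?g)\<^esub>"
    "defect (wrd ?f) (wrd ?g) (cell G R t) = \<zero>\<^bsub>HK (wrd ?f) (wrd ?g)\<^esub>"
    using assms commutes_iff[of s ?f ?g] commutes_iff[of t ?f ?g] by auto
  hence "defect (wrd ?f) (wrd ?g) (cell G R (s +\<^sub>t t)) = \<zero>\<^bsub>HK (wrd ?f) (wrd ?g)\<^esub>"
    unfolding cell_Ad[OF w] defect_add[OF m c] by simp
  thus ?thesis using w commutes_iff[of "s +\<^sub>t t" ?f ?g] by auto
qed

lemma commutes_Sm:
  assumes w: "wft G t" and "commutes t"
  shows "commutes (r *\<^sub>t t)"
proof -
  let ?f = "tdom t" and ?g = "tcod t"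
  have m: "wrd ?f \<in> Mor AP (snd ?f) (tgt ?f)" "wrd ?g \<in> Mor AP (snd ?f) (tgt ?f)"
    using wft_parallel[of G t] w by (auto intro: wrd_Mor)
  show ?thesis
    using commutes_smult[OF m cell_closed[OF w HOL.refl HOL.refl]] assms by (simp add: commutes_def cell_Sm)
qed

lemma defect_Vc_left:
  assumes "wft G s" "wft G t" "tdom t = f" "tcod t = g" "tdom s = g" "tcod s = h" and s: "commutes s"
  shows "defect (wrd f) (wrd h) (cell G R (s \<bullet>\<^sub>t t)) = img s \<bullet>\<^bsub>K\<^esub> defect (wrd f) (wrd g) (cell G R t)"
proof -
  have m: "wrd f \<in> Mor AP (snd f) (tgt f)" "wrd g \<in> Mor AP (snd f) (tgt f)" "wrd h \<in> Mor AP (snd f) (tgt f)"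
    using wft_parallel[OF assms(1)] wft_parallel[OF assms(2)] assms(3-6) by (auto intro: wrd_Mor)
  show ?thesis
    using defect_Vcomp_left[OF m cell_closed[OF assms(2-4)] cell_closed[OF assms(1,5,6)]]
      commutes_iff[OF assms(1,5,6)] assms by (simp add: cell_Vc)
qed

lemma defect_Vc_right:
  assumes "wft G s" "wft G t" "tdom t = f" "tcod t = g" "tdom s = g" "tcod s = h" and t: "commutes t"
  shows "defect (wrd f) (wrd h) (cell G R (s \<bullet>\<^sub>t t)) = defect (wrd g) (wrd h) (cell G R s) \<bullet>\<^bsub>K\<^esub> img t"
proof -
  have m: "wrd f \<in> Mor AP (snd f) (tgt f)" "wrd g \<in> Mor AP (snd f) (tgt f)" "wrd h \<in> Mor AP (snd f) (tgt f)"
    using wft_parallel[OF assms(1)] wft_parallel[OF assms(2)] assms(3-6) by (auto intro: wrd_Mor)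
  show ?thesis
    using defect_Vcomp_right[OF m cell_closed[OF assms(2-4)] cell_closed[OF assms(1,5,6)]]
      commutes_iff[OF assms(2-4)] assms by (simp add: cell_Vc)
qed

lemma commutes_Vc:
  assumes w: "wft G (s \<bullet>\<^sub>t t)" and "commutes s" "commutes t"
  shows "commutes (s \<bullet>\<^sub>t t)"
proof -
  let ?f = "tdom t" and ?g = "tcod t" and ?h = "tcod s"
  have m: "wrd ?f \<in> Mor AP (snd ?f) (tgt ?f)" "wrd ?g \<in> Mor AP (snd ?f) (tgt ?f)" "wrd ?h \<in> Mor AP (snd ?f) (tgt ?f)"
    using wft_parallel[of G s] wft_parallel[of G t] w by (auto intro: wrd_Mor)
  have "defect (wrd ?f) (wrd ?h) (cell G R (s \<bullet>\<^sub>t t)) = img s \<bullet>\<^bsub>K\<^esub> \<zero>\<^bsub>HK (wrd ?f) (wrd ?g)\<^esub>"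
    using assms defect_Vc_left[of s t ?f ?g ?h] commutes_iff[of t ?f ?g] by simp
  also have "\<dots> = \<zero>\<^bsub>HK (wrd ?f) (wrd ?h)\<^esub>"
    using w by (intro K.Vcomp_zero_right[OF F.fmor_closed[OF m(1)] F.fmor_closed[OF m(2)] F.fmor_closed[OF m(3)]]
        image_closed(1)[OF m(2,3)] cell_closed) auto
  finally show ?thesis using w by (simp add: commutes_iff[where f = ?f and g = ?h])
qed

lemma commutes_Hc:
  assumes w: "wft G (s \<star>\<^sub>t t)" and "commutes s" "commutes t"
  shows "commutes (s \<star>\<^sub>t t)"
proof -
  have m: "wrd (tdom t) \<in> Mor AP (snd (tdom t)) (tgt (tdom t))" "wrd (tcod t) \<in> Mor AP (snd (tdom t)) (tgt (tdom t))"
    "wrd (tdom s) \<in> Mor AP (tgt (tdom t)) (tgt (tdom s))" "wrd (tcod s) \<in> Mor AP (tgt (tdom t)) (tgt (tdom s))"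
    using wft_parallel[of G s] wft_parallel[of G t] w by (auto intro!: wrd_Mor)
  have c: "cell G R t \<in> Cells AP (wrd (tdom t)) (wrd (tcod t))" "cell G R s \<in> Cells AP (wrd (tdom s)) (wrd (tcod s))"
    using w by (auto intro: cell_closed)
  show ?thesis
    using commutes_Hcomp[OF m c] assms by (simp add: commutes_def cell_Hc)
qed

text \<open>
  Induction on terms. The set \<open>G'\<close> is kept separate from \<open>G\<close> because it is also used for the generators which are
  common to both 2-categories, before anything is known about the formal inverses.
\<close>

lemma commutes_term:
  assumes "wft G' t" "G' \<subseteq> G" "\<And>g. g \<in> G' \<Longrightarrow> commutes (Gen g)"
  shows "wft G t \<and> commutes t"
  using assms(1)
proof (induction t)
  case (Gen g)
  thus ?case using assms by auto
next
  case (Idt f)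
  thus ?case by (simp add: commutes_Idt)
next
  case (Ze f g)
  thus ?case by (simp add: commutes_Ze)
next
  case (Ad s t)
  thus ?case by (intro conjI commutes_Ad) auto
next
  case (Sm r t)
  thus ?case by (intro conjI commutes_Sm) auto
next
  case (Vc s t)
  thus ?case by (intro conjI commutes_Vc) auto
next
  case (Hc s t)
  thus ?case by (intro conjI commutes_Hc) auto
qed

lemma img_Vc_eq:
  assumes "wft G s" "wft G t" "tdom t = f" "tcod t = g" "tdom s = g" "tcod s = h" "teq G R (s \<bullet>\<^sub>t t) u"
  shows "img s \<bullet>\<^bsub>K\<^esub> img t = img u"
proof -
  have m: "wrd f \<in> Mor AP (snd f) (tgt f)" "wrd g \<in> Mor AP (snd f) (tgt f)" "wrd h \<in> Mor AP (snd f) (tgt f)"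
    using wft_parallel[OF assms(1)] wft_parallel[OF assms(2)] assms(3-6) by (auto intro: wrd_Mor)
  have "img u = fcell F (cell G R s \<bullet>\<^bsub>AP\<^esub> cell G R t)"
    using cell_eq[OF assms(7)] cell_Vc[of s t] assms by simp
  thus ?thesis
    using F.fcell_Vcomp[OF m cell_closed[OF assms(2-4)] cell_closed[OF assms(1,5,6)]] by simp
qed

lemma img_Idt: "img (Idt f) = Id2 K (fmor F (wrd f))"
  using F.fcell_id[OF wrd_Mor[OF HOL.refl HOL.refl]] by (simp add: cell_Idt)

lemma img_Ze: "\<lbrakk>snd f = snd g; tgt f = tgt g\<rbrakk> \<Longrightarrow> img (Ze f g) = \<zero>\<^bsub>HK (wrd f) (wrd g)\<^esub>"
  using F_zero[OF wrd_Mor[OF HOL.refl HOL.refl] wrd_Mor[of g "snd f" "tgt f"]] by (simp add: cell_Ze)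

text \<open>
  The heart of the matter: a derivation that kills an invertible matrix kills the inverse. Let the row
  \<open>(e j)\<^sub>j\<close> have no defect and let the column \<open>(c j)\<^sub>j\<close> be inverse to it. Applying the defect, written \<open>D\<close>, to
  \<open>\<Sum>\<^sub>j e j \<bullet> c j = 1\<close> gives \<open>\<Sum>\<^sub>j F (e j) \<bullet> D (c j) = 0\<close>, and composing with \<open>F (c i)\<close> leaves \<open>D (c i) = 0\<close>
  because of \<open>c i \<bullet> e j = \<delta>\<^sub>i\<^sub>j\<close>.
\<close>

lemma commutes_inverse_column:
  fixes e c :: "'i \<Rightarrow> 'k trm"
  assumes e: "\<And>j. j \<in> set js \<Longrightarrow> wft G (e j) \<and> tdom (e j) = h j \<and> tcod (e j) = f \<and> commutes (e j)"
    and c: "\<And>j. j \<in> set js \<Longrightarrow> wft G (c j) \<and> tdom (c j) = f \<and> tcod (c j) = h j"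
    and total: "teq G R (tsum f f (map (\<lambda>j. e j \<bullet>\<^sub>t c j) js)) (Idt f)"
    and dual: "\<And>i j. \<lbrakk>i \<in> set js; j \<in> set js\<rbrakk> \<Longrightarrow> teq G R (c i \<bullet>\<^sub>t e j) (if i = j then Idt (h i) else Ze (h j) (h i))"
    and js: "distinct js" and i: "i \<in> set js"
  shows "commutes (c i)"
proof -
  let ?a = "snd f" and ?b = "tgt f"
  have h: "snd (h j) = ?a \<and> tgt (h j) = ?b" if "j \<in> set js" for j
    using wft_parallel[of G "e j"] e[OF that] by auto
  have mf: "wrd f \<in> Mor AP ?a ?b" by (simp add: wrd_Mor)
  have mh: "wrd (h j) \<in> Mor AP ?a ?b" if "j \<in> set js" for j using h[OF that] by (simp add: wrd_Mor)
  note mF = F.fmor_closed[OF mf] and mH = F.fmor_closed[OF mh]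
  have ec: "cell G R (e j) \<in> Cells AP (wrd (h j)) (wrd f)" if "j \<in> set js" for j
    using e[OF that] by (simp add: cell_closed)
  have cc: "cell G R (c j) \<in> Cells AP (wrd f) (wrd (h j))" if "j \<in> set js" for j
    using c[OF that] by (simp add: cell_closed)
  let ?d = "\<lambda>j. defect (wrd f) (wrd (h j)) (cell G R (c j))"
  note ici = image_closed(1)[OF mf mh[OF i] cc[OF i]]
  interpret H: abelian_group "HK (wrd f) (wrd (h i))" using HK_group[OF mf mh[OF i]] .
  have dcl: "?d j \<in> carrier (HK (wrd f) (wrd (h j)))" if "j \<in> set js" for j
    by (rule defect_closed[OF mf mh[OF that] cc[OF that]])
  have summand: "img (c i) \<bullet>\<^bsub>K\<^esub> defect (wrd f) (wrd f) (cell G R (e k \<bullet>\<^sub>t c k))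
      = (if i = k then ?d i else \<zero>\<^bsub>HK (wrd f) (wrd (h i))\<^esub>)" if k: "k \<in> set js" for k
  proof -
    have "img (c i) \<bullet>\<^bsub>K\<^esub> defect (wrd f) (wrd f) (cell G R (e k \<bullet>\<^sub>t c k)) = img (c i) \<bullet>\<^bsub>K\<^esub> (img (e k) \<bullet>\<^bsub>K\<^esub> ?d k)"
      using defect_Vc_left[of "e k" "c k" f "h k" f] e[OF k] c[OF k] by simp
    also have "\<dots> = (img (c i) \<bullet>\<^bsub>K\<^esub> img (e k)) \<bullet>\<^bsub>K\<^esub> ?d k"
      by (rule K.Vcomp_assoc[OF mF mH[OF k] mF mH[OF i] dcl[OF k] image_closed(1)[OF mh[OF k] mf ec[OF k]] ici, symmetric])
    also have "img (c i) \<bullet>\<^bsub>K\<^esub> img (e k) = img (if i = k then Idt (h i) else Ze (h k) (h i))"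
      using e[OF k] c[OF i] by (intro img_Vc_eq[OF _ _ _ _ _ _ dual[OF i k]]) auto
    also have "\<dots> \<bullet>\<^bsub>K\<^esub> ?d k = (if i = k then ?d i else \<zero>\<^bsub>HK (wrd f) (wrd (h i))\<^esub>)"
    proof (cases "i = k")
      case True
      thus ?thesis using K.Vcomp_id(2)[OF mF mH[OF i] dcl[OF i]] by (simp add: img_Idt)
    next
      case False
      thus ?thesis using K.Vcomp_zero_left[OF mF mH[OF k] mH[OF i] dcl[OF k]] h[OF i] h[OF k] by (simp add: img_Ze)
    qed
    finally show ?thesis .
  qed
  \<comment> \<open>Of the terms composed with \<open>c i\<close> only the \<open>i\<close>-th survives; distinctness lets it occur once.\<close>
  have "img (c i) \<bullet>\<^bsub>K\<^esub> defect (wrd f) (wrd f) (cell G R (tsum f f (map (\<lambda>j. e j \<bullet>\<^sub>t c j) ks)))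
      = (if i \<in> set ks then ?d i else \<zero>\<^bsub>HK (wrd f) (wrd (h i))\<^esub>)"
    if "set ks \<subseteq> set js" "distinct ks" for ks
    using that
  proof (induction ks)
    case Nil
    show ?case
      using K.Vcomp_zero_right[OF mF mF mH[OF i] ici] by (simp add: tsum_def cell_Ze defect_zero[OF mf mf])
  next
    case (Cons k ks)
    let ?s = "e k \<bullet>\<^sub>t c k" and ?t = "tsum f f (map (\<lambda>j. e j \<bullet>\<^sub>t c j) ks)"
    have k: "k \<in> set js" and ks: "set ks \<subseteq> set js" using Cons.prems by auto
    have s: "wft G ?s \<and> tdom ?s = f \<and> tcod ?s = f" using e[OF k] c[OF k] by simp
    have t: "wft G ?t \<and> tdom ?t = f \<and> tcod ?t = f"
      using e c ks by (intro wft_tsum) auto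
    have cs: "cell G R ?s \<in> Cells AP (wrd f) (wrd f)" and ct: "cell G R ?t \<in> Cells AP (wrd f) (wrd f)"
      using s t by (auto intro!: cell_closed)
    have "tsum f f (map (\<lambda>j. e j \<bullet>\<^sub>t c j) (k # ks)) = ?s +\<^sub>t ?t" by (simp add: tsum_def)
    moreover have "cell G R (?s +\<^sub>t ?t) = cell G R ?s \<oplus>\<^bsub>Hom2 AP (wrd f) (wrd f)\<^esub> cell G R ?t"
      using s t cell_Ad[of ?s ?t] by simp
    ultimately have "img (c i) \<bullet>\<^bsub>K\<^esub> defect (wrd f) (wrd f) (cell G R (tsum f f (map (\<lambda>j. e j \<bullet>\<^sub>t c j) (k # ks))))
        = (img (c i) \<bullet>\<^bsub>K\<^esub> defect (wrd f) (wrd f) (cell G R ?s))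
          \<oplus>\<^bsub>HK (wrd f) (wrd (h i))\<^esub> (img (c i) \<bullet>\<^bsub>K\<^esub> defect (wrd f) (wrd f) (cell G R ?t))"
      by (simp only: defect_add[OF mf mf cs ct] K.Vcomp_add(1)[OF mF mF mH[OF i] defect_closed[OF mf mf cs] defect_closed[OF mf mf ct] ici])
    thus ?case
      using Cons.IH[OF ks] Cons.prems(2) H.r_zero[OF dcl[OF i]] H.l_zero[OF dcl[OF i]]
      unfolding summand[OF k] by auto
  qed
  from this[OF subset_refl js] have "img (c i) \<bullet>\<^bsub>K\<^esub> defect (wrd f) (wrd f) (cell G R (Idt f)) = ?d i"
    using i cell_eq[OF total] by simp
  hence "?d i = \<zero>\<^bsub>HK (wrd f) (wrd (h i))\<^esub>"
    using K.Vcomp_zero_right[OF mF mF mH[OF i] ici] by (simp add: cell_Idt defect_Id2[OF mf])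
  thus ?thesis using c[OF i] commutes_iff[of "c i" f "h i"] by simp
qed

text \<open>
  The mirror image, for a column \<open>e\<close> with inverse row \<open>c\<close>: apply the defect to \<open>\<Sum>\<^sub>j c j \<bullet> e j = 1\<close> and compose
  with \<open>F (c i)\<close> on the right.
\<close>

lemma commutes_inverse_row:
  fixes e c :: "'i \<Rightarrow> 'k trm"
  assumes e: "\<And>j. j \<in> set js \<Longrightarrow> wft G (e j) \<and> tdom (e j) = f \<and> tcod (e j) = h j \<and> commutes (e j)"
    and c: "\<And>j. j \<in> set js \<Longrightarrow> wft G (c j) \<and> tdom (c j) = h j \<and> tcod (c j) = f"
    and total: "teq G R (tsum f f (map (\<lambda>j. c j \<bullet>\<^sub>t e j) js)) (Idt f)"
    and dual: "\<And>i j. \<lbrakk>i \<in> set js; j \<in> set js\<rbrakk> \<Longrightarrow> teq G R (e j \<bullet>\<^sub>t c i) (if i = j then Idt (h i) else Ze (h i) (h j))"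
    and js: "distinct js" and i: "i \<in> set js"
  shows "commutes (c i)"
proof -
  let ?a = "snd f" and ?b = "tgt f"
  have h: "snd (h j) = ?a \<and> tgt (h j) = ?b" if "j \<in> set js" for j
    using wft_parallel[of G "e j"] e[OF that] by auto
  have mf: "wrd f \<in> Mor AP ?a ?b" by (simp add: wrd_Mor)
  have mh: "wrd (h j) \<in> Mor AP ?a ?b" if "j \<in> set js" for j using h[OF that] by (simp add: wrd_Mor)
  note mF = F.fmor_closed[OF mf] and mH = F.fmor_closed[OF mh]
  have ec: "cell G R (e j) \<in> Cells AP (wrd f) (wrd (h j))" if "j \<in> set js" for j
    using e[OF that] by (simp add: cell_closed)
  have cc: "cell G R (c j) \<in> Cells AP (wrd (h j)) (wrd f)" if "j \<in> set js" for j
    using c[OF that] by (simp add: cell_closed)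
  let ?d = "\<lambda>j. defect (wrd (h j)) (wrd f) (cell G R (c j))"
  note ici = image_closed(1)[OF mh[OF i] mf cc[OF i]]
  interpret H: abelian_group "HK (wrd (h i)) (wrd f)" using HK_group[OF mh[OF i] mf] .
  have dcl: "?d j \<in> carrier (HK (wrd (h j)) (wrd f))" if "j \<in> set js" for j
    by (rule defect_closed[OF mh[OF that] mf cc[OF that]])
  have summand: "defect (wrd f) (wrd f) (cell G R (c k \<bullet>\<^sub>t e k)) \<bullet>\<^bsub>K\<^esub> img (c i)
      = (if i = k then ?d i else \<zero>\<^bsub>HK (wrd (h i)) (wrd f)\<^esub>)" if k: "k \<in> set js" for k
  proof -
    have "defect (wrd f) (wrd f) (cell G R (c k \<bullet>\<^sub>t e k)) \<bullet>\<^bsub>K\<^esub> img (c i) = (?d k \<bullet>\<^bsub>K\<^esub> img (e k)) \<bullet>\<^bsub>K\<^esub> img (c i)"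
      using defect_Vc_right[of "c k" "e k" f "h k" f] e[OF k] c[OF k] by simp
    also have "\<dots> = ?d k \<bullet>\<^bsub>K\<^esub> (img (e k) \<bullet>\<^bsub>K\<^esub> img (c i))"
      by (rule K.Vcomp_assoc[OF mH[OF i] mF mH[OF k] mF ici image_closed(1)[OF mf mh[OF k] ec[OF k]] dcl[OF k]])
    also have "img (e k) \<bullet>\<^bsub>K\<^esub> img (c i) = img (if i = k then Idt (h i) else Ze (h i) (h k))"
      using e[OF k] c[OF i] by (intro img_Vc_eq[OF _ _ _ _ _ _ dual[OF i k]]) auto
    also have "?d k \<bullet>\<^bsub>K\<^esub> \<dots> = (if i = k then ?d i else \<zero>\<^bsub>HK (wrd (h i)) (wrd f)\<^esub>)"
    proof (cases "i = k")
      case True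
      thus ?thesis using K.Vcomp_id(1)[OF mH[OF i] mF dcl[OF i]] by (simp add: img_Idt)
    next
      case False
      thus ?thesis using K.Vcomp_zero_right[OF mH[OF i] mH[OF k] mF dcl[OF k]] h[OF i] h[OF k] by (simp add: img_Ze)
    qed
    finally show ?thesis .
  qed
  have "defect (wrd f) (wrd f) (cell G R (tsum f f (map (\<lambda>j. c j \<bullet>\<^sub>t e j) ks))) \<bullet>\<^bsub>K\<^esub> img (c i)
      = (if i \<in> set ks then ?d i else \<zero>\<^bsub>HK (wrd (h i)) (wrd f)\<^esub>)"
    if "set ks \<subseteq> set js" "distinct ks" for ks
    using that
  proof (induction ks)
    case Nil
    show ?case
      using K.Vcomp_zero_left[OF mH[OF i] mF mF ici] by (simp add: tsum_def cell_Ze defect_zero[OF mf mf])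
  next
    case (Cons k ks)
    let ?s = "c k \<bullet>\<^sub>t e k" and ?t = "tsum f f (map (\<lambda>j. c j \<bullet>\<^sub>t e j) ks)"
    have k: "k \<in> set js" and ks: "set ks \<subseteq> set js" using Cons.prems by auto
    have s: "wft G ?s \<and> tdom ?s = f \<and> tcod ?s = f" using e[OF k] c[OF k] by simp
    have t: "wft G ?t \<and> tdom ?t = f \<and> tcod ?t = f"
      using e c ks by (intro wft_tsum) auto
    have cs: "cell G R ?s \<in> Cells AP (wrd f) (wrd f)" and ct: "cell G R ?t \<in> Cells AP (wrd f) (wrd f)"
      using s t by (auto intro!: cell_closed)
    have "tsum f f (map (\<lambda>j. c j \<bullet>\<^sub>t e j) (k # ks)) = ?s +\<^sub>t ?t" by (simp add: tsum_def)
    moreover have "cell G R (?s +\<^sub>t ?t) = cell G R ?s \<oplus>\<^bsub>Hom2 AP (wrd f) (wrd f)\<^esub> cell G R ?t"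
      using s t cell_Ad[of ?s ?t] by simp
    ultimately have "defect (wrd f) (wrd f) (cell G R (tsum f f (map (\<lambda>j. c j \<bullet>\<^sub>t e j) (k # ks)))) \<bullet>\<^bsub>K\<^esub> img (c i)
        = (defect (wrd f) (wrd f) (cell G R ?s) \<bullet>\<^bsub>K\<^esub> img (c i))
          \<oplus>\<^bsub>HK (wrd (h i)) (wrd f)\<^esub> (defect (wrd f) (wrd f) (cell G R ?t) \<bullet>\<^bsub>K\<^esub> img (c i))"
      by (simp only: defect_add[OF mf mf cs ct] K.Vcomp_add(2)[OF mH[OF i] mF mF ici defect_closed[OF mf mf cs] defect_closed[OF mf mf ct]])
    thus ?case
      using Cons.IH[OF ks] Cons.prems(2) H.r_zero[OF dcl[OF i]] H.l_zero[OF dcl[OF i]]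
      unfolding summand[OF k] by auto
  qed
  from this[OF subset_refl js] have "defect (wrd f) (wrd f) (cell G R (Idt f)) \<bullet>\<^bsub>K\<^esub> img (c i) = ?d i"
    using i cell_eq[OF total] by simp
  hence "?d i = \<zero>\<^bsub>HK (wrd (h i)) (wrd f)\<^esub>"
    using K.Vcomp_zero_left[OF mH[OF i] mF mF ici] by (simp add: cell_Idt defect_Id2[OF mf])
  thus ?thesis using c[OF i] commutes_iff[of "c i" "h i" f] by simp
qed

lemma commutes_if_generators_commute:
  assumes gens: "\<And>g. g \<in> G \<Longrightarrow> commutes (Gen g)"
    and mor: "A \<in> Mor AP a b" "B \<in> Mor AP a b" and \<alpha>: "\<alpha> \<in> Cells AP A B"
  shows "\<delta>K (fcell F \<alpha>) = fcell F (\<delta> \<alpha>)"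
proof (rule commutes_if_entries_commute[OF mor \<alpha>])
  fix f g \<mu> assume f: "f \<in> Mor P a b" and g: "g \<in> Mor P a b" and \<mu>: "\<mu> \<in> Cells P f g"
  from \<mu> obtain t where t: "\<mu> = cls G R t" "wft G t" "tdom t = f" "tcod t = g" by (rule Cells_P_E)
  have "mk2 (a, b, [(0, f)]) (a, b, [(0, g)]) (\<lambda>_ _. \<mu>) = cell G R t"
    using f g t by (simp add: cell_def wrd_def Mor_P)
  thus "\<delta>K (fcell F (mk2 (a, b, [(0, f)]) (a, b, [(0, g)]) (\<lambda>_ _. \<mu>)))
      = fcell F (\<delta> (mk2 (a, b, [(0, f)]) (a, b, [(0, g)]) (\<lambda>_ _. \<mu>)))"
    using commutes_term[OF t(2) subset_refl gens] by (simp add: commutes_def)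
qed

end

lemma dots_wft: "Dot m \<in> G \<Longrightarrow> wft G (dots m n)"
  by (induction n) (auto simp: dots_def dots_typed[unfolded dots_def])

definition basic_gens :: "gen set"
  where "basic_gens = range Dot \<union> range Cross \<union> range Eta \<union> range Epsilon"

text \<open>
  Rouquier's presentation, where the defect is known to vanish on all generators but the formal inverses.
\<close>

locale rouquier_comparison = presented_comparison UR_gens UR_rels \<delta> K \<delta>K F
  for \<delta> :: "'k::field mor2 \<Rightarrow> 'k mor2" and K :: "('o1, 'f1, 'a1, 'k) gr2cat" and \<delta>K :: "'a1 \<Rightarrow> 'a1"
    and F :: "(int, mor1, 'k mor2, 'o1, 'f1, 'a1) fun2" +
  assumes commutes_Dot: "commutes (Gen (Dot m))" and commutes_Cross: "commutes (Gen (Cross m))"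
    and commutes_Eta: "commutes (Gen (Eta m))" and commutes_Epsilon: "commutes (Gen (Epsilon m))"
begin

lemma commutes_basic: "wft basic_gens t \<Longrightarrow> wft UR_gens t \<and> commutes t"
proof (rule commutes_term[of basic_gens])
  show "basic_gens \<subseteq> UR_gens" by (auto simp: basic_gens_def UR_gens_def)
  show "g \<in> basic_gens \<Longrightarrow> commutes (Gen g)" for g
    by (auto simp: basic_gens_def commutes_Dot commutes_Cross commutes_Eta commutes_Epsilon)
qed

lemma sig_basic: "wft basic_gens (sig m)" "tdom (sig m) = ([\<F>, \<E>], m)" "tcod (sig m) = ([\<E>, \<F>], m)"
  by (auto simp: sig_def basic_gens_def wcomp_def tgt_def)

lemma eta_dots_basic: "wft basic_gens (eta_dots m j)" "tdom (eta_dots m j) = ([], m)" "tcod (eta_dots m j) = ([\<E>, \<F>], m)"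
  by (auto simp: eta_dots_def basic_gens_def wcomp_def tgt_def dots_typed dots_wft)

lemma eps_dots_basic: "wft basic_gens (eps_dots m j)" "tdom (eps_dots m j) = ([\<F>, \<E>], m)" "tcod (eps_dots m j) = ([], m)"
  by (auto simp: eps_dots_def basic_gens_def wcomp_def tgt_def dots_typed dots_wft)

text \<open>
  For \<open>m \<ge> 0\<close> the formal inverse is a column. The index \<open>None\<close> stands for the summand \<open>\<F>\<E>\<close>, with entries
  \<open>sig\<close> and \<open>InvS\<close>, and \<open>Some n\<close> for the \<open>n\<close>-th copy of the identity 1-morphism. The entries of the inverted
  row are composites of \<open>x\<close>, \<open>\<tau>\<close>, \<open>\<eta>\<close> and \<open>\<epsilon>\<close>.
\<close>

lemma commutes_inverse_pos:
  assumes m: "m \<ge> 0" and i: "i = None \<or> (\<exists>n. i = Some n \<and> int n < m)"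
  shows "commutes (case i of None \<Rightarrow> Gen (InvS m) | Some n \<Rightarrow> Gen (InvP m n))"
proof -
  let ?js = "None # map Some [0..<nat m]"
  let ?e = "(\<lambda>j. case j of None \<Rightarrow> sig m | Some n \<Rightarrow> eta_dots m n) :: nat option \<Rightarrow> 'k trm"
  let ?c = "(\<lambda>j. case j of None \<Rightarrow> Gen (InvS m) | Some n \<Rightarrow> Gen (InvP m n)) :: nat option \<Rightarrow> 'k trm"
  let ?h = "\<lambda>j. case j of None \<Rightarrow> ([\<F>, \<E>], m) | Some _ \<Rightarrow> ([], m)"
  let ?f = "([\<E>, \<F>], m)"
  have e: "wft UR_gens (?e j) \<and> tdom (?e j) = ?h j \<and> tcod (?e j) = ?f \<and> commutes (?e j)" for j
    by (cases j) (simp_all add: commutes_basic sig_basic eta_dots_basic)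
  have c: "wft UR_gens (?c j) \<and> tdom (?c j) = ?f \<and> tcod (?c j) = ?h j" if "j \<in> set ?js" for j
    using that by (auto simp: UR_gens_def)
  have "commutes (?c i)"
  proof (rule commutes_inverse_column[where e = ?e and c = ?c and h = ?h and f = ?f and js = ?js])
    let ?sum = "tsum ?f ?f (map (\<lambda>j. ?e j \<bullet>\<^sub>t ?c j) ?js)"
    have eq: "?sum = sig m \<bullet>\<^sub>t Gen (InvS m) +\<^sub>t tsum ?f ?f [eta_dots m j \<bullet>\<^sub>t Gen (InvP m j). j \<leftarrow> [0..<nat m]]"
      by (simp add: tsum_def comp_def)
    have "wft UR_gens t \<and> tdom t = ?f \<and> tcod t = ?f" if "t \<in> set (map (\<lambda>j. ?e j \<bullet>\<^sub>t ?c j) ?js)" for t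
    proof -
      from that obtain j where j: "j \<in> set ?js" "t = ?e j \<bullet>\<^sub>t ?c j" unfolding set_map by blast
      show ?thesis using e[of j] c[OF j(1)] by (simp only: j(2) wft.simps tdom.simps tcod.simps)
    qed
    hence w: "wft UR_gens ?sum" using wft_tsum[OF HOL.refl HOL.refl] by blast
    show "teq UR_gens UR_rels ?sum (Idt ?f)"
      by (rule teq.rel[OF _ w]) (use inv_pos_id[OF m] eq in auto)
    fix i j assume ij: "i \<in> set ?js" "j \<in> set ?js"
    have w: "wft UR_gens (?c i \<bullet>\<^sub>t ?e j)" using e[of j] c[OF ij(1)] by simp
    have w': "wft UR_gens (if i = j then Idt (?h i) else Ze (?h j) (?h i))" by (auto simp: tgt_def split: option.splits)
    have "(?c i \<bullet>\<^sub>t ?e j, if i = j then Idt (?h i) else Ze (?h j) (?h i)) \<in> UR_rels"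
    proof (cases i; cases j)
      assume that: "i = None" "j = None"
      from inv_pos_SS[OF m] show ?thesis by (simp add: that)
    next
      fix b assume that: "i = None" "j = Some b"
      hence "int b < m" using ij by auto
      from inv_pos_SP[OF this] show ?thesis by (simp add: that)
    next
      fix a assume that: "i = Some a" "j = None"
      hence "int a < m" using ij by auto
      from inv_pos_PS[OF this] show ?thesis by (simp add: that)
    next
      fix a b assume that: "i = Some a" "j = Some b"
      hence "int a < m" "int b < m" using ij by auto
      from inv_pos_PP[OF this] show ?thesis by (cases "a = b") (simp_all add: that)
    qed
    thus "teq UR_gens UR_rels (?c i \<bullet>\<^sub>t ?e j) (if i = j then Idt (?h i) else Ze (?h j) (?h i))"
      using w w' by (rule teq.rel)
  qed (use e c i in \<open>auto simp: distinct_map\<close>)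
  thus ?thesis .
qed

text \<open>
  For \<open>m \<le> 0\<close> the formal inverse is a row, indexed in the same way.
\<close>

lemma commutes_inverse_neg:
  assumes m: "m \<le> 0" and i: "i = None \<or> (\<exists>n. i = Some n \<and> int n < - m)"
  shows "commutes (case i of None \<Rightarrow> Gen (InvS m) | Some n \<Rightarrow> Gen (InvI m n))"
proof -
  let ?js = "None # map Some [0..<nat (- m)]"
  let ?e = "(\<lambda>j. case j of None \<Rightarrow> sig m | Some n \<Rightarrow> eps_dots m n) :: nat option \<Rightarrow> 'k trm"
  let ?c = "(\<lambda>j. case j of None \<Rightarrow> Gen (InvS m) | Some n \<Rightarrow> Gen (InvI m n)) :: nat option \<Rightarrow> 'k trm"
  let ?h = "\<lambda>j. case j of None \<Rightarrow> ([\<E>, \<F>], m) | Some _ \<Rightarrow> ([], m)"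
  let ?f = "([\<F>, \<E>], m)"
  have e: "wft UR_gens (?e j) \<and> tdom (?e j) = ?f \<and> tcod (?e j) = ?h j \<and> commutes (?e j)" for j
    by (cases j) (simp_all add: commutes_basic sig_basic eps_dots_basic)
  have c: "wft UR_gens (?c j) \<and> tdom (?c j) = ?h j \<and> tcod (?c j) = ?f" if "j \<in> set ?js" for j
    using that by (auto simp: UR_gens_def)
  have "commutes (?c i)"
  proof (rule commutes_inverse_row[where e = ?e and c = ?c and h = ?h and f = ?f and js = ?js])
    let ?sum = "tsum ?f ?f (map (\<lambda>j. ?c j \<bullet>\<^sub>t ?e j) ?js)"
    have eq: "?sum = Gen (InvS m) \<bullet>\<^sub>t sig m +\<^sub>t tsum ?f ?f [Gen (InvI m j) \<bullet>\<^sub>t eps_dots m j. j \<leftarrow> [0..<nat (- m)]]"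
      by (simp add: tsum_def comp_def)
    have "wft UR_gens t \<and> tdom t = ?f \<and> tcod t = ?f" if "t \<in> set (map (\<lambda>j. ?c j \<bullet>\<^sub>t ?e j) ?js)" for t
    proof -
      from that obtain j where j: "j \<in> set ?js" "t = ?c j \<bullet>\<^sub>t ?e j" unfolding set_map by blast
      show ?thesis using e[of j] c[OF j(1)] by (simp only: j(2) wft.simps tdom.simps tcod.simps)
    qed
    hence w: "wft UR_gens ?sum" using wft_tsum[OF HOL.refl HOL.refl] by blast
    show "teq UR_gens UR_rels ?sum (Idt ?f)"
      by (rule teq.rel[OF _ w]) (use inv_neg_id[OF m] eq in auto)
    fix i j assume ij: "i \<in> set ?js" "j \<in> set ?js"
    have w: "wft UR_gens (?e j \<bullet>\<^sub>t ?c i)" using e[of j] c[OF ij(1)] by simp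
    have w': "wft UR_gens (if i = j then Idt (?h i) else Ze (?h i) (?h j))" by (auto simp: tgt_def split: option.splits)
    have "(?e j \<bullet>\<^sub>t ?c i, if i = j then Idt (?h i) else Ze (?h i) (?h j)) \<in> UR_rels"
    proof (cases i; cases j)
      assume that: "i = None" "j = None"
      from inv_neg_SS[OF m] show ?thesis by (simp add: that)
    next
      fix b assume that: "i = None" "j = Some b"
      hence "int b < - m" using ij by auto
      from inv_neg_IS[OF this] show ?thesis by (simp add: that)
    next
      fix a assume that: "i = Some a" "j = None"
      hence "int a < - m" using ij by auto
      from inv_neg_SI[OF this] show ?thesis by (simp add: that)
    next
      fix a b assume that: "i = Some a" "j = Some b"
      hence "int b < - m" "int a < - m" using ij by auto
      from inv_neg_II[OF this] show ?thesis by (cases "a = b") (simp_all add: that)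
    qed
    thus "teq UR_gens UR_rels (?e j \<bullet>\<^sub>t ?c i) (if i = j then Idt (?h i) else Ze (?h i) (?h j))"
      using w w' by (rule teq.rel)
  qed (use e c i in \<open>auto simp: distinct_map\<close>)
  thus ?thesis .
qed

lemma commutes_generator:
  assumes "g \<in> UR_gens" shows "commutes (Gen g)"
proof -
  have S: "commutes (Gen (InvS m))" for m
    using commutes_inverse_pos[of m None] commutes_inverse_neg[of m None] by (cases "m \<ge> 0") auto
  have P: "commutes (Gen (InvP m n))" if "int n < m" for m n
    using commutes_inverse_pos[of m "Some n"] that by auto
  have I: "commutes (Gen (InvI m n))" if "int n < - m" for m n
    using commutes_inverse_neg[of m "Some n"] that by auto
  show ?thesis
    using assms S P I commutes_Dot commutes_Cross commutes_Eta commutes_Epsilon unfolding UR_gens_def by auto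
qed

end

section \<open>Transport along an equivalence\<close>

lemma fun2_on_cells_simps [simp]:
  "fobj (fun2_on_cells D \<Theta>) a = a" "fmor (fun2_on_cells D \<Theta>) f = f" "fcell (fun2_on_cells D \<Theta>) = \<Theta>"
  "fcmp (fun2_on_cells D \<Theta>) g f = Id2 D (g \<diamondop>\<^bsub>D\<^esub> f)" "funit (fun2_on_cells D \<Theta>) a = Id2 D (Unit1 D a)"
  by (simp_all add: fun2_on_cells_def)

lemma transport_simps [simp]:
  "fobj (transport \<Theta> \<Phi>) = fobj \<Phi>" "fmor (transport \<Theta> \<Phi>) = fmor \<Phi>" "fcell (transport \<Theta> \<Phi>) \<alpha> = fcell \<Phi> (\<Theta> \<alpha>)"
  "fcmp (transport \<Theta> \<Phi>) = fcmp \<Phi>" "funit (transport \<Theta> \<Phi>) = funit \<Phi>"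
  by (simp_all add: transport_def)

text \<open>
  A strict 2-functor that is the identity on objects and 1-morphisms and bijective on 2-morphisms. The last
  assumption says that a 2-morphism of \<open>D\<close> determines its source and target, so that the inverse of \<open>\<Theta>\<close> is a
  function of the 2-morphism alone.
\<close>

locale equivalence_on_cells =
  C: linear_2cat_part C + D: linear_2cat_part D + T: graded_2functor C D "fun2_on_cells D \<Theta>"
  for C :: "('o, 'f, 'a, 'k::field) gr2cat" and D :: "('o, 'f, 'b, 'k) gr2cat" and \<Theta> :: "'a \<Rightarrow> 'b" +
  assumes same_Objs: "Objs C = Objs D" and same_Mor: "Mor C = Mor D"
    and same_Comp1: "Comp1 C = Comp1 D" and same_Unit1: "Unit1 C = Unit1 D"
    and bij: "\<lbrakk>A \<in> Mor C a b; B \<in> Mor C a b\<rbrakk> \<Longrightarrow> bij_betw \<Theta> (Cells C A B) (Cells D A B)"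
    and disjoint: "\<lbrakk>\<beta> \<in> Cells D A B; \<beta> \<in> Cells D A' B'\<rbrakk> \<Longrightarrow> A = A' \<and> B = B'"
begin

lemma preimage:
  assumes "A \<in> Mor D a b" "B \<in> Mor D a b" "\<beta> \<in> Cells D A B"
  obtains \<alpha> where "\<alpha> \<in> Cells C A B" "\<Theta> \<alpha> = \<beta>"
proof -
  have "\<Theta> ` Cells C A B = Cells D A B"
    by (rule bij_betw_imp_surj_on[OF bij[OF assms(1,2)[folded same_Mor]]])
  hence "\<beta> \<in> \<Theta> ` Cells C A B" using assms(3) by simp
  thus ?thesis using that by blast
qed

text \<open>
  The structure isomorphisms of \<open>fun2_on_cells\<close> are identities, so naturality becomes strict preservation.
\<close>

lemma \<Theta>_Hcomp:
  assumes mor: "f \<in> Mor C a b" "f' \<in> Mor C a b" "g \<in> Mor C b c" "g' \<in> Mor C b c"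
    and cells: "\<alpha> \<in> Cells C f f'" "\<beta> \<in> Cells C g g'"
  shows "\<Theta> (\<beta> \<star>\<^bsub>C\<^esub> \<alpha>) = \<Theta> \<beta> \<star>\<^bsub>D\<^esub> \<Theta> \<alpha>"
proof -
  note m = mor[unfolded same_Mor]
  note c = D.Comp1_closed[OF m(1,3)] D.Comp1_closed[OF m(2,4)]
  have l: "\<Theta> (\<beta> \<star>\<^bsub>C\<^esub> \<alpha>) \<in> Cells D (g \<diamondop>\<^bsub>D\<^esub> f) (g' \<diamondop>\<^bsub>D\<^esub> f')"
    using T.fcell_closed[OF C.Comp1_closed[OF mor(1,3)] C.Comp1_closed[OF mor(2,4)] C.Hcomp_closed[OF mor cells]]
    by (simp add: same_Comp1)
  have r: "\<Theta> \<beta> \<star>\<^bsub>D\<^esub> \<Theta> \<alpha> \<in> Cells D (g \<diamondop>\<^bsub>D\<^esub> f) (g' \<diamondop>\<^bsub>D\<^esub> f')"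
    using D.Hcomp_closed[OF m] T.fcell_closed[OF mor(1,2) cells(1)] T.fcell_closed[OF mor(3,4) cells(2)] by simp
  have "\<Theta> (\<beta> \<star>\<^bsub>C\<^esub> \<alpha>) \<bullet>\<^bsub>D\<^esub> Id2 D (g \<diamondop>\<^bsub>D\<^esub> f)
      = Id2 D (g' \<diamondop>\<^bsub>D\<^esub> f') \<bullet>\<^bsub>D\<^esub> (\<Theta> \<beta> \<star>\<^bsub>D\<^esub> \<Theta> \<alpha>)"
    using T.fcmp_natural[OF mor cells] by simp
  thus ?thesis
    by (simp add: D.Vcomp_id(1)[OF c l] D.Vcomp_id(2)[OF c r])
qed

text \<open>
  The conjugate of \<open>\<delta>\<close> by \<open>\<Theta>\<close>; by injectivity and disjointness the chosen preimage is the only one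
  (\<open>transported_image\<close>).
\<close>

definition transported :: "('a \<Rightarrow> 'a) \<Rightarrow> 'b \<Rightarrow> 'b"
  where "transported \<delta> \<beta> = \<Theta> (\<delta> (SOME \<alpha>. \<exists>a b. \<exists>A \<in> Mor C a b. \<exists>B \<in> Mor C a b. \<alpha> \<in> Cells C A B \<and> \<Theta> \<alpha> = \<beta>))"

lemma transported_image:
  assumes mor: "A \<in> Mor C a b" "B \<in> Mor C a b" and \<alpha>: "\<alpha> \<in> Cells C A B"
  shows "transported \<delta> (\<Theta> \<alpha>) = \<Theta> (\<delta> \<alpha>)"
proof -
  let ?P = "\<lambda>\<alpha>'. \<exists>a b. \<exists>A \<in> Mor C a b. \<exists>B \<in> Mor C a b. \<alpha>' \<in> Cells C A B \<and> \<Theta> \<alpha>' = \<Theta> \<alpha>"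
  have "\<alpha>' = \<alpha>" if "?P \<alpha>'" for \<alpha>'
  proof -
    from that obtain a' b' A' B' where 1: "A' \<in> Mor C a' b'" "B' \<in> Mor C a' b'" "\<alpha>' \<in> Cells C A' B'" "\<Theta> \<alpha>' = \<Theta> \<alpha>"
      by blast
    have "\<Theta> \<alpha> \<in> Cells D A B" "\<Theta> \<alpha>' \<in> Cells D A' B'"
      using T.fcell_closed[OF mor \<alpha>] T.fcell_closed[OF 1(1-3)] by simp_all
    hence "A' = A \<and> B' = B" using 1(4) by (intro disjoint) simp_all
    hence "\<alpha>' \<in> Cells C A B" using 1(3) by simp
    thus ?thesis using 1(4) \<alpha> bij_betw_imp_inj_on[OF bij[OF mor]] by (auto dest: inj_onD)
  qed
  moreover have "?P \<alpha>" using assms by blast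
  ultimately have "(SOME \<alpha>'. ?P \<alpha>') = \<alpha>" by (intro some_equality)
  thus ?thesis by (simp add: transported_def)
qed

lemma derivation_transported:
  assumes "derivation C \<delta>"
  shows "derivation D (transported \<delta>)"
proof -
  interpret d: derivation C \<delta> by fact
  show ?thesis
  proof (rule derivation.intro)
    fix A B a b \<beta> assume mor: "A \<in> Mor D a b" "B \<in> Mor D a b" and \<beta>: "\<beta> \<in> Cells D A B"
    note m = mor[folded same_Mor]
    obtain \<alpha> where \<alpha>: "\<alpha> \<in> Cells C A B" "\<Theta> \<alpha> = \<beta>" using preimage[OF mor \<beta>] .
    show "transported \<delta> \<beta> \<in> Cells D A B"
      using T.fcell_closed[OF m d.d_closed[OF m \<alpha>(1)]] transported_image[OF m \<alpha>(1)] \<alpha>(2) by simp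
    show "transported \<delta> (r \<odot>\<^bsub>Hom2 D A B\<^esub> \<beta>) = r \<odot>\<^bsub>Hom2 D A B\<^esub> transported \<delta> \<beta>" for r
      using transported_image[OF m C.smult_closed[OF m \<alpha>(1)]] transported_image[OF m \<alpha>(1)] \<alpha>(2)
        T.fcell_smult[OF m \<alpha>(1)] T.fcell_smult[OF m d.d_closed[OF m \<alpha>(1)]] d.d_smult[OF m \<alpha>(1)] by simp
    fix \<beta>' assume \<beta>': "\<beta>' \<in> Cells D A B"
    obtain \<alpha>' where \<alpha>': "\<alpha>' \<in> Cells C A B" "\<Theta> \<alpha>' = \<beta>'" using preimage[OF mor \<beta>'] .
    show "transported \<delta> (\<beta> \<oplus>\<^bsub>Hom2 D A B\<^esub> \<beta>') = transported \<delta> \<beta> \<oplus>\<^bsub>Hom2 D A B\<^esub> transported \<delta> \<beta>'"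
      using transported_image[OF m C.add_closed[OF m \<alpha>(1) \<alpha>'(1)]] transported_image[OF m \<alpha>(1)] transported_image[OF m \<alpha>'(1)]
        \<alpha>(2) \<alpha>'(2) T.fcell_add[OF m \<alpha>(1) \<alpha>'(1)] T.fcell_add[OF m d.d_closed[OF m \<alpha>(1)] d.d_closed[OF m \<alpha>'(1)]]
        d.d_add[OF m \<alpha>(1) \<alpha>'(1)] by simp
  next
    fix A B E a b \<beta> \<beta>'
    assume mor: "A \<in> Mor D a b" "B \<in> Mor D a b" "E \<in> Mor D a b"
      and \<beta>: "\<beta> \<in> Cells D A B" and \<beta>': "\<beta>' \<in> Cells D B E"
    note m = mor[folded same_Mor]
    obtain \<alpha> where \<alpha>: "\<alpha> \<in> Cells C A B" "\<Theta> \<alpha> = \<beta>" using preimage[OF mor(1,2) \<beta>] .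
    obtain \<alpha>' where \<alpha>': "\<alpha>' \<in> Cells C B E" "\<Theta> \<alpha>' = \<beta>'" using preimage[OF mor(2,3) \<beta>'] .
    note d\<alpha> = d.d_closed[OF m(1,2) \<alpha>(1)] and d\<alpha>' = d.d_closed[OF m(2,3) \<alpha>'(1)]
    have "\<Theta> (\<delta> (\<alpha>' \<bullet>\<^bsub>C\<^esub> \<alpha>)) = (\<Theta> (\<delta> \<alpha>') \<bullet>\<^bsub>D\<^esub> \<beta>) \<oplus>\<^bsub>Hom2 D A E\<^esub> (\<beta>' \<bullet>\<^bsub>D\<^esub> \<Theta> (\<delta> \<alpha>))"
      using d.Leibniz_Vcomp[OF m \<alpha>(1) \<alpha>'(1)]
        T.fcell_add[OF m(1,3) C.Vcomp_closed[OF m \<alpha>(1) d\<alpha>'] C.Vcomp_closed[OF m d\<alpha> \<alpha>'(1)]]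
        T.fcell_Vcomp[OF m \<alpha>(1) d\<alpha>'] T.fcell_Vcomp[OF m d\<alpha> \<alpha>'(1)] \<alpha>(2) \<alpha>'(2) by simp
    thus "transported \<delta> (\<beta>' \<bullet>\<^bsub>D\<^esub> \<beta>) = (transported \<delta> \<beta>' \<bullet>\<^bsub>D\<^esub> \<beta>) \<oplus>\<^bsub>Hom2 D A E\<^esub> (\<beta>' \<bullet>\<^bsub>D\<^esub> transported \<delta> \<beta>)"
      using transported_image[OF m(1,3) C.Vcomp_closed[OF m \<alpha>(1) \<alpha>'(1)], of \<delta>] T.fcell_Vcomp[OF m \<alpha>(1) \<alpha>'(1)]
        transported_image[OF m(1,2) \<alpha>(1), of \<delta>] transported_image[OF m(2,3) \<alpha>'(1), of \<delta>] \<alpha>(2) \<alpha>'(2) by simp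
  next
    fix f f' g g' a b c \<beta> \<beta>'
    assume mor: "f \<in> Mor D a b" "f' \<in> Mor D a b" "g \<in> Mor D b c" "g' \<in> Mor D b c"
      and \<beta>: "\<beta> \<in> Cells D f f'" and \<beta>': "\<beta>' \<in> Cells D g g'"
    note m = mor[folded same_Mor]
    note cm = C.Comp1_closed[OF m(1,3)] C.Comp1_closed[OF m(2,4)]
    obtain \<alpha> where \<alpha>: "\<alpha> \<in> Cells C f f'" "\<Theta> \<alpha> = \<beta>" using preimage[OF mor(1,2) \<beta>] .
    obtain \<alpha>' where \<alpha>': "\<alpha>' \<in> Cells C g g'" "\<Theta> \<alpha>' = \<beta>'" using preimage[OF mor(3,4) \<beta>'] .
    note d\<alpha> = d.d_closed[OF m(1,2) \<alpha>(1)] and d\<alpha>' = d.d_closed[OF m(3,4) \<alpha>'(1)]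
    have "\<Theta> (\<delta> (\<alpha>' \<star>\<^bsub>C\<^esub> \<alpha>)) = (\<Theta> (\<delta> \<alpha>') \<star>\<^bsub>D\<^esub> \<beta>) \<oplus>\<^bsub>Hom2 D (g \<diamondop>\<^bsub>C\<^esub> f) (g' \<diamondop>\<^bsub>C\<^esub> f')\<^esub> (\<beta>' \<star>\<^bsub>D\<^esub> \<Theta> (\<delta> \<alpha>))"
      using d.Leibniz_Hcomp[OF m \<alpha>(1) \<alpha>'(1)]
        T.fcell_add[OF cm C.Hcomp_closed[OF m \<alpha>(1) d\<alpha>'] C.Hcomp_closed[OF m d\<alpha> \<alpha>'(1)]]
        \<Theta>_Hcomp[OF m \<alpha>(1) d\<alpha>'] \<Theta>_Hcomp[OF m d\<alpha> \<alpha>'(1)] \<alpha>(2) \<alpha>'(2) by simp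
    thus "transported \<delta> (\<beta>' \<star>\<^bsub>D\<^esub> \<beta>)
        = (transported \<delta> \<beta>' \<star>\<^bsub>D\<^esub> \<beta>) \<oplus>\<^bsub>Hom2 D (g \<diamondop>\<^bsub>D\<^esub> f) (g' \<diamondop>\<^bsub>D\<^esub> f')\<^esub> (\<beta>' \<star>\<^bsub>D\<^esub> transported \<delta> \<beta>)"
      using transported_image[OF cm C.Hcomp_closed[OF m \<alpha>(1) \<alpha>'(1)], of \<delta>] \<Theta>_Hcomp[OF m \<alpha>(1) \<alpha>'(1)]
        transported_image[OF m(1,2) \<alpha>(1), of \<delta>] transported_image[OF m(3,4) \<alpha>'(1), of \<delta>] \<alpha>(2) \<alpha>'(2)
      by (simp add: same_Comp1)
  qed
qed

lemma transport_functor: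
  assumes "graded_2functor D K \<Phi>"
  shows "graded_2functor C K (transport \<Theta> \<Phi>)"
proof -
  interpret \<Phi>: graded_2functor D K \<Phi> by fact
  show ?thesis
  proof (rule graded_2functor.intro, unfold transport_simps same_Objs same_Comp1 same_Unit1)
    fix f g a b assume "f \<in> Mor C a b" "g \<in> Mor C a b"
    note m = this and m' = this[unfolded same_Mor]
    show "fmor \<Phi> f \<in> Mor K (fobj \<Phi> a) (fobj \<Phi> b)" using \<Phi>.fmor_closed[OF m'(1)] .
    show "fcell \<Phi> (\<Theta> \<alpha>) \<in> Deg2 K (fmor \<Phi> f) (fmor \<Phi> g) d" if "\<alpha> \<in> Deg2 C f g d" for \<alpha> d
      using \<Phi>.fcell_degree[OF m'] T.fcell_degree[OF m that] by simp
    fix \<alpha> assume \<alpha>: "\<alpha> \<in> Cells C f g"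
    note t = T.fcell_closed[OF m \<alpha>, simplified]
    show "fcell \<Phi> (\<Theta> \<alpha>) \<in> Cells K (fmor \<Phi> f) (fmor \<Phi> g)" by (rule \<Phi>.fcell_closed[OF m' t])
    show "fcell \<Phi> (\<Theta> (r \<odot>\<^bsub>Hom2 C f g\<^esub> \<alpha>)) = r \<odot>\<^bsub>Hom2 K (fmor \<Phi> f) (fmor \<Phi> g)\<^esub> fcell \<Phi> (\<Theta> \<alpha>)" for r
      using T.fcell_smult[OF m \<alpha>] \<Phi>.fcell_smult[OF m' t] by simp
    fix \<beta> assume \<beta>: "\<beta> \<in> Cells C f g"
    show "fcell \<Phi> (\<Theta> (\<alpha> \<oplus>\<^bsub>Hom2 C f g\<^esub> \<beta>)) = fcell \<Phi> (\<Theta> \<alpha>) \<oplus>\<^bsub>Hom2 K (fmor \<Phi> f) (fmor \<Phi> g)\<^esub> fcell \<Phi> (\<Theta> \<beta>)"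
      using T.fcell_add[OF m \<alpha> \<beta>] \<Phi>.fcell_add[OF m' t T.fcell_closed[OF m \<beta>, simplified]] by simp
  next
    fix f g h a b \<alpha> \<beta> assume m: "f \<in> Mor C a b" "g \<in> Mor C a b" "h \<in> Mor C a b"
      and \<alpha>: "\<alpha> \<in> Cells C f g" and \<beta>: "\<beta> \<in> Cells C g h"
    show "fcell \<Phi> (\<Theta> (\<beta> \<bullet>\<^bsub>C\<^esub> \<alpha>)) = fcell \<Phi> (\<Theta> \<beta>) \<bullet>\<^bsub>K\<^esub> fcell \<Phi> (\<Theta> \<alpha>)"
      using T.fcell_Vcomp[OF m \<alpha> \<beta>] \<Phi>.fcell_Vcomp[OF m[unfolded same_Mor]] T.fcell_closed[OF m(1,2) \<alpha>]
        T.fcell_closed[OF m(2,3) \<beta>] by simp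
  next
    fix f f' g g' a b c \<alpha> \<beta> assume m: "f \<in> Mor C a b" "f' \<in> Mor C a b" "g \<in> Mor C b c" "g' \<in> Mor C b c"
      and \<alpha>: "\<alpha> \<in> Cells C f f'" and \<beta>: "\<beta> \<in> Cells C g g'"
    show "fcell \<Phi> (\<Theta> (\<beta> \<star>\<^bsub>C\<^esub> \<alpha>)) \<bullet>\<^bsub>K\<^esub> fcmp \<Phi> g f = fcmp \<Phi> g' f' \<bullet>\<^bsub>K\<^esub> (fcell \<Phi> (\<Theta> \<beta>) \<star>\<^bsub>K\<^esub> fcell \<Phi> (\<Theta> \<alpha>))"
      using \<Theta>_Hcomp[OF m \<alpha> \<beta>] \<Phi>.fcmp_natural[OF m[unfolded same_Mor]] T.fcell_closed[OF m(1,2) \<alpha>]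
        T.fcell_closed[OF m(3,4) \<beta>] by simp
  next
    show "f \<in> Mor C a b \<Longrightarrow> fcell \<Phi> (\<Theta> (Id2 C f)) = Id2 K (fmor \<Phi> f)" for f a b
      using T.fcell_id[of f a b] \<Phi>.fcell_id[of f a b] same_Mor by simp
  qed (use same_Mor in \<open>auto intro: \<Phi>.fobj_closed \<Phi>.fmor_closed \<Phi>.fcmp_iso \<Phi>.funit_iso \<Phi>.fcmp_assoc \<Phi>.fcmp_unit\<close>)
qed

end

lemma wft_mono: "\<lbrakk>wft G t; G \<subseteq> G'\<rbrakk> \<Longrightarrow> wft G' t"
  by (induction t) auto

lemma basic_gens_subset: "basic_gens \<subseteq> U_gens" "basic_gens \<subseteq> UR_gens"
  by (auto simp: basic_gens_def U_gens_def UR_gens_def)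

lemma Cells_add_closure_disjoint:
  "\<lbrakk>\<beta> \<in> Cells (add_closure C) A B; \<beta> \<in> Cells (add_closure C) A' B'\<rbrakk> \<Longrightarrow> A = A' \<and> B = B'"
  by (auto simp: add_closure_def hom_sum2_def mk2_def)

lemma linear_2cat_part_UU: "linear_2cat_part (UU :: (int, mor1, 'k::field mor2, 'k) gr2cat)"
  unfolding UU_def
  by (intro linear_2cat_part.add_closure_linear_2cat_part typed_presentation.presented_linear_2cat_part U_presentation)

lemma linear_2cat_part_UR: "linear_2cat_part (UR :: (int, mor1, 'k::field mor2, 'k) gr2cat)"
  unfolding UR_def
  by (intro linear_2cat_part.add_closure_linear_2cat_part typed_presentation.presented_linear_2cat_part UR_presentation)

lemma matching_equivalence_on_cells:
  fixes \<Theta> :: "'k::field mor2 \<Rightarrow> 'k mor2"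
  assumes "matching_equivalence \<Theta>"
  shows "equivalence_on_cells UU UR \<Theta>"
proof -
  let ?UU = "UU :: (int, mor1, 'k mor2, 'k) gr2cat"
  note M = assms[unfolded matching_equivalence_def]
  show ?thesis
  proof (intro equivalence_on_cells.intro equivalence_on_cells_axioms.intro linear_2cat_part_UU linear_2cat_part_UR)
    show "graded_2functor UU UR (fun2_on_cells UR \<Theta>)" using M by blast
    show "Objs UU = Objs UR" "Mor ?UU = Mor UR" "Comp1 UU = Comp1 UR" "Unit1 UU = Unit1 UR"
      by (simp_all add: UU_def UR_def add_closure_def presented_def comp_sum1_def fun_eq_iff)
    show "bij_betw \<Theta> (Cells UU A B) (Cells UR A B)" if "A \<in> Mor ?UU a b" "B \<in> Mor ?UU a b" for A B a b
      using M that by blast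
    show "A = A' \<and> B = B'" if "\<beta> \<in> Cells UR A B" "\<beta> \<in> Cells UR A' B'" for \<beta> A B A' B'
      using that Cells_add_closure_disjoint unfolding UR_def by blast
  qed
qed

text \<open>
  An equivalence matching the common generators matches every linear combination of composites of them, in
  particular the prescribed values of the differential.
\<close>

lemma matching_equivalence_cell:
  fixes \<Theta> :: "'k::field mor2 \<Rightarrow> 'k mor2"
  assumes M: "matching_equivalence \<Theta>" and t: "wft basic_gens t"
  shows "\<Theta> (Ucell t) = URcell t"
proof -
  let ?UU = "UU :: (int, mor1, 'k mor2, 'k) gr2cat"
  interpret E: equivalence_on_cells UU UR \<Theta> by (rule matching_equivalence_on_cells[OF M])
  interpret U: typed_presentation U_gens "U_rels :: ('k trm \<times> 'k trm) set" by (rule U_presentation)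
  interpret R: typed_presentation UR_gens "UR_rels :: ('k trm \<times> 'k trm) set" by (rule UR_presentation)
  note mono = wft_mono[OF _ basic_gens_subset(1)] wft_mono[OF _ basic_gens_subset(2)]
  have mor: "wrd f \<in> Mor ?UU a b" if "snd f = a" "tgt f = b" for f a b
    using U.Mor_wrd[of f] that by (simp add: UU_def)
  have cl: "Ucell t \<in> Cells UU (wrd f) (wrd g)" if "wft basic_gens t" "tdom t = f" "tcod t = g" for t :: "'k trm" and f g
    using U.cell_Cells[OF mono(1)[OF that(1)]] that by (simp add: UU_def)
  show ?thesis
    using t
  proof (induction t)
    case (Gen g)
    thus ?case using M unfolding matching_equivalence_def basic_gens_def by auto
  next
    case (Idt f)
    show ?case using E.T.fcell_id[OF mor[of f, OF HOL.refl HOL.refl]]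
      by (simp add: U.cell_Idt R.cell_Idt UU_def UR_def)
  next
    case (Ze f g)
    hence m: "wrd f \<in> Mor ?UU (snd f) (tgt f)" "wrd g \<in> Mor ?UU (snd f) (tgt f)" by (auto intro: mor)
    have "\<Theta> \<zero>\<^bsub>Hom2 UU (wrd f) (wrd g)\<^esub> = \<zero>\<^bsub>Hom2 UR (wrd f) (wrd g)\<^esub>"
      using graded_2functor_zero[OF E.T.graded_2functor_axioms m E.C.Hom2_group[OF m]]
        E.D.Hom2_group[OF m[unfolded E.same_Mor]] by simp
    thus ?case by (simp only: U.cell_Ze[folded UU_def] R.cell_Ze[folded UR_def])
  next
    case (Ad s t)
    have m: "wrd (tdom s) \<in> Mor ?UU (snd (tdom s)) (tgt (tdom s))" "wrd (tcod s) \<in> Mor ?UU (snd (tdom s)) (tgt (tdom s))"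
      using wft_parallel[of basic_gens s] Ad.prems by (auto intro: mor)
    have c: "Ucell s \<in> Cells UU (wrd (tdom s)) (wrd (tcod s))" "Ucell t \<in> Cells UU (wrd (tdom s)) (wrd (tcod s))"
      using Ad.prems by (auto intro: cl)
    have IH: "\<Theta> (Ucell s) = URcell s" "\<Theta> (Ucell t) = URcell t" using Ad by auto
    show ?case
      unfolding U.cell_Ad[OF mono(1)[OF Ad.prems], folded UU_def] R.cell_Ad[OF mono(2)[OF Ad.prems], folded UR_def]
      using E.T.fcell_add[OF m c] by (simp only: fun2_on_cells_simps IH)
  next
    case (Sm r t)
    have m: "wrd (tdom t) \<in> Mor ?UU (snd (tdom t)) (tgt (tdom t))" "wrd (tcod t) \<in> Mor ?UU (snd (tdom t)) (tgt (tdom t))"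
      using wft_parallel[of basic_gens t] Sm.prems by (auto intro: mor)
    have w: "wft basic_gens t" using Sm.prems by simp
    show ?case
      unfolding U.cell_Sm[OF mono(1)[OF w], folded UU_def] R.cell_Sm[OF mono(2)[OF w], folded UR_def]
      using E.T.fcell_smult[OF m cl[OF w HOL.refl HOL.refl]] by (simp only: fun2_on_cells_simps Sm.IH[OF w])
  next
    case (Vc s t)
    have m: "wrd (tdom t) \<in> Mor ?UU (snd (tdom t)) (tgt (tdom t))" "wrd (tcod t) \<in> Mor ?UU (snd (tdom t)) (tgt (tdom t))"
      "wrd (tcod s) \<in> Mor ?UU (snd (tdom t)) (tgt (tdom t))"
      using wft_parallel[of basic_gens t] wft_parallel[of basic_gens s] Vc.prems by (auto intro: mor)
    have c: "Ucell t \<in> Cells UU (wrd (tdom t)) (wrd (tcod t))" "Ucell s \<in> Cells UU (wrd (tcod t)) (wrd (tcod s))"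
      using Vc.prems by (auto intro: cl)
    have IH: "\<Theta> (Ucell s) = URcell s" "\<Theta> (Ucell t) = URcell t" using Vc by auto
    show ?case
      unfolding U.cell_Vc[OF mono(1)[OF Vc.prems], folded UU_def] R.cell_Vc[OF mono(2)[OF Vc.prems], folded UR_def]
      using E.T.fcell_Vcomp[OF m c] by (simp only: fun2_on_cells_simps IH)
  next
    case (Hc s t)
    have m: "wrd (tdom t) \<in> Mor ?UU (snd (tdom t)) (tgt (tdom t))" "wrd (tcod t) \<in> Mor ?UU (snd (tdom t)) (tgt (tdom t))"
      "wrd (tdom s) \<in> Mor ?UU (tgt (tdom t)) (tgt (tdom s))" "wrd (tcod s) \<in> Mor ?UU (tgt (tdom t)) (tgt (tdom s))"
      using wft_parallel[of basic_gens t] wft_parallel[of basic_gens s] Hc.prems by (auto intro!: mor)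
    have c: "Ucell t \<in> Cells UU (wrd (tdom t)) (wrd (tcod t))" "Ucell s \<in> Cells UU (wrd (tdom s)) (wrd (tcod s))"
      using Hc.prems by (auto intro: cl)
    have IH: "\<Theta> (Ucell s) = URcell s" "\<Theta> (Ucell t) = URcell t" using Hc by auto
    show ?case
      unfolding U.cell_Hc[OF mono(1)[OF Hc.prems], folded UU_def] R.cell_Hc[OF mono(2)[OF Hc.prems], folded UR_def]
      using E.\<Theta>_Hcomp[OF m c] by (simp only: IH)
  qed
qed

section \<open>2-functors out of the 2-category of Khovanov and Lauda\<close>

text \<open>
  The differential of \<open>UU\<close>, carried over to \<open>UR\<close> along \<open>\<Theta>\<close>, takes the prescribed values on \<open>x\<close>, \<open>\<tau>\<close>, \<open>\<eta>\<close>, \<open>\<epsilon>\<close>,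
  because these values are linear combinations of composites of generators matched by \<open>\<Theta>\<close>. The hypotheses on \<open>\<Phi>\<close> thus say that
  the defect of \<open>\<Phi>\<close> vanishes on the four families and on the structure maps of sums and shifts.
\<close>

theorem theorem5p12:
  fixes p :: nat
    and K :: "('o, 'f, 'a, 'k::field) gr2cat" and \<delta>K :: "'a \<Rightarrow> 'a"
    and \<delta>U :: "'k mor2 \<Rightarrow> 'k mor2" and \<Theta> :: "'k mor2 \<Rightarrow> 'k mor2"
    and \<Phi> :: "(int, mor1, 'k mor2, 'o, 'f, 'a) fun2"
  assumes char: "p > 0" "CHAR('k) = p"
    and K: "pdg_2cat p K \<delta>K"
    and \<delta>U: "U_differential p \<delta>U"
    and \<Theta>: "matching_equivalence \<Theta>"
    and \<Phi>: "graded_2functor UR K \<Phi>" "closed_coherence UR K \<delta>K \<Phi>" "closed_sums_shifts UR_base K \<delta>K \<Phi>"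
    and \<Phi>_Dot: "\<And>m. \<delta>K (fcell \<Phi> (URcell (Gen (Dot m)))) = fcell \<Phi> (URcell (Dot_sq m))"
    and \<Phi>_Cross: "\<And>m. \<delta>K (fcell \<Phi> (URcell (Gen (Cross m)))) = fcell \<Phi> (URcell (d_Cross m))"
    and \<Phi>_Eps: "\<And>m. \<delta>K (fcell \<Phi> (URcell (Gen (Epsilon m)))) =
      of_int (m + 1) \<odot>\<^bsub>Hom2 K (fmor \<Phi> (wrd ([\<F>, \<E>], m))) (fmor \<Phi> (wrd ([], m)))\<^esub> fcell \<Phi> (URcell (Eps_Dot m))"
    and \<Phi>_Eta: "\<And>m. \<delta>K (fcell \<Phi> (URcell (Gen (Eta m)))) =
      of_int (1 - m) \<odot>\<^bsub>Hom2 K (fmor \<Phi> (wrd ([], m))) (fmor \<Phi> (wrd ([\<E>, \<F>], m)))\<^esub> fcell \<Phi> (URcell (Dot_Eta m))"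
  shows "pdg_2functor UU \<delta>U K \<delta>K (transport \<Theta> \<Phi>)"
proof -
  let ?UU = "UU :: (int, mor1, 'k mor2, 'k) gr2cat"
  interpret E: equivalence_on_cells UU UR \<Theta> by (rule matching_equivalence_on_cells[OF \<Theta>])
  interpret U: typed_presentation U_gens "U_rels :: ('k trm \<times> 'k trm) set" by (rule U_presentation)
  interpret R: typed_presentation UR_gens "UR_rels :: ('k trm \<times> 'k trm) set" by (rule UR_presentation)
  interpret K: pdg_2cat p K \<delta>K by (rule K)
  interpret \<Phi>: graded_2functor UR K \<Phi> by (rule \<Phi>(1))
  let ?\<delta> = "E.transported \<delta>U"
  note dU = \<delta>U[unfolded U_differential_def] and M = \<Theta>[unfolded matching_equivalence_def]
  have dU_derivation: "derivation UU \<delta>U" using dU p_differential_derivation by blast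
  interpret d: derivation UR ?\<delta> by (rule E.derivation_transported[OF dU_derivation])
  have mor: "wrd f \<in> Mor ?UU a b" if "snd f = a" "tgt f = b" for f a b
    using U.Mor_wrd[of f] that by (simp add: UU_def)
  note morR = mor[unfolded E.same_Mor]
  have U_closed: "Ucell t \<in> Cells UU (wrd (tdom t)) (wrd (tcod t))" if "wft basic_gens t" for t :: "'k trm"
    using U.cell_Cells[OF wft_mono[OF that basic_gens_subset(1)]] by (simp add: UU_def)
  have R_closed: "URcell t \<in> Cells UR (wrd (tdom t)) (wrd (tcod t))" if "wft basic_gens t" for t :: "'k trm"
    using R.cell_Cells[OF wft_mono[OF that basic_gens_subset(2)]] by (simp add: UR_def)
  have d_cell: "?\<delta> (URcell t) = \<Theta> (\<delta>U (Ucell t))" if t: "wft basic_gens t" for t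
  proof -
    have "wrd (tdom t) \<in> Mor ?UU (snd (tdom t)) (tgt (tdom t))" "wrd (tcod t) \<in> Mor ?UU (snd (tdom t)) (tgt (tdom t))"
      using wft_parallel[OF t] by (auto intro: mor)
    from E.transported_image[OF this U_closed[OF t], of \<delta>U] show ?thesis
      by (simp only: matching_equivalence_cell[OF \<Theta> t])
  qed
  have basic: "wft basic_gens (Gen (Dot m))" "wft basic_gens (Gen (Cross m))" "wft basic_gens (Gen (Eta m))"
    "wft basic_gens (Gen (Epsilon m))" "wft basic_gens (Dot_sq m)" "wft basic_gens (d_Cross m)"
    "wft basic_gens (Dot_Eta m)" "wft basic_gens (Eps_Dot m)" for m
    by (auto simp: basic_gens_def Dot_sq_def d_Cross_def Dot_Eta_def Eps_Dot_def wcomp_def tgt_def)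
  have type: "tdom (Dot_Eta m) = ([], m)" "tcod (Dot_Eta m) = ([\<E>, \<F>], m)"
    "tdom (Eps_Dot m) = ([\<F>, \<E>], m)" "tcod (Eps_Dot m) = ([], m)" for m
    by (auto simp: Dot_Eta_def Eps_Dot_def wcomp_def)
  have image_zero: "fcell \<Phi> (\<Theta> \<zero>\<^bsub>Hom2 UU A B\<^esub>) = \<zero>\<^bsub>Hom2 K (fmor \<Phi> A) (fmor \<Phi> B)\<^esub>"
    if "A \<in> Mor ?UU a b" "B \<in> Mor ?UU a b" for A B a b
  proof -
    note m = that that[unfolded E.same_Mor]
    note g = E.C.Hom2_group[OF m(1,2)] E.D.Hom2_group[OF m(3,4)]
      K.abelian_Hom2[OF \<Phi>.fmor_closed[OF m(3)] \<Phi>.fmor_closed[OF m(4)]]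
    show ?thesis
      using graded_2functor_zero[OF E.T.graded_2functor_axioms m(1,2) g(1)] g(2)
        graded_2functor_zero[OF \<Phi>(1) m(3,4) g(2,3)] by simp
  qed
  interpret C: presented_comparison UR_gens UR_rels ?\<delta> K \<delta>K \<Phi>
  proof (intro presented_comparison.intro matrix_comparison.intro derivation_comparison.intro, unfold UR_def[symmetric])
    show "typed_presentation UR_gens (UR_rels :: ('k trm \<times> 'k trm) set)" by (rule UR_presentation)
    show "linear_2cat_part (UR_base :: (int, word, 'k trm set, 'k) gr2cat)"
      by (rule R.presented_linear_2cat_part)
    show "linear_2cat_part (UR :: (int, mor1, 'k mor2, 'k) gr2cat)" by (rule linear_2cat_part_UR)
    show "derivation UR ?\<delta>" by (rule d.derivation_axioms)
    show "graded_2cat K" by (rule K.graded_2cat_axioms)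
    show "derivation K \<delta>K" by (rule p_differential_derivation[OF K.p_differential_axioms])
    show "graded_2functor UR K \<Phi>" by (rule \<Phi>(1))
    show "derivation_comparison_axioms UR K \<delta>K \<Phi>" by (rule derivation_comparison_axioms.intro) (rule \<Phi>(2))
    show "matrix_comparison_axioms UR_base ?\<delta> \<delta>K \<Phi>"
    proof (rule matrix_comparison_axioms.intro, unfold UR_def[symmetric])
      fix A :: mor1 and a b i
      assume A: "A \<in> Mor (UR :: (int, mor1, 'k mor2, 'k) gr2cat) a b" and i: "i < rk A"
      note AU = A[folded E.same_Mor]
      let ?S = "(a, b, [snd (snd A) ! i])"
      note Ui = U.presented_linear_2cat_part AU[unfolded UU_def] i
      have "?S \<in> Mor ?UU a b"
        unfolding linear_2cat_part.summand_eq[OF Ui] UU_def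
        by (rule linear_2cat_part.single_Mor[OF Ui(1) linear_2cat_part.summand_Mor[OF Ui]])
      note S = this this[unfolded E.same_Mor]
      have "(incl U_base A i :: 'k mor2) \<in> Cells UU ?S A"
        using linear_2cat_part.incl_Cells[OF Ui] unfolding UU_def .
      hence "?\<delta> (incl UR_base A i) = \<Theta> (\<delta>U (incl U_base A i))"
        using E.transported_image[OF S(1) AU, of "incl U_base A i" \<delta>U] M AU i by simp
      also have "\<delta>U (incl U_base A i) = \<zero>\<^bsub>Hom2 UU ?S A\<^esub>" using dU AU i by blast
      finally have "fcell \<Phi> (?\<delta> (incl UR_base A i)) = \<zero>\<^bsub>Hom2 K (fmor \<Phi> ?S) (fmor \<Phi> A)\<^esub>"
        using image_zero[OF S(1) AU] by simp
      thus "\<delta>K (fcell \<Phi> (incl UR_base A i)) = fcell \<Phi> (?\<delta> (incl UR_base A i))"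
        using \<Phi>(3) A i unfolding closed_sums_shifts_def UR_def by simp
    next
      fix f a b and n :: int assume f: "f \<in> Mor (UR_base :: (int, word, 'k trm set, 'k) gr2cat) a b"
      hence ab: "snd f = a" "tgt f = b" by (simp_all add: R.Mor_P)
      have fU: "f \<in> Mor (U_base :: (int, word, 'k trm set, 'k) gr2cat) a b" using ab by (simp add: U.Mor_P)
      let ?S = "(a, b, [(0 :: int, f)])" and ?T = "(a, b, [(n, f)])"
      have "?S \<in> Mor ?UU a b" "?T \<in> Mor ?UU a b"
        using linear_2cat_part.single_Mor[OF U.presented_linear_2cat_part fU] by (simp_all add: UU_def)
      note S = this
      have "(shift_iso U_base a b n f :: 'k mor2) \<in> Cells UU ?S ?T"
        using linear_2cat_part.shift_iso_Cells[OF U.presented_linear_2cat_part fU] by (simp add: UU_def)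
      hence "?\<delta> (shift_iso UR_base a b n f) = \<Theta> (\<delta>U (shift_iso U_base a b n f))"
        using E.transported_image[OF S, of "shift_iso U_base a b n f" \<delta>U] M[THEN conjunct2, THEN conjunct2, THEN conjunct2, THEN conjunct1, rule_format, of f n] ab by simp
      also have "\<delta>U (shift_iso U_base a b n f) = \<zero>\<^bsub>Hom2 UU ?S ?T\<^esub>"
        using dU[THEN conjunct2, THEN conjunct2, THEN conjunct1, rule_format, of f n] ab by (simp add: wrd_def)
      finally have "fcell \<Phi> (?\<delta> (shift_iso UR_base a b n f)) = \<zero>\<^bsub>Hom2 K (fmor \<Phi> ?S) (fmor \<Phi> ?T)\<^esub>"
        using image_zero[OF S] by simp
      thus "\<delta>K (fcell \<Phi> (shift_iso UR_base a b n f)) = fcell \<Phi> (?\<delta> (shift_iso UR_base a b n f))"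
        using \<Phi>(3) f unfolding closed_sums_shifts_def by simp
    qed
  qed
  interpret C: rouquier_comparison ?\<delta> K \<delta>K \<Phi>
  proof (intro rouquier_comparison.intro rouquier_comparison_axioms.intro C.presented_comparison_axioms,
      unfold C.commutes_def)
    fix m
    show "\<delta>K (C.img (Gen (Dot m))) = fcell \<Phi> (?\<delta> (URcell (Gen (Dot m))))"
      using dU \<Phi>_Dot by (simp add: d_cell[OF basic(1)] matching_equivalence_cell[OF \<Theta> basic(5)])
    show "\<delta>K (C.img (Gen (Cross m))) = fcell \<Phi> (?\<delta> (URcell (Gen (Cross m))))"
      using dU \<Phi>_Cross by (simp add: d_cell[OF basic(2)] matching_equivalence_cell[OF \<Theta> basic(6)])
    have 1: "wrd ([], m) \<in> Mor ?UU m m" and EF: "wrd ([\<E>, \<F>], m) \<in> Mor ?UU m m" and FE: "wrd ([\<F>, \<E>], m) \<in> Mor ?UU m m"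
      by (auto intro!: mor simp: tgt_def)
    note R = 1[unfolded E.same_Mor] EF[unfolded E.same_Mor] FE[unfolded E.same_Mor]
    have "?\<delta> (URcell (Gen (Eta m))) = \<Theta> (of_int (1 - m) \<odot>\<^bsub>Hom2 UU (wrd ([], m)) (wrd ([\<E>, \<F>], m))\<^esub> Ucell (Dot_Eta m))"
      using dU by (simp add: d_cell[OF basic(3)])
    also have "\<dots> = of_int (1 - m) \<odot>\<^bsub>Hom2 UR (wrd ([], m)) (wrd ([\<E>, \<F>], m))\<^esub> URcell (Dot_Eta m)"
      using E.T.fcell_smult[OF 1 EF U_closed[OF basic(7)[of m], unfolded type]]
      by (simp add: matching_equivalence_cell[OF \<Theta> basic(7)])
    finally show "\<delta>K (C.img (Gen (Eta m))) = fcell \<Phi> (?\<delta> (URcell (Gen (Eta m))))"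
      using \<Phi>.fcell_smult[OF R(1,2) R_closed[OF basic(7)[of m], unfolded type]] by (simp only: \<Phi>_Eta)
    have "?\<delta> (URcell (Gen (Epsilon m))) = \<Theta> (of_int (m + 1) \<odot>\<^bsub>Hom2 UU (wrd ([\<F>, \<E>], m)) (wrd ([], m))\<^esub> Ucell (Eps_Dot m))"
      using dU by (simp add: d_cell[OF basic(4)])
    also have "\<dots> = of_int (m + 1) \<odot>\<^bsub>Hom2 UR (wrd ([\<F>, \<E>], m)) (wrd ([], m))\<^esub> URcell (Eps_Dot m)"
      using E.T.fcell_smult[OF FE 1 U_closed[OF basic(8)[of m], unfolded type]]
      by (simp add: matching_equivalence_cell[OF \<Theta> basic(8)])
    finally show "\<delta>K (C.img (Gen (Epsilon m))) = fcell \<Phi> (?\<delta> (URcell (Gen (Epsilon m))))"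
      using \<Phi>.fcell_smult[OF R(3,1) R_closed[OF basic(8)[of m], unfolded type]] by (simp only: \<Phi>_Eps)
  qed
  show ?thesis
    unfolding pdg_2functor_def
  proof (intro conjI allI ballI)
    show "graded_2functor UU K (transport \<Theta> \<Phi>)" by (rule E.transport_functor[OF \<Phi>(1)])
    show "closed_coherence UU K \<delta>K (transport \<Theta> \<Phi>)"
      using \<Phi>(2) unfolding closed_coherence_def by (simp add: E.same_Objs E.same_Mor E.same_Comp1 E.same_Unit1)
    fix a b A B \<alpha> assume m: "A \<in> Mor ?UU a b" "B \<in> Mor ?UU a b" and \<alpha>: "\<alpha> \<in> Cells ?UU A B"
    have "\<Theta> \<alpha> \<in> Cells UR A B" using E.T.fcell_closed[OF m \<alpha>] by simp
    hence "\<delta>K (fcell \<Phi> (\<Theta> \<alpha>)) = fcell \<Phi> (?\<delta> (\<Theta> \<alpha>))"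
      using C.commutes_if_generators_commute[OF C.commutes_generator, folded UR_def, OF _ m[unfolded E.same_Mor]] by blast
    thus "\<delta>K (fcell (transport \<Theta> \<Phi>) \<alpha>) = fcell (transport \<Theta> \<Phi>) (\<delta>U \<alpha>)"
      by (simp add: E.transported_image[OF m \<alpha>])
  qed
qed

end
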